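(* Let $X_{mn}=(x_{ij})$ be a generic $m\times n$ matrix (its entries are $mn$ distinct indeterminates) and let $I_{mn}\subset\mathbb{K}[x_{ij}]$ be the ideal generated by the $2\times2$ minors of $X_{mn}$. Then $I_{mn}$ is differentially perfect.
   Context: $\mathbb{K}$ is an algebraically closed field and $R=\mathbb{K}[\mathbf{x}]$ is the polynomial ring in the entries of the matrix. Symbolic power: $I^{(r)}=(R_I^{-1}I^r)\cap R$, where $R_I$ is the complement of the union of the minimal primes of $I$. Join and secant ideals: $I\ast J=\big(I(\mathbf{y})+J(\mathbf{z})+\langle x_a-y_a-z_a\mid a\rangle\big)\cap\mathbb{K}[\mathbf{x}]$ ($a$ running over the indices of the variables), where $I(\mathbf{y})$ is $I$ with $y_a$ substituted for $x_a$; the $r$-th secant ideal is the $r$-fold join $I^{\{r\}}=I\ast\cdots\ast I$ (so $I^{\{1\}}=I$). An ideal $I$ is $r$-differentially perfect if for all $s\ge1$, $(I^{\{r\}})^{(s)}=I^{\{r+s-1\}}+\sum_{i=1}^{s-1}(I^{\{r\}})^{(i)}(I^{\{r\}})^{(s-i)}$; it is differentially perfect if it is $r$-differentially perfect for all $r\ge1$. *)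

theory Defs
  imports
    "HOL-Analysis.Analysis"
    "HOL-Algebra.Ideal_Product"
    "HOL-Algebra.Algebraic_Closure_Type"
    "HOL-Library.Poly_Mapping"
    "HOL-Library.Set_Algebras"
begin

section \<open>Polynomial rings and their ideals\<close>

text \<open>
  \<open>('v, 'a) mpoly\<close> is the polynomial ring over \<open>'a\<close> in the variables indexed by \<open>'v\<close>:
  a finitely supported map from monomials (finitely supported exponent vectors) to
  coefficients.
\<close>

type_synonym ('v, 'a) mpoly = "('v \<Rightarrow>\<^sub>0 nat) \<Rightarrow>\<^sub>0 'a"

definition Const :: "'a::comm_ring_1 \<Rightarrow> ('v, 'a) mpoly" where
  "Const c = Poly_Mapping.single 0 c"

definition Var :: "'v \<Rightarrow> ('v, 'a::comm_ring_1) mpoly" where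
  "Var v = Poly_Mapping.single (Poly_Mapping.single v 1) 1"

definition poly_subst ::
    "('v \<Rightarrow> ('w, 'a::comm_ring_1) mpoly) \<Rightarrow> ('v, 'a) mpoly \<Rightarrow> ('w, 'a) mpoly" where
  "poly_subst \<sigma> p =
    (\<Sum>m\<in>Poly_Mapping.keys p. Const (Poly_Mapping.lookup p m) *
      (\<Prod>v\<in>Poly_Mapping.keys m. \<sigma> v ^ Poly_Mapping.lookup m v))"

text \<open>
  Ideals are those of HOL-Algebra, in the ring whose carrier is the whole type.  On sets, \<open>+\<close>
  and \<open>\<Sum>\<close> are elementwise (Set\_Algebras), which for ideals is the sum of ideals; the empty
  sum is the zero ideal.  The elementwise product of sets is \<^emph>\<open>not\<close> the product of ideals
  and is not used.
\<close>

abbreviation type_ring :: "'r::comm_ring_1 ring" where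
  "type_ring \<equiv> ring_of_type_algebra"

abbreviation generated_ideal :: "'r::comm_ring_1 set \<Rightarrow> 'r set" where
  "generated_ideal S \<equiv> genideal type_ring S"

abbreviation ideal_times :: "'r::comm_ring_1 set \<Rightarrow> 'r set \<Rightarrow> 'r set" where
  "ideal_times I J \<equiv> ideal_prod type_ring I J"

abbreviation ideal_power :: "'r::comm_ring_1 set \<Rightarrow> nat \<Rightarrow> 'r set" where
  "ideal_power I r \<equiv> I [^]\<^bsub>ideals_set type_ring\<^esub> r"


section \<open>Symbolic powers\<close>

definition minimal_primes :: "'r::comm_ring_1 set \<Rightarrow> 'r set set" where
  "minimal_primes I =
    {P. primeideal P type_ring \<and> I \<subseteq> P \<and>
        (\<forall>Q. primeideal Q type_ring \<and> I \<subseteq> Q \<and> Q \<subseteq> P \<longrightarrow> Q = P)}"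

text \<open>
  The contraction to the ring of the extension of \<open>I^r\<close> to the localization at the
  complement of the union of the minimal primes of \<open>I\<close>: the elements \<open>f\<close> with
  \<open>f / 1 = g / s\<close> for some \<open>g\<close> in \<open>I^r\<close> and some denominator \<open>s\<close>.  Clearing denominators,
  this means that some denominator multiplies \<open>f\<close> into \<open>I^r\<close>.
\<close>

definition symbolic_power :: "'r::comm_ring_1 set \<Rightarrow> nat \<Rightarrow> 'r set" where
  "symbolic_power I r =
    {f. \<exists>s \<in> - \<Union> (minimal_primes I). s * f \<in> ideal_power I r}"


section \<open>Joins and secant ideals\<close>

text \<open>The variables \<open>x\<^sub>a\<close>, \<open>y\<^sub>a\<close>, \<open>z\<^sub>a\<close> of the ring in which the elimination takes place.\<close>

datatype 'v join_var = JX 'v | JY 'v | JZ 'v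

definition join_ideal ::
    "('v, 'a::comm_ring_1) mpoly set \<Rightarrow> ('v, 'a) mpoly set \<Rightarrow> ('v, 'a) mpoly set" where
  "join_ideal I J =
    {f. poly_subst (\<lambda>a. Var (JX a)) f \<in>
          generated_ideal (poly_subst (\<lambda>a. Var (JY a)) ` I)
        + generated_ideal (poly_subst (\<lambda>a. Var (JZ a)) ` J)
        + generated_ideal (range (\<lambda>a. Var (JX a) - Var (JY a) - Var (JZ a)))}"

text \<open>
  The \<open>r\<close>-fold join, bracketed to the left; meaningful for \<open>r \<ge> 1\<close>.
\<close>

definition secant_ideal ::
    "('v, 'a::comm_ring_1) mpoly set \<Rightarrow> nat \<Rightarrow> ('v, 'a) mpoly set" where
  "secant_ideal I r = ((\<lambda>J. join_ideal J I) ^^ (r - 1)) I"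


section \<open>Differentially perfect ideals\<close>

definition r_differentially_perfect ::
    "nat \<Rightarrow> ('v, 'a::comm_ring_1) mpoly set \<Rightarrow> bool" where
  "r_differentially_perfect r I \<longleftrightarrow>
    (\<forall>s\<ge>1. symbolic_power (secant_ideal I r) s =
       secant_ideal I (r + s - 1) +
       (\<Sum>i = 1..s - 1. ideal_times (symbolic_power (secant_ideal I r) i)
                                   (symbolic_power (secant_ideal I r) (s - i))))"

definition differentially_perfect :: "('v, 'a::comm_ring_1) mpoly set \<Rightarrow> bool" where
  "differentially_perfect I \<longleftrightarrow> (\<forall>r\<ge>1. r_differentially_perfect r I)"


section \<open>The generic matrix and its 2-minors\<close>

definition generic_matrix :: "('m::finite \<times> 'n::finite, 'a::comm_ring_1) mpoly ^ 'n ^ 'm" where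
  "generic_matrix = (\<chi> i j. Var (i, j))"

text \<open>
  A 2-minor is given by two distinct rows and two distinct columns, in either order; the
  order only affects the sign, hence not the ideal generated.
\<close>

definition minors2 :: "'r::comm_ring_1 ^ 'n ^ 'm \<Rightarrow> 'r set" where
  "minors2 M =
    {det ((\<chi> p q. M $ \<rho> p $ \<gamma> q) :: 'r ^ 2 ^ 2) |\<rho> \<gamma>. inj \<rho> \<and> inj \<gamma>}"

end

theory Submission
  imports Defs "Jordan_Normal_Form.Determinant"
begin

text \<open>
  The maximal minors \<open>p\<^sub>S\<close> of \<open>(X | 1)\<close>, for sets \<open>S\<close> of columns, are up to sign the minors of
  \<open>X\<close>; the size \<open>k(S)\<close> of the minor is the number of columns taken from \<open>X\<close>.  By the Pluecker
  relations every polynomial is a linear combination of standard products, in which the \<open>S\<close> form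
  a chain.  Substitute \<open>X = L\<^sup>-\<^sup>1 Z\<close> with \<open>L\<close> generic lower unitriangular and \<open>Z\<close> generic: as
  \<open>L (X | 1) = (Z | L)\<close> and \<open>det L = 1\<close>, the \<open>p\<^sub>S\<close> become the maximal minors of \<open>(Z | L)\<close>, and
  standard products of the same length acquire distinct leading monomials.  The order in the
  variables of the rows \<open>i \<ge> r\<close> of \<open>Z\<close> is a valuation, and it equals \<open>\<Sum> max 0 (k(S) - r)\<close> both
  on a standard product and on its leading monomial.  Hence the polynomials of order at least
  \<open>s\<close> are spanned by the products of minors with \<open>\<Sum> max 0 (k(S) - r) \<ge> s\<close>.

  For \<open>s = 1\<close> this is a prime ideal, generated by the \<open>(r + 1)\<close>-minors, and it is the \<open>r\<close>-th
  secant ideal.  Multiplying a \<open>k\<close>-minor by suitable \<open>r\<close>-minors, which lie outside this prime,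
  puts it into the \<open>(k - r)\<close>-th power, so the polynomials of order at least \<open>s\<close> form the \<open>s\<close>-th
  symbolic power.  A product of minors of order at least \<open>s\<close> either contains a minor of size at
  least \<open>r + s\<close>, or it splits into two factors of positive orders \<open>i\<close> and \<open>s - i\<close>.
\<close>

section \<open>Ideals of a commutative ring\<close>

text \<open>In X alone, standard products are not separated by their leading monomials. For a 3 x 3
  matrix with indices 0, 1, 2, the determinant and the product of x_11 with the minor on rows and
  columns 0, 2 are both standard: as column sets of \<open>(X | 1)\<close> they are the chains 012,
  345 and 024, 135. Both have the main diagonal x_00 x_11 x_22 as leading monomial. The variables of
  L record which unit columns occur. L is unitriangular for two reasons: its adjugate inverts it
  without denominators, and the entry 1 is the last nonzero entry of each row of
  \<open>(Z | L)\<close>. An entry 1 leaves no trace in a monomial, but since it can stand at one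
  place only, its frequency is recovered from the fixed number of factors. Distinct leading
  monomials are what makes the order informative: otherwise products of low order could cancel, and
  the order of a sum would say nothing about its summands. Treating all minors of X as maximal
  minors of one matrix makes minors of different sizes comparable and lets a single family of
  quadratic relations straighten everything.\<close>

definition is_ideal :: "'r::comm_ring_1 set \<Rightarrow> bool" where
  "is_ideal I \<longleftrightarrow> 0 \<in> I \<and> (\<forall>a\<in>I. \<forall>b\<in>I. a + b \<in> I) \<and> (\<forall>r. \<forall>a\<in>I. r * a \<in> I)"

lemma is_idealI:
  assumes "0 \<in> I" "\<And>a b. a \<in> I \<Longrightarrow> b \<in> I \<Longrightarrow> a + b \<in> I" "\<And>r a. a \<in> I \<Longrightarrow> r * a \<in> I"
  shows "is_ideal I"
  using assms by (simp add: is_ideal_def)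

lemma is_idealD:
  assumes "is_ideal I"
  shows "0 \<in> I" "a \<in> I \<Longrightarrow> b \<in> I \<Longrightarrow> a + b \<in> I" "a \<in> I \<Longrightarrow> r * a \<in> I" "a \<in> I \<Longrightarrow> a * r \<in> I"
  using assms by (auto simp: is_ideal_def mult.commute[of _ r])

lemma is_ideal_uminus: "is_ideal I \<Longrightarrow> a \<in> I \<Longrightarrow> - a \<in> I"
  using is_idealD(3)[of I a "-1"] by simp

lemma is_ideal_sum: "is_ideal I \<Longrightarrow> (\<And>x. x \<in> A \<Longrightarrow> f x \<in> I) \<Longrightarrow> sum f A \<in> I"
  by (induction A rule: infinite_finite_induct) (auto simp: is_idealD)

lemma type_ring_simps [simp]:
  "carrier (type_ring :: 'r::comm_ring_1 ring) = UNIV"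
  "x \<oplus>\<^bsub>(type_ring :: 'r ring)\<^esub> y = x + y" "x \<otimes>\<^bsub>(type_ring :: 'r ring)\<^esub> y = x * y"
  "\<one>\<^bsub>(type_ring :: 'r ring)\<^esub> = 1" "\<zero>\<^bsub>(type_ring :: 'r ring)\<^esub> = 0"
  by (simp_all add: ring_of_type_algebra_def)

lemma a_inv_type_ring [simp]: "a_inv (type_ring :: 'r::comm_ring_1 ring) a = - a"
proof -
  interpret ring "type_ring :: 'r ring" by (rule ring_from_type_algebra)
  show ?thesis using minus_equality[of "-a" a] by simp
qed

lemma ideal_type_ring_iff: "ideal I (type_ring :: 'r::comm_ring_1 ring) \<longleftrightarrow> is_ideal I"
proof
  assume "ideal I (type_ring :: 'r ring)"
  then interpret ideal I "type_ring :: 'r ring" .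
  show "is_ideal I"
    using additive_subgroup.zero_closed[OF additive_subgroup_axioms]
      additive_subgroup.a_closed[OF additive_subgroup_axioms] I_l_closed by (simp add: is_ideal_def)
next
  assume I: "is_ideal I"
  show "ideal I (type_ring :: 'r ring)"
  proof (rule idealI)
    show "ring (type_ring :: 'r ring)" by (rule ring_from_type_algebra)
    show "subgroup I (add_monoid (type_ring :: 'r ring))"
    proof (intro group.subgroupI abelian_group.a_group ring.is_abelian_group ring_from_type_algebra)
      fix a assume "a \<in> I"
      then show "inv\<^bsub>add_monoid (type_ring :: 'r ring)\<^esub> a \<in> I"
        using is_ideal_uminus[OF I] by (simp only: a_inv_type_ring flip: a_inv_def)
    qed (use is_idealD[OF I] in auto)
  qed (use is_idealD[OF I] in auto)
qed

lemma is_ideal_generated: "is_ideal (generated_ideal S)"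
  using ring.genideal_ideal[OF ring_from_type_algebra, of S] by (simp add: ideal_type_ring_iff)

lemma generated_ideal_self: "S \<subseteq> generated_ideal S"
  using ring.genideal_self[OF ring_from_type_algebra, of S] by simp

lemma generated_ideal_subset: "is_ideal I \<Longrightarrow> S \<subseteq> I \<Longrightarrow> generated_ideal S \<subseteq> I"
  using ring.genideal_minimal[OF ring_from_type_algebra, of I S] by (simp add: ideal_type_ring_iff)

lemma is_ideal_plus:
  assumes "is_ideal I" "is_ideal J" shows "is_ideal (I + J)"
proof (rule is_idealI)
  show "0 \<in> I + J" using is_idealD(1)[OF assms(1)] is_idealD(1)[OF assms(2)]
    by (metis add_0 set_plus_intro)
next
  fix a b assume "a \<in> I + J" "b \<in> I + J"
  then obtain i j i' j' where "a = i + j" "b = i' + j'" "i \<in> I" "j \<in> J" "i' \<in> I" "j' \<in> J"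
    by (auto simp: set_plus_def)
  moreover have "i + j + (i' + j') = (i + i') + (j + j')" by simp
  ultimately show "a + b \<in> I + J"
    using is_idealD(2)[OF assms(1)] is_idealD(2)[OF assms(2)] by (metis set_plus_intro)
next
  fix r a assume "a \<in> I + J"
  then obtain i j where "a = i + j" "i \<in> I" "j \<in> J" by (auto simp: set_plus_def)
  then show "r * a \<in> I + J"
    using is_idealD(3)[OF assms(1)] is_idealD(3)[OF assms(2)]
    by (simp add: distrib_left set_plus_intro)
qed

lemma is_ideal_set_sum: "(\<And>i. i \<in> A \<Longrightarrow> is_ideal (B i)) \<Longrightarrow> is_ideal (\<Sum>i\<in>A. B i)"
proof (induction A rule: infinite_finite_induct)
  case (insert x F)
  then show ?case by (simp add: is_ideal_plus)
qed (auto simp: is_ideal_def)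

lemma subset_set_sum:
  assumes "finite A" "j \<in> A" "\<And>i. i \<in> A \<Longrightarrow> is_ideal (B i)"
  shows "B j \<subseteq> (\<Sum>i\<in>A. B i)"
proof -
  have "0 \<in> (\<Sum>i\<in>A - {j}. B i)"
    using assms by (intro is_idealD(1) is_ideal_set_sum) auto
  then show ?thesis
    using set_zero_plus2[of "\<Sum>i\<in>A - {j}. B i" "B j"] assms by (simp add: sum.remove add.commute)
qed

lemma set_sum_subset:
  assumes "is_ideal C" "\<And>i. i \<in> A \<Longrightarrow> B i \<subseteq> C"
  shows "(\<Sum>i\<in>A. B i) \<subseteq> C"
  using assms(2)
proof (induction A rule: infinite_finite_induct)
  case (insert x F)
  then have "B x \<subseteq> C" "(\<Sum>i\<in>F. B i) \<subseteq> C" by auto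
  moreover have "C + C \<subseteq> C" using is_idealD(2)[OF assms(1)] by (auto simp: set_plus_def)
  ultimately have "B x + (\<Sum>i\<in>F. B i) \<subseteq> C"
    using set_plus_mono2[of "B x" C "\<Sum>i\<in>F. B i" C] by (rule_tac order_trans)
  then show ?case by (simp only: sum.insert[OF insert.hyps] simp_thms)
qed (use is_idealD(1)[OF assms(1)] in \<open>simp_all add: set_zero\<close>)

lemma is_ideal_times: "is_ideal I \<Longrightarrow> is_ideal J \<Longrightarrow> is_ideal (ideal_times I J)"
  using ring.ideal_prod_is_ideal[OF ring_from_type_algebra, of I J] by (simp add: ideal_type_ring_iff)

lemma ideal_times_intro: "a \<in> I \<Longrightarrow> b \<in> J \<Longrightarrow> a * b \<in> ideal_times I J"
  using ideal_prod.prod[of a I b J type_ring] by simp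

lemma ideal_times_subset:
  assumes "is_ideal K" "\<And>a b. a \<in> I \<Longrightarrow> b \<in> J \<Longrightarrow> a * b \<in> K"
  shows "ideal_times I J \<subseteq> K"
proof
  fix x assume "x \<in> ideal_times I J"
  then show "x \<in> K"
    by induction (use assms is_idealD[OF assms(1)] in auto)
qed

lemma ideal_power_0: "ideal_power I 0 = UNIV"
  and ideal_power_Suc: "ideal_power I (Suc n) = ideal_times (ideal_power I n) I"
  by (simp_all add: nat_pow_def ideals_set_def)

lemma is_ideal_power: "is_ideal I \<Longrightarrow> is_ideal (ideal_power I n)"
proof (induction n)
  case 0
  show ?case by (simp only: ideal_power_0) (simp add: is_ideal_def)
next
  case (Suc n)
  then show ?case by (simp only: ideal_power_Suc is_ideal_times)
qed

lemma ideal_power_mult: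
  assumes I: "is_ideal I" and "a \<in> ideal_power I i" "b \<in> ideal_power I j"
  shows "a * b \<in> ideal_power I (i + j)"
  using assms(3)
proof (induction j arbitrary: b)
  case 0
  then show ?case using is_idealD(4)[OF is_ideal_power[OF I] assms(2)] by simp
next
  case (Suc j)
  \<comment> \<open>The elements that \<open>a\<close> multiplies into the power form an ideal, so
    it is enough to test the generating products \<open>x * y\<close>.\<close>
  have "is_ideal {b. a * b \<in> ideal_power I (i + Suc j)}"
    using is_idealD[OF is_ideal_power[OF I, of "i + Suc j"]]
    by (intro is_idealI) (auto simp: distrib_left mult.left_commute[of a])
  moreover have "a * (x * y) \<in> ideal_power I (i + Suc j)"
    if "x \<in> ideal_power I j" "y \<in> I" for x y
    using ideal_times_intro[OF Suc.IH[OF that(1)] that(2)]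
    by (simp only: add_Suc_right ideal_power_Suc mult.assoc)
  ultimately have "ideal_times (ideal_power I j) I \<subseteq> {b. a * b \<in> ideal_power I (i + Suc j)}"
    by (intro ideal_times_subset) auto
  then show ?case using Suc.prems by (auto simp only: ideal_power_Suc)
qed

lemma ideal_power_antimono:
  assumes I: "is_ideal I" and "i \<le> j" shows "ideal_power I j \<subseteq> ideal_power I i"
proof -
  have "ideal_power I (Suc n) \<subseteq> ideal_power I n" for n
    unfolding ideal_power_Suc
    by (intro ideal_times_subset is_ideal_power I) (auto intro: is_idealD(4)[OF is_ideal_power[OF I]])
  then show ?thesis using assms(2) lift_Suc_antimono_le[of "ideal_power I"] by blast
qed

lemma ideal_power_1: "is_ideal I \<Longrightarrow> a \<in> I \<Longrightarrow> a \<in> ideal_power I 1"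
  using ideal_times_intro[of 1 "ideal_power I 0" a I] ideal_power_Suc[of I 0] ideal_power_0[of I]
  by auto

section \<open>Polynomial substitution and joins\<close>

text \<open>Reduces statements about all polynomials to the generators of the algebra; powers of a
  variable, then monomials, then terms are assembled from them.\<close>

lemma mpoly_induct [case_names Const Var add mult]:
  fixes p :: "('v, 'a::comm_ring_1) mpoly"
  assumes Const: "\<And>c. P (Const c)" and Var: "\<And>v. P (Var v)"
    and add: "\<And>p q. P p \<Longrightarrow> P q \<Longrightarrow> P (p + q)" and mult: "\<And>p q. P p \<Longrightarrow> P q \<Longrightarrow> P (p * q)"
  shows "P p"
proof -
  have pow: "P (Poly_Mapping.single (Poly_Mapping.single v n) 1)" for v n
  proof (induction n)
    case 0
    show ?case using Const[of 1] by (simp add: Const_def)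
  next
    case (Suc n)
    have "Poly_Mapping.single (Poly_Mapping.single v (Suc n)) (1::'a) =
        Var v * Poly_Mapping.single (Poly_Mapping.single v n) 1"
      by (simp add: Var_def mult_single flip: single_add)
    then show ?case using Suc mult Var by metis
  qed
  have mon: "P (Poly_Mapping.single m 1)" for m
  proof (induction m rule: update_induct)
    case const
    show ?case using Const[of 1] by (simp add: Const_def)
  next
    case (update f a b)
    have "Poly_Mapping.update a b f = Poly_Mapping.single a b + f"
      using update(1) by (intro poly_mapping_eqI)
        (auto simp: lookup_update lookup_add lookup_single in_keys_iff when_def)
    then have "Poly_Mapping.single (Poly_Mapping.update a b f) (1::'a) =
        Poly_Mapping.single (Poly_Mapping.single a b) 1 * Poly_Mapping.single f 1"
      by (simp add: mult_single)
    then show ?case using update mult pow by metis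
  qed
  show ?thesis
  proof (induction p rule: update_induct)
    case const
    show ?case using Const[of 0] by (simp add: Const_def)
  next
    case (update f a b)
    have "Poly_Mapping.update a b f = Const b * Poly_Mapping.single a 1 + f"
      using update(1) by (intro poly_mapping_eqI)
        (auto simp: lookup_update lookup_add lookup_single in_keys_iff when_def Const_def mult_single)
    then show ?case using update add mult Const mon by metis
  qed
qed

lemma Const_hom:
  fixes a b :: "'a::comm_ring_1"
  shows "Const (0::'a) = 0" "Const (1::'a) = 1"
  "Const (a + b) = Const a + Const b" "Const (a * b) = Const a * Const b"
  "Const (- a) = - Const a"
  by (simp_all add: Const_def single_add mult_single single_uminus)

text \<open>Cancellation can make the support of a sum smaller than the union of the supports; a
  common larger index set turns additivity into a termwise identity.\<close>

lemma poly_subst_superset: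
  assumes "finite A" "Poly_Mapping.keys p \<subseteq> A"
  shows "poly_subst \<sigma> p = (\<Sum>m\<in>A. Const (Poly_Mapping.lookup p m) *
      (\<Prod>v\<in>Poly_Mapping.keys m. \<sigma> v ^ Poly_Mapping.lookup m v))"
  unfolding poly_subst_def using assms
  by (intro sum.mono_neutral_left) (auto simp: in_keys_iff Const_hom)

lemma poly_subst_add: "poly_subst \<sigma> (p + q) = poly_subst \<sigma> p + poly_subst \<sigma> q"
proof -
  let ?A = "Poly_Mapping.keys p \<union> Poly_Mapping.keys q"
  have "Poly_Mapping.keys (p + q) \<subseteq> ?A" by (rule Poly_Mapping.keys_add)
  then show ?thesis
    by (simp add: poly_subst_superset[of ?A] lookup_add Const_hom distrib_right sum.distrib)
qed

lemma poly_subst_single: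
  "poly_subst \<sigma> (Poly_Mapping.single m c) =
     Const c * (\<Prod>v\<in>Poly_Mapping.keys m. \<sigma> v ^ Poly_Mapping.lookup m v)"
  by (subst poly_subst_superset[of "{m}"]) auto

lemma mono_subst_add:
  fixes \<sigma> :: "'v \<Rightarrow> 'r::comm_ring_1"
  shows "(\<Prod>v\<in>Poly_Mapping.keys (m + n). \<sigma> v ^ Poly_Mapping.lookup (m + n) v) =
    (\<Prod>v\<in>Poly_Mapping.keys m. \<sigma> v ^ Poly_Mapping.lookup m v) *
    (\<Prod>v\<in>Poly_Mapping.keys n. \<sigma> v ^ Poly_Mapping.lookup n v)"
proof -
  let ?A = "Poly_Mapping.keys m \<union> Poly_Mapping.keys n"
  have *: "(\<Prod>v\<in>Poly_Mapping.keys k. \<sigma> v ^ Poly_Mapping.lookup k v) =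
      (\<Prod>v\<in>?A. \<sigma> v ^ Poly_Mapping.lookup k v)" if "Poly_Mapping.keys k \<subseteq> ?A" for k :: "'v \<Rightarrow>\<^sub>0 nat"
    using that by (intro prod.mono_neutral_left) (auto simp: in_keys_iff)
  show ?thesis
    unfolding *[OF Poly_Mapping.keys_add] *[OF Un_upper1] *[OF Un_upper2]
    by (simp add: lookup_add power_add prod.distrib)
qed

lemma poly_subst_mult: "poly_subst \<sigma> (p * q) = poly_subst \<sigma> p * poly_subst \<sigma> q"
proof -
  have single: "poly_subst \<sigma> (Poly_Mapping.single m c * q) =
      poly_subst \<sigma> (Poly_Mapping.single m c) * poly_subst \<sigma> q" for m c
  proof (induction q rule: update_induct)
    case const
    show ?case by (simp add: poly_subst_def)
  next
    case (update f a b)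
    have "Poly_Mapping.update a b f = Poly_Mapping.single a b + f"
      using update(1) by (intro poly_mapping_eqI)
        (auto simp: lookup_update lookup_add lookup_single in_keys_iff when_def)
    then show ?case
      using update by (simp add: distrib_left poly_subst_add mult_single poly_subst_single
        mono_subst_add Const_hom algebra_simps)
  qed
  show ?thesis
  proof (induction p rule: update_induct)
    case const
    show ?case by (simp add: poly_subst_def)
  next
    case (update f a b)
    have "Poly_Mapping.update a b f = Poly_Mapping.single a b + f"
      using update(1) by (intro poly_mapping_eqI)
        (auto simp: lookup_update lookup_add lookup_single in_keys_iff when_def)
    then show ?case using update by (simp add: distrib_right poly_subst_add single)
  qed
qed

lemma poly_subst_Const [simp]: "poly_subst \<sigma> (Const c) = Const c"
  unfolding Const_def by (simp only: poly_subst_single) (simp add: Const_def)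

lemma poly_subst_Var [simp]: "poly_subst \<sigma> (Var v) = \<sigma> v"
  unfolding Var_def by (simp add: poly_subst_single Const_hom)

interpretation poly_subst: comm_ring_hom "poly_subst \<sigma>"
  for \<sigma> :: "'v \<Rightarrow> ('w, 'a::comm_ring_1) mpoly"
proof
  show "poly_subst \<sigma> 1 = 1" using poly_subst_Const[of \<sigma> 1] by (simp only: Const_hom)
  show "poly_subst \<sigma> 0 = 0" by (simp add: poly_subst_def)
qed (rule poly_subst_add poly_subst_mult)+

lemma poly_subst_poly_subst:
  "poly_subst \<tau> (poly_subst \<sigma> p) = poly_subst (\<lambda>v. poly_subst \<tau> (\<sigma> v)) p"
  by (induction p rule: mpoly_induct) (simp_all add: poly_subst_add poly_subst_mult)

lemma poly_subst_generated:
  assumes "\<And>g. g \<in> S \<Longrightarrow> poly_subst \<sigma> g = 0" "f \<in> generated_ideal S"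
  shows "poly_subst \<sigma> f = 0"
proof -
  have "is_ideal {f. poly_subst \<sigma> f = 0}"
    by (intro is_idealI) (auto simp: poly_subst_add poly_subst_mult)
  from generated_ideal_subset[OF this, of S] show ?thesis using assms by blast
qed

text \<open>Joins vanish on sums of points: sending x to \<alpha> + \<beta>, y to \<alpha> and z to
  \<beta> kills the generators of all three summands of the elimination ideal.\<close>

lemma join_ideal_vanish:
  assumes I: "\<And>f. f \<in> I \<Longrightarrow> poly_subst \<alpha> f = 0" and J: "\<And>f. f \<in> J \<Longrightarrow> poly_subst \<beta> f = 0"
    and f: "f \<in> join_ideal I J"
  shows "poly_subst (\<lambda>a. \<alpha> a + \<beta> a) f = 0"
proof -
  define \<theta> where "\<theta> v = (case v of JX a \<Rightarrow> \<alpha> a + \<beta> a | JY a \<Rightarrow> \<alpha> a | JZ a \<Rightarrow> \<beta> a)" for v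
  obtain p q r where pqr: "poly_subst (\<lambda>a. Var (JX a)) f = p + q + r"
    "p \<in> generated_ideal (poly_subst (\<lambda>a. Var (JY a)) ` I)"
    "q \<in> generated_ideal (poly_subst (\<lambda>a. Var (JZ a)) ` J)"
    "r \<in> generated_ideal (range (\<lambda>a. Var (JX a) - Var (JY a) - Var (JZ a)))"
    using f by (auto simp: join_ideal_def set_plus_def)
  have "poly_subst \<theta> p = 0"
    by (rule poly_subst_generated[OF _ pqr(2)]) (auto simp: poly_subst_poly_subst \<theta>_def I)
  moreover have "poly_subst \<theta> q = 0"
    by (rule poly_subst_generated[OF _ pqr(3)]) (auto simp: poly_subst_poly_subst \<theta>_def J)
  moreover have "poly_subst \<theta> r = 0"
    by (rule poly_subst_generated[OF _ pqr(4)]) (auto simp: poly_subst.hom_minus \<theta>_def)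
  ultimately have "poly_subst \<theta> (poly_subst (\<lambda>a. Var (JX a)) f) = 0"
    by (simp add: pqr(1) poly_subst_add)
  then show ?thesis by (simp add: poly_subst_poly_subst \<theta>_def)
qed

lemma secant_ideal_Suc: "r \<ge> 1 \<Longrightarrow> secant_ideal I (Suc r) = join_ideal (secant_ideal I r) I"
  by (cases r) (simp_all add: secant_ideal_def)

text \<open>A substitution is a point with coordinates in a polynomial ring.\<close>

lemma secant_ideal_vanish:
  assumes "r \<ge> 1" "\<And>k f. k < r \<Longrightarrow> f \<in> I \<Longrightarrow> poly_subst (\<alpha> k) f = 0" "f \<in> secant_ideal I r"
  shows "poly_subst (\<lambda>a. \<Sum>k<r. \<alpha> k a) f = 0"
  using assms
proof (induction r arbitrary: f)
  case (Suc r)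
  show ?case
  proof (cases "r = 0")
    case True
    then show ?thesis using Suc.prems by (simp add: secant_ideal_def)
  next
    case False
    show ?thesis unfolding sum.lessThan_Suc
      by (rule join_ideal_vanish[of "secant_ideal I r"])
         (use False Suc secant_ideal_Suc[of r I] in \<open>auto simp: less_Suc_eq\<close>)
  qed
qed simp

lemma is_ideal_join: "is_ideal (join_ideal I J)"
proof -
  define A where "A = generated_ideal (poly_subst (\<lambda>a. Var (JY a)) ` I)
        + generated_ideal (poly_subst (\<lambda>a. Var (JZ a)) ` J)
        + generated_ideal (range (\<lambda>a. Var (JX a) - Var (JY a) - Var (JZ a) :: ('a join_var, 'b) mpoly))"
  have "is_ideal A" unfolding A_def by (intro is_ideal_plus is_ideal_generated)
  note A = is_idealD[OF this]
  show ?thesis unfolding join_ideal_def A_def[symmetric]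
    by (intro is_idealI) (auto simp: A poly_subst_add poly_subst_mult)
qed

lemma is_ideal_secant: "is_ideal I \<Longrightarrow> is_ideal (secant_ideal I r)"
  by (cases "r - 1") (simp_all add: secant_ideal_def is_ideal_join)

text \<open>For a prime ideal the denominators are exactly the elements outside it.\<close>

lemma symbolic_power_prime:
  assumes "is_ideal P" "1 \<notin> P" "\<forall>a b. a * b \<in> P \<longrightarrow> a \<in> P \<or> b \<in> P"
  shows "symbolic_power P s = {f. \<exists>g. g \<notin> P \<and> g * f \<in> ideal_power P s}"
proof -
  have "primeideal P type_ring"
    using assms by (intro primeidealI) (auto simp: ideal_type_ring_iff cring_from_type_algebra)
  then have "minimal_primes P = {P}" by (auto simp: minimal_primes_def)
  then show ?thesis by (auto simp: symbolic_power_def)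
qed

text \<open>Everything comes from multiplying denominators together; primality keeps the product
  outside \<open>P\<close>.\<close>

lemma symbolic_power_props:
  assumes "is_ideal P" "1 \<notin> P" "\<forall>a b. a * b \<in> P \<longrightarrow> a \<in> P \<or> b \<in> P"
  shows is_ideal_symbolic_power: "is_ideal (symbolic_power P s)"
    and symbolic_power_mult: "a \<in> symbolic_power P i \<Longrightarrow> b \<in> symbolic_power P j
       \<Longrightarrow> a * b \<in> symbolic_power P (i + j)"
    and symbolic_power_antimono: "i \<le> j \<Longrightarrow> symbolic_power P j \<subseteq> symbolic_power P i"
    and symbolic_power_cancel: "g * f \<in> symbolic_power P s \<Longrightarrow> g \<notin> P \<Longrightarrow> f \<in> symbolic_power P s"
    and symbolic_power_1: "a \<in> P \<Longrightarrow> a \<in> symbolic_power P 1"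
    and symbolic_power_0: "symbolic_power P 0 = UNIV"
proof -
  note S = symbolic_power_prime[OF assms]
  note I = is_idealD[OF is_ideal_power[OF assms(1)]]
  have prime: "\<And>a b. a * b \<in> P \<Longrightarrow> a \<in> P \<or> b \<in> P" using assms(3) by blast
  show "is_ideal (symbolic_power P s)"
  proof (rule is_idealI)
    show "0 \<in> symbolic_power P s" using assms(2) I(1) by (auto simp: S)
  next
    fix a b assume "a \<in> symbolic_power P s" "b \<in> symbolic_power P s"
    then obtain g h where gh: "g \<notin> P" "h \<notin> P" "g * a \<in> ideal_power P s" "h * b \<in> ideal_power P s"
      by (auto simp: S)
    have "(g * h) * (a + b) = h * (g * a) + g * (h * b)" by (simp add: algebra_simps)
    then have "(g * h) * (a + b) \<in> ideal_power P s" using gh I by metis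
    then show "a + b \<in> symbolic_power P s" using prime gh by (auto simp: S)
  next
    fix r a assume "a \<in> symbolic_power P s"
    then show "r * a \<in> symbolic_power P s" by (auto simp: S) (metis I(3) mult.left_commute)
  qed
  show "a \<in> symbolic_power P i \<Longrightarrow> b \<in> symbolic_power P j \<Longrightarrow> a * b \<in> symbolic_power P (i + j)"
  proof -
    assume "a \<in> symbolic_power P i" "b \<in> symbolic_power P j"
    then obtain g h where gh: "g \<notin> P" "h \<notin> P" "g * a \<in> ideal_power P i" "h * b \<in> ideal_power P j"
      by (auto simp: S)
    have "(g * h) * (a * b) = (g * a) * (h * b)" by (simp add: algebra_simps)
    then have "(g * h) * (a * b) \<in> ideal_power P (i + j)"
      using ideal_power_mult[OF assms(1) gh(3,4)] by metis
    then show "a * b \<in> symbolic_power P (i + j)" using prime gh by (auto simp: S)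
  qed
  show "i \<le> j \<Longrightarrow> symbolic_power P j \<subseteq> symbolic_power P i"
    using ideal_power_antimono[OF assms(1)] by (auto simp: S)
  show "g * f \<in> symbolic_power P s \<Longrightarrow> g \<notin> P \<Longrightarrow> f \<in> symbolic_power P s"
    using prime by (auto simp: S) (metis mult.assoc)
  show "a \<in> P \<Longrightarrow> a \<in> symbolic_power P 1"
    using ideal_power_1[OF assms(1)] I(3) assms(2) by (auto simp: S)
  show "symbolic_power P 0 = UNIV"
    using assms(2) ideal_power_0 by (auto simp: S)
qed

section \<open>Determinants\<close>

text \<open>The size is a number and the entries form a total function, so that minors, cofactors
  and bordered matrices of varying size arise by mere renumbering of indices.\<close>

definition fdet :: "nat \<Rightarrow> (nat \<Rightarrow> nat \<Rightarrow> 'r::comm_ring_1) \<Rightarrow> 'r" where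
  "fdet k f = Determinant.det (Matrix.mat k k (\<lambda>(i, j). f i j))"

lemma fdet_leibniz:
  "fdet k f = (\<Sum>p | p permutes {0..<k}. signof p * (\<Prod>i = 0..<k. f i (p i)))"
proof -
  have "(\<Prod>i = 0..<k. Matrix.mat k k (\<lambda>(i, j). f i j) $$ (i, p i)) = (\<Prod>i = 0..<k. f i (p i))"
    if "p permutes {0..<k}" for p
    using permutes_in_image[OF that] by (intro prod.cong) auto
  then show ?thesis
    unfolding fdet_def by (subst det_def'[of _ k]) (auto intro!: sum.cong)
qed

lemma fdet_cong:
  assumes "\<And>i j. i < k \<Longrightarrow> j < k \<Longrightarrow> f i j = g i j" shows "fdet k f = fdet k g"
  unfolding fdet_def by (rule arg_cong[where f = Determinant.det], rule eq_matI) (auto simp: assms)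

lemma fdet_0 [simp]: "fdet 0 f = 1"
  by (simp add: fdet_def)

lemma fdet_1: "fdet 1 f = f 0 0"
  unfolding fdet_def by (subst det_single) auto

lemma fdet_hom: "comm_ring_hom h \<Longrightarrow> h (fdet k f) = fdet k (\<lambda>i j. h (f i j))"
  unfolding fdet_def
  by (subst comm_ring_hom.hom_det[symmetric]) (auto intro!: arg_cong[where f = Determinant.det] eq_matI)

lemma fdet_transpose: "fdet k (\<lambda>i j. f j i) = fdet k f"
  unfolding fdet_def
  by (subst det_transpose[symmetric, where n = k]) (auto intro!: arg_cong[where f = Determinant.det] eq_matI)

lemma fdet_permute_rows:
  assumes "\<sigma> permutes {0..<k}" shows "fdet k (\<lambda>i. f (\<sigma> i)) = signof \<sigma> * fdet k f"
proof -
  have "Matrix.mat k k (\<lambda>(i, j). f (\<sigma> i) j) =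
      Matrix.mat k k (\<lambda>(i, j). Matrix.mat k k (\<lambda>(i, j). f i j) $$ (\<sigma> i, j))"
    using permutes_in_image[OF assms] by (intro eq_matI) auto
  then show ?thesis
    unfolding fdet_def using det_permute_rows[OF _ assms, of "Matrix.mat k k (\<lambda>(i, j). f i j)"] by simp
qed

lemma fdet_identical_rows:
  assumes "i < k" "j < k" "i \<noteq> j" "f i = f j" shows "fdet k f = 0"
  unfolding fdet_def
  by (rule Determinant.det_identical_rows[of _ k i j]) (use assms in \<open>auto intro!: eq_vecI\<close>)

lemma fdet_mult: "fdet k (\<lambda>i j. \<Sum>l<k. f i l * g l j) = fdet k f * fdet k g"
  unfolding fdet_def
  by (subst det_mult[symmetric, of _ k])
     (auto intro!: arg_cong[where f = Determinant.det] eq_matI sum.cong simp: scalar_prod_def atLeast0LessThan)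

lemma fdet_upper_unitriangular:
  assumes "\<And>i j. j < i \<Longrightarrow> i < k \<Longrightarrow> f i j = 0" "\<And>i. i < k \<Longrightarrow> f i i = 1"
  shows "fdet k f = 1"
proof -
  have "diag_mat (Matrix.mat k k (\<lambda>(i, j). f i j)) = replicate k 1"
    by (intro nth_equalityI) (auto simp: diag_mat_def assms(2))
  then show ?thesis
    unfolding fdet_def by (subst det_upper_triangular[of _ k]) (auto simp: assms(1))
qed

text \<open>The increasing enumeration of all numbers except \<open>i\<close>; composing with it
  deletes row or column \<open>i\<close>.\<close>

definition skip :: "nat \<Rightarrow> nat \<Rightarrow> nat" where
  "skip i a = (if a < i then a else Suc a)"

lemma skip_less: "a < k \<Longrightarrow> skip i a < Suc k" and skip_neq: "skip i a \<noteq> i"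
  by (auto simp: skip_def)

lemma inj_skip: "inj (skip i)"
  by (auto simp: inj_def skip_def split: if_splits)

lemma skip_cover:
  assumes "b \<noteq> i" shows "\<exists>a. skip i a = b"
proof (cases "b < i")
  case False
  then have "skip i (b - 1) = b" using assms by (auto simp: skip_def)
  then show ?thesis ..
qed (auto simp: skip_def)

definition fcof :: "nat \<Rightarrow> (nat \<Rightarrow> nat \<Rightarrow> 'r::comm_ring_1) \<Rightarrow> nat \<Rightarrow> nat \<Rightarrow> 'r" where
  "fcof k f i j = (-1) ^ (i + j) * fdet k (\<lambda>a b. f (skip i a) (skip j b))"

lemma cofactor_eq_fcof:
  "cofactor (Matrix.mat (Suc k) (Suc k) (\<lambda>(i, j). f i j)) i j = fcof k f i j"
  unfolding cofactor_def fcof_def fdet_def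
  by (auto intro!: arg_cong[where f = "\<lambda>x. _ * Determinant.det x"] eq_matI simp: mat_delete_def skip_def)

lemma fdet_laplace_row: "i < Suc k \<Longrightarrow> fdet (Suc k) f = (\<Sum>j<Suc k. f i j * fcof k f i j)"
  unfolding fdet_def
  by (subst laplace_expansion_row[of _ "Suc k" i]) (auto simp: cofactor_eq_fcof simp del: sum.lessThan_Suc)

lemma fdet_laplace_column: "j < Suc k \<Longrightarrow> fdet (Suc k) f = (\<Sum>i<Suc k. f i j * fcof k f i j)"
  unfolding fdet_def
  by (subst laplace_expansion_column[of _ "Suc k" j]) (auto simp: cofactor_eq_fcof simp del: sum.lessThan_Suc)

text \<open>Overwrite column \<open>j\<close> by column \<open>l\<close>: the cofactors along column
  \<open>j\<close> do not notice, and the new matrix has two equal columns.\<close>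

lemma fcof_column_orthogonal:
  assumes "j < Suc k" "l < Suc k" "j \<noteq> l"
  shows "(\<Sum>i<Suc k. f i l * fcof k f i j) = 0"
proof -
  define g where "g i c = (if c = j then f i l else f i c)" for i c
  have "fdet (Suc k) g = (\<Sum>i<Suc k. g i j * fcof k g i j)"
    by (rule fdet_laplace_column) (rule assms)
  also have "\<dots> = (\<Sum>i<Suc k. f i l * fcof k f i j)"
    using skip_neq[of j] by (intro sum.cong refl) (simp add: g_def fcof_def)
  finally have "(\<Sum>i<Suc k. f i l * fcof k f i j) = fdet (Suc k) (\<lambda>i c. g c i)"
    by (simp add: fdet_transpose[of _ g])
  also have "\<dots> = 0"
    by (rule fdet_identical_rows[of j _ l]) (use assms in \<open>auto simp: g_def\<close>)
  finally show ?thesis .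
qed

text \<open>Pigeonhole principle: no permutation maps \<open>R\<close> into the smaller set
  \<open>C\<close>, so every Leibniz term contains a zero entry.\<close>

lemma fdet_zero_block:
  assumes "R \<subseteq> {..<k}" "finite C" "card C < card R"
    and "\<And>i j. i \<in> R \<Longrightarrow> j < k \<Longrightarrow> j \<notin> C \<Longrightarrow> f i j = 0"
  shows "fdet k f = 0"
proof -
  have "(\<Prod>i = 0..<k. f i (p i)) = 0" if p: "p permutes {0..<k}" for p
  proof -
    have "\<not> p ` R \<subseteq> C"
    proof
      assume "p ` R \<subseteq> C"
      then have "card (p ` R) \<le> card C" using assms(2) by (rule card_mono[rotated])
      moreover have "card (p ` R) = card R"
        using permutes_inj[OF p] by (intro card_image) (auto intro: inj_on_subset)
      ultimately show False using assms(3) by simp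
    qed
    then obtain i where i: "i \<in> R" "p i \<notin> C" by auto
    then have "i < k" "p i < k" using assms(1) permutes_in_image[OF p] by auto
    then have "f i (p i) = 0" using assms(4) i by auto
    then show ?thesis using \<open>i < k\<close> by (intro prod_zero) auto
  qed
  then show ?thesis by (simp add: fdet_leibniz)
qed

text \<open>The matrix is the product of diag(first block, 1) and diag(1, second block), and unit
  rows are removed from each factor by Laplace expansion.\<close>

lemma fdet_block_diagonal:
  assumes "\<And>i j. i < a \<Longrightarrow> a \<le> j \<Longrightarrow> f i j = 0" "\<And>i j. a \<le> i \<Longrightarrow> j < a \<Longrightarrow> f i j = 0"
  shows "fdet (a + b) f = fdet a f * fdet b (\<lambda>i j. f (a + i) (a + j))"
proof -
  define F where "F i j = (if i < a \<and> j < a then f i j else if i = j then 1 else 0)" for i j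
  \<comment> \<open>The number \<open>c\<close> of leading unit rows is kept variable so that they
    can be removed one by one by induction; only \<open>c = a\<close> is used in the
    product.\<close>
  define G where "G c i j = (if c \<le> i \<and> c \<le> j then f (a + i - c) (a + j - c) else if i = j then 1 else 0)" for c i j
  have 1: "fdet (a + d) F = fdet a f" for d
  proof (induction d)
    case 0
    show ?case by (auto simp: F_def intro: fdet_cong)
  next
    case (Suc d)
    have "fdet (Suc (a + d)) F = (\<Sum>j<Suc (a + d). F (a + d) j * fcof (a + d) F (a + d) j)"
      by (rule fdet_laplace_row) simp
    also have "\<dots> = fcof (a + d) F (a + d) (a + d)"
      by (simp add: F_def)
    also have "\<dots> = fdet (a + d) F"
      by (auto simp: fcof_def skip_def intro: fdet_cong simp flip: mult_2)
    finally show ?case using Suc by simp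
  qed
  have 2: "fdet (c + b) (G c) = fdet b (\<lambda>i j. f (a + i) (a + j))" for c
  proof (induction c)
    case 0
    show ?case by (auto simp: G_def intro: fdet_cong)
  next
    case (Suc c)
    have "fdet (Suc (c + b)) (G (Suc c)) =
        (\<Sum>j<Suc (c + b). G (Suc c) 0 j * fcof (c + b) (G (Suc c)) 0 j)"
      by (rule fdet_laplace_row) simp
    also have "\<dots> = (\<Sum>j<Suc (c + b). if j = 0 then fcof (c + b) (G (Suc c)) 0 0 else 0)"
      by (intro sum.cong refl) (auto simp: G_def)
    also have "\<dots> = fcof (c + b) (G (Suc c)) 0 0"
      by (subst sum.delta) auto
    also have "\<dots> = fdet (c + b) (G c)"
      by (auto simp: fcof_def skip_def G_def intro: fdet_cong)
    finally show ?case using Suc by simp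
  qed
  have "fdet (a + b) f = fdet (a + b) (\<lambda>i j. \<Sum>l<a + b. F i l * G a l j)"
  proof (rule fdet_cong)
    fix i j assume ij: "i < a + b" "j < a + b"
    show "f i j = (\<Sum>l<a + b. F i l * G a l j)"
    proof (cases "i < a")
      case True
      have "(\<Sum>l<a + b. F i l * G a l j) = (\<Sum>l<a + b. if l = j then f i j else 0)"
        using True assms(1) by (intro sum.cong refl) (auto simp: F_def G_def)
      then show ?thesis using ij by simp
    next
      case False
      have "(\<Sum>l<a + b. F i l * G a l j) = (\<Sum>l<a + b. if l = i then f i j else 0)"
        using False assms(2) by (intro sum.cong refl) (auto simp: F_def G_def)
      then show ?thesis using ij by simp
    qed
  qed
  then show ?thesis by (simp add: fdet_mult 1 2)
qed

text \<open>Multilinearity applied to all rows at once. It serves twice: for the rows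
  \<open>(v, v)\<close> of the Pluecker matrix and for the matrix Y + Z in a join.\<close>

lemma fdet_add_rows:
  "fdet k (\<lambda>i j. f i j + g i j) = (\<Sum>P\<in>Pow {..<k}. fdet k (\<lambda>i. if i \<in> P then f i else g i))"
proof -
  have "(\<Prod>i = 0..<k. f i (p i) + g i (p i)) =
      (\<Sum>P\<in>Pow {..<k}. \<Prod>i = 0..<k. (if i \<in> P then f i else g i) (p i))" for p
    unfolding atLeast0LessThan
  proof (subst prod_add, simp, intro sum.cong refl)
    fix P assume "P \<in> Pow {..<k}"
    then show "(\<Prod>i\<in>P. f i (p i)) * (\<Prod>i\<in>{..<k} - P. g i (p i)) =
        (\<Prod>i<k. (if i \<in> P then f i else g i) (p i))"
      by (subst prod.subset_diff[of P]) (auto simp: mult.commute intro!: arg_cong2[where f = "(*)"] prod.cong)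
  qed
  then show ?thesis
    unfolding fdet_leibniz by (simp add: sum_distrib_left sum.swap[of _ "Pow {..<k}"])
qed

text \<open>Each Leibniz product telescopes. In a join this replaces the generic matrix X by Y + Z
  modulo the linear relations.\<close>

lemma fdet_cong_ideal:
  assumes I: "is_ideal I" and "\<And>i j. i < k \<Longrightarrow> j < k \<Longrightarrow> f i j - g i j \<in> I"
  shows "fdet k f - fdet k g \<in> I"
proof -
  have prod: "(\<Prod>i<n. f i (p i)) - (\<Prod>i<n. g i (p i)) \<in> I"
    if "\<And>i. i < n \<Longrightarrow> f i (p i) - g i (p i) \<in> I" for n p
    using that
  proof (induction n)
    case (Suc n)
    have "(\<Prod>i<Suc n. f i (p i)) - (\<Prod>i<Suc n. g i (p i)) =
        ((\<Prod>i<n. f i (p i)) - (\<Prod>i<n. g i (p i))) * f n (p n)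
        + (\<Prod>i<n. g i (p i)) * (f n (p n) - g n (p n))" by (simp add: algebra_simps)
    then show ?case using Suc is_idealD[OF I] by simp
  qed (simp add: is_idealD[OF I])
  have "(\<Prod>i = 0..<k. f i (p i)) - (\<Prod>i = 0..<k. g i (p i)) \<in> I" if "p permutes {0..<k}" for p
    unfolding atLeast0LessThan
    by (rule prod) (use assms(2) permutes_in_image[OF that] in auto)
  then show ?thesis
    unfolding fdet_leibniz sum_subtractf[symmetric] right_diff_distrib[symmetric]
    by (intro is_ideal_sum[OF I] is_idealD(3)[OF I]) auto
qed

text \<open>A weak form of generalised Laplace expansion: expanding along the rows outside
  \<open>R\<close> leaves a combination of minors whose rows are exactly \<open>R\<close>. The
  bijections \<open>\<rho>\<close> need not be increasing, which at most changes signs.\<close>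

lemma fdet_mem_ideal_rows:
  assumes I: "is_ideal I" and R: "R \<subseteq> {..<k}"
    and "\<And>\<rho> \<gamma>. inj_on \<rho> {..<card R} \<Longrightarrow> \<rho> ` {..<card R} = R \<Longrightarrow> inj_on \<gamma> {..<card R} \<Longrightarrow>
      \<gamma> ` {..<card R} \<subseteq> {..<k} \<Longrightarrow> fdet (card R) (\<lambda>a b. f (\<rho> a) (\<gamma> b)) \<in> I"
  shows "fdet k f \<in> I"
  using assms(2,3)
proof (induction k arbitrary: f R)
  case 0
  then have "R = {}" by auto
  then show ?case using "0.prems"(2)[of id id] by simp
next
  case (Suc k)
  show ?case
  proof (cases "R = {..<Suc k}")
    case True
    then show ?thesis using Suc.prems(2)[of id id] by (simp add: id_def del: fdet_0)
  next
    case False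
    \<comment> \<open>Every cofactor along a row outside \<open>R\<close> still contains all rows of
      \<open>R\<close>, merely renumbered by \<open>skip\<close>.\<close>
    then obtain i where i: "i < Suc k" "i \<notin> R" using Suc.prems(1) by auto
    define R' where "R' = skip i -` R"
    have R_image: "R = skip i ` R'"
    proof (intro equalityI subsetI)
      fix x assume "x \<in> R"
      then have "x \<noteq> i" using i(2) by auto
      then obtain a where "skip i a = x" using skip_cover by blast
      then show "x \<in> skip i ` R'" using \<open>x \<in> R\<close> by (auto simp: R'_def)
    qed (auto simp: R'_def)
    have card_R: "card R' = card R"
      unfolding R_image by (rule card_image[symmetric]) (rule inj_on_subset[OF inj_skip], simp)
    have R': "R' \<subseteq> {..<k}"
    proof
      fix a assume "a \<in> R'"
      then have "skip i a < Suc k" using Suc.prems(1) by (auto simp: R'_def)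
      then show "a \<in> {..<k}" using i(1) by (auto simp: skip_def split: if_splits)
    qed
    have "fdet k (\<lambda>a b. f (skip i a) (skip j b)) \<in> I" if j: "j < Suc k" for j
    proof (rule Suc.IH[OF R'])
      fix \<rho> \<gamma> :: "nat \<Rightarrow> nat"
      assume *: "inj_on \<rho> {..<card R'}" "\<rho> ` {..<card R'} = R'" "inj_on \<gamma> {..<card R'}"
        "\<gamma> ` {..<card R'} \<subseteq> {..<k}"
      show "fdet (card R') (\<lambda>a b. f (skip i (\<rho> a)) (skip j (\<gamma> b))) \<in> I"
        unfolding card_R
      proof (rule Suc.prems(2)[of "skip i \<circ> \<rho>" "skip j \<circ> \<gamma>", unfolded o_def])
        show "(\<lambda>x. skip j (\<gamma> x)) ` {..<card R} \<subseteq> {..<Suc k}"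
          using *(4) skip_less[of _ k j] by (auto simp: card_R image_subset_iff)
        show "(\<lambda>x. skip i (\<rho> x)) ` {..<card R} = R"
          using *(2) R_image card_R by (metis image_image)
        show "inj_on (\<lambda>x. skip i (\<rho> x)) {..<card R}" "inj_on (\<lambda>x. skip j (\<gamma> x)) {..<card R}"
          using *(1,3) injD[OF inj_skip] unfolding card_R inj_on_def by blast+
      qed
    qed
    then show ?thesis
      by (subst fdet_laplace_row[OF i(1)], intro is_ideal_sum[OF I])
         (auto simp: fcof_def intro!: is_idealD(3)[OF I])
  qed
qed

section \<open>Straightening\<close>

text \<open>The Pluecker coordinate p_S, with the chosen columns written as rows. \<open>S\<close>
  is a list and not a set because an exchange may produce unsorted or repeated columns.\<close>

definition pdet :: "nat \<Rightarrow> (nat \<Rightarrow> nat \<Rightarrow> 'r::comm_ring_1) \<Rightarrow> nat list \<Rightarrow> 'r" where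
  "pdet m v S = fdet m (\<lambda>q i. v (S ! q) i)"

lemma sgn_eq_pm_one: "of_int (sign p) \<in> {1, - 1 :: 'r::ring_1}"
  by (auto simp: sign_def)

lemma pdet_mset:
  fixes v :: "nat \<Rightarrow> nat \<Rightarrow> 'r::comm_ring_1"
  assumes "length S = m" "mset S' = mset S"
  shows "\<exists>\<epsilon>\<in>{1, -1}. pdet m v S' = \<epsilon> * pdet m v S"
proof -
  obtain p where p: "p permutes {..<length S}" "permute_list p S = S'"
    using mset_eq_permutation[OF assms(2)] by blast
  have nth: "S' ! q = S ! p q" if "q < m" for q
    using permute_list_nth[OF p(1), of q] p(2) assms(1) that by simp
  have "pdet m v S' = fdet m (\<lambda>q. v (S ! p q))"
    unfolding pdet_def by (rule fdet_cong) (simp add: nth)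
  also have "\<dots> = signof p * pdet m v S"
    unfolding pdet_def using p(1) assms(1)
    by (intro fdet_permute_rows[of p m "\<lambda>q. v (S ! q)"]) (simp add: atLeast0LessThan)
  finally show ?thesis by (intro bexI[OF _ sgn_eq_pm_one])
qed

lemma pdet_not_distinct:
  assumes "length S = m" "\<not> distinct S" shows "pdet m v S = 0"
proof -
  obtain i j where "i < m" "j < m" "i \<noteq> j" "S ! i = S ! j"
    using assms by (auto simp: distinct_conv_nth)
  then show ?thesis unfolding pdet_def by (intro fdet_identical_rows[of i m j]) auto
qed

lemma set_nths_upt: "set (nths [0..<n] A) = {..<n} \<inter> A"
proof -
  have "x \<in> set (nths [0..<n] A)" if "x < n" "x \<in> A" for x
    using that by (auto simp: set_nths intro!: exI[of _ x])
  then show ?thesis by (auto simp: set_nths)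
qed

lemma nths_none: "(\<And>i. i < length xs \<Longrightarrow> i \<notin> A) \<Longrightarrow> nths xs A = []"
proof -
  assume "\<And>i. i < length xs \<Longrightarrow> i \<notin> A"
  then have "{i. i < length xs \<and> i \<in> A} = {}" by auto
  then have "length (nths xs A) = 0" by (simp only: length_nths card.empty)
  then show ?thesis by simp
qed

text \<open>Moving the rows in \<open>P\<close> to the front makes the matrix block diagonal; the
  permutation that does so contributes only a sign.\<close>

lemma fdet_shuffled_blocks:
  fixes v :: "nat \<Rightarrow> nat \<Rightarrow> 'r::comm_ring_1"
  assumes L: "length L = 2 * m" and P: "P \<subseteq> {..<2 * m}" "card P = m"
  shows "\<exists>\<epsilon>\<in>{1, -1}. fdet (2 * m) (\<lambda>j c. if c < m then (if j \<in> P then v (L ! j) c else 0)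
      else (if j \<in> P then 0 else v (L ! j) (c - m)))
    = \<epsilon> * (pdet m v (nths L P) * pdet m v (nths L (- P)))" (is "\<exists>\<epsilon>\<in>_. fdet _ ?f = _")
proof -
  define K where "K = nths [0..<2 * m] P @ nths [0..<2 * m] (- P)"
  have lens: "length (nths [0..<2 * m] P) = m" "length (nths [0..<2 * m] (- P)) = m"
  proof -
    have "{i. i < 2 * m \<and> i \<in> P} = P" "{i. i < 2 * m \<and> i \<in> - P} = {..<2 * m} - P"
      using P(1) by auto
    then show "length (nths [0..<2 * m] P) = m" "length (nths [0..<2 * m] (- P)) = m"
      using P finite_subset[OF P(1)] by (simp_all add: length_nths card_Diff_subset)
  qed
  have "distinct K" unfolding K_def by (auto simp: set_nths_upt)
  moreover have "set K = set [0..<2 * m]" unfolding K_def by (auto simp: set_nths_upt)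
  ultimately have "mset K = mset [0..<2 * m]"
    by (metis set_eq_iff_mset_eq_distinct distinct_upt)
  from mset_eq_permutation[OF this] obtain \<sigma> where
    \<sigma>: "\<sigma> permutes {..<length [0..<2 * m]}" "permute_list \<sigma> [0..<2 * m] = K" by blast
  have K: "K ! j = \<sigma> j" if "j < 2 * m" for j
    using permute_list_nth[OF \<sigma>(1), of j] permutes_in_image[OF \<sigma>(1), of j] that \<sigma>(2) by simp
  have L_map: "L = map ((!) L) [0..<2 * m]" using L by (metis map_nth)
  have lo: "\<sigma> j \<in> P" "L ! \<sigma> j = nths L P ! j" if "j < m" for j
  proof -
    have *: "\<sigma> j = nths [0..<2 * m] P ! j" using K[of j] that lens by (simp add: K_def nth_append)
    then have "\<sigma> j \<in> set (nths [0..<2 * m] P)" using lens that by auto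
    then show "\<sigma> j \<in> P" by (auto simp: set_nths)
    show "L ! \<sigma> j = nths L P ! j"
      by (subst (2) L_map) (simp add: nths_map lens that *)
  qed
  have hi: "\<sigma> (m + j) \<notin> P" "L ! \<sigma> (m + j) = nths L (- P) ! j" if "j < m" for j
  proof -
    have *: "\<sigma> (m + j) = nths [0..<2 * m] (- P) ! j" using K[of "m + j"] that lens by (simp add: K_def nth_append)
    then have "\<sigma> (m + j) \<in> set (nths [0..<2 * m] (- P))" using lens that by auto
    then show "\<sigma> (m + j) \<notin> P" by (auto simp: set_nths)
    show "L ! \<sigma> (m + j) = nths L (- P) ! j"
      by (subst (2) L_map) (simp add: nths_map lens that *)
  qed
  \<comment> \<open>Cut off outside the square, because \<open>fdet_block_diagonal\<close> asks for
    zeros at all indices.\<close>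
  define g where "g j c = (if j < 2 * m \<and> c < 2 * m then ?f (\<sigma> j) c else 0)" for j c
  have "signof \<sigma> * fdet (2 * m) ?f = fdet (2 * m) (\<lambda>j. ?f (\<sigma> j))"
    by (rule fdet_permute_rows[symmetric]) (use \<sigma>(1) in \<open>simp add: atLeast0LessThan\<close>)
  also have "\<dots> = fdet (2 * m) g"
    by (rule fdet_cong) (simp add: g_def)
  also have "\<dots> = fdet (m + m) g"
    by (simp add: mult_2)
  also have "\<dots> = fdet m g * fdet m (\<lambda>i j. g (m + i) (m + j))"
  proof (rule fdet_block_diagonal)
    fix i j :: nat assume "m \<le> i" "j < m"
    then show "g i j = 0" using hi(1)[of "i - m"] by (auto simp: g_def)
  qed (use lo in \<open>auto simp: g_def\<close>)
  also have "fdet m g = pdet m v (nths L P)"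
    unfolding pdet_def by (rule fdet_cong) (simp add: g_def lo)
  also have "fdet m (\<lambda>i j. g (m + i) (m + j)) = pdet m v (nths L (- P))"
    unfolding pdet_def by (rule fdet_cong) (simp add: g_def hi)
  finally have *: "signof \<sigma> * fdet (2 * m) ?f = pdet m v (nths L P) * pdet m v (nths L (- P))" .
  have "signof \<sigma> * signof \<sigma> = (1 :: 'r)"
    using sgn_eq_pm_one[of \<sigma>, where ?'r = 'r] by auto
  then have "fdet (2 * m) ?f = signof \<sigma> * (signof \<sigma> * fdet (2 * m) ?f)"
    by (simp add: mult.assoc[symmetric])
  then show ?thesis unfolding * by (intro bexI[OF _ sgn_eq_pm_one])
qed

text \<open>In the \<open>2m \<times> 2m\<close> matrix below the first \<open>i\<close> rows are \<open>(v, 0)\<close>, the next \<open>m + 1\<close> rows are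
  \<open>(v, v)\<close> and the remaining ones \<open>(0, v)\<close>.  Subtracting the left half of the columns from the
  right half leaves \<open>m + 1\<close> rows supported in \<open>m\<close> columns, so its determinant vanishes;
  splitting the rows \<open>(v, v)\<close> expands it into products of two maximal minors.\<close>

lemma pluecker_relation:
  fixes v :: "nat \<Rightarrow> nat \<Rightarrow> 'r::comm_ring_1"
  assumes L: "length L = 2 * m" and i: "i < m"
  defines "\<P> \<equiv> {P. {..<i} \<subseteq> P \<and> P \<subseteq> {..<i + m + 1} \<and> card P = m}"
  shows "\<exists>\<epsilon>. (\<forall>P\<in>\<P>. \<epsilon> P \<in> {1, -1}) \<and>
    (\<Sum>P\<in>\<P>. \<epsilon> P * (pdet m v (nths L P) * pdet m v (nths L (- P)))) = 0"
proof -
  \<comment> \<open>\<open>F\<close> is the left half and \<open>G\<close> the right half. Their row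
    ranges overlap in the \<open>m + 1\<close> rows from \<open>i\<close> to \<open>i + m\<close>,
    which are the rows \<open>(v, v)\<close>.\<close>
  define F where "F j c = (if c < m \<and> j < i + m + 1 then v (L ! j) c else 0)" for j c
  define G where "G j c = (if m \<le> c \<and> i \<le> j then v (L ! j) (c - m) else 0)" for j c
  define D where "D P = fdet (2 * m) (\<lambda>j. if j \<in> P then F j else G j)" for P
  \<comment> \<open>The column operation that subtracts the left half from the right half.\<close>
  define U :: "nat \<Rightarrow> nat \<Rightarrow> 'r" where
    "U l c = (if l = c then 1 else if l < m \<and> c = l + m then - 1 else 0)" for l c
  have \<P>_sub: "\<P> \<subseteq> Pow {..<2 * m}" using i by (auto simp: \<P>_def)
  have prod_U: "(\<Sum>l<2 * m. (F j l + G j l) * U l c) =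
      (F j c + G j c) - (if m \<le> c then F j (c - m) + G j (c - m) else 0)" if c: "c < 2 * m" for j c
  proof -
    have "(\<Sum>l<2 * m. (F j l + G j l) * U l c) =
        (\<Sum>l<2 * m. (if l = c then F j c + G j c else 0)
          + (if l = c - m then if m \<le> c then - (F j (c - m) + G j (c - m)) else 0 else 0))"
    proof (intro sum.cong refl)
      fix l assume "l \<in> {..<2 * m}"
      show "(F j l + G j l) * U l c = (if l = c then F j c + G j c else 0)
          + (if l = c - m then if m \<le> c then - (F j (c - m) + G j (c - m)) else 0 else 0)"
        using c i by (cases "l = c"; cases "l = c - m"; cases "m \<le> c") (auto simp: U_def)
    qed
    also have "\<dots> = (F j c + G j c) - (if m \<le> c then F j (c - m) + G j (c - m) else 0)"
      using c by (auto simp: sum.distrib)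
    finally show ?thesis .
  qed
  have "fdet (2 * m) (\<lambda>j c. F j c + G j c) * fdet (2 * m) U =
      fdet (2 * m) (\<lambda>j c. \<Sum>l<2 * m. (F j l + G j l) * U l c)"
    by (rule fdet_mult[symmetric])
  also have "\<dots> = 0"
  proof (rule fdet_zero_block[of "{i..<i + m + 1}" _ "{..<m}"])
    fix j c assume "j \<in> {i..<i + m + 1}" "c < 2 * m" "c \<notin> {..<m}"
    then show "(\<Sum>l<2 * m. (F j l + G j l) * U l c) = 0"
      unfolding prod_U[OF \<open>c < 2 * m\<close>] by (auto simp: F_def G_def)
  qed (use i in auto)
  finally have "fdet (2 * m) (\<lambda>j c. F j c + G j c) = 0"
    by (subst (asm) fdet_upper_unitriangular) (auto simp: U_def)
  then have "(\<Sum>P\<in>Pow {..<2 * m}. D P) = 0"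
    by (simp add: fdet_add_rows D_def)
  also have "(\<Sum>P\<in>Pow {..<2 * m}. D P) = (\<Sum>P\<in>\<P>. D P)"
  proof (rule sum.mono_neutral_right)
    show "\<forall>P\<in>Pow {..<2 * m} - \<P>. D P = 0"
    proof
      fix P assume P: "P \<in> Pow {..<2 * m} - \<P>"
      then have fin: "finite P" using finite_subset by auto
      \<comment> \<open>A choice of halves outside \<open>\<P>\<close> either takes a zero row, or
        puts more than \<open>m\<close> rows into a half with only \<open>m\<close> columns.\<close>
      consider "\<not> {..<i} \<subseteq> P" | "\<not> P \<subseteq> {..<i + m + 1}" | "card P > m" | "card P < m"
        using P by (force simp: \<P>_def)
      then show "D P = 0"
      proof cases
        case 1
        then obtain j where "j < i" "j \<notin> P" by auto
        then show ?thesis unfolding D_def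
          by (intro fdet_zero_block[of "{j}" _ "{}"]) (use i in \<open>auto simp: G_def\<close>)
      next
        case 2
        then obtain j where "j \<in> P" "\<not> j < i + m + 1" by auto
        then show ?thesis unfolding D_def
          by (intro fdet_zero_block[of "{j}" _ "{}"]) (use P in \<open>auto simp: F_def\<close>)
      next
        case 3
        then show ?thesis unfolding D_def
          by (intro fdet_zero_block[of P _ "{..<m}"]) (use P in \<open>auto simp: F_def\<close>)
      next
        case 4
        then have "card ({..<2 * m} - P) > m" using P fin by (auto simp: card_Diff_subset)
        then show ?thesis unfolding D_def
          by (intro fdet_zero_block[of "{..<2 * m} - P" _ "{m..<2 * m}"]) (auto simp: G_def)
      qed
    qed
  qed (use \<P>_sub in auto)
  finally have sum0: "(\<Sum>P\<in>\<P>. D P) = 0" .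
  have "\<forall>P\<in>\<P>. \<exists>\<epsilon>\<in>{1, -1}. D P = \<epsilon> * (pdet m v (nths L P) * pdet m v (nths L (- P)))"
  proof
    fix P assume P: "P \<in> \<P>"
    have "D P = fdet (2 * m) (\<lambda>j c. if c < m then (if j \<in> P then v (L ! j) c else 0)
        else (if j \<in> P then 0 else v (L ! j) (c - m)))"
      unfolding D_def
    proof (rule fdet_cong)
      fix j c
      have "j \<in> P \<Longrightarrow> j < i + m + 1" "j \<notin> P \<Longrightarrow> i \<le> j" using P by (auto simp: \<P>_def subset_iff not_less[symmetric])
      then show "(if j \<in> P then F j else G j) c = (if c < m then if j \<in> P then v (L ! j) c else 0
          else if j \<in> P then 0 else v (L ! j) (c - m))"
        by (simp add: F_def G_def)
    qed
    moreover have "P \<subseteq> {..<2 * m}" "card P = m" using P \<P>_sub by (auto simp: \<P>_def)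
    ultimately show "\<exists>\<epsilon>\<in>{1, -1}. D P = \<epsilon> * (pdet m v (nths L P) * pdet m v (nths L (- P)))"
      using fdet_shuffled_blocks[OF L, of P v] by simp
  qed
  then obtain \<epsilon> where "\<forall>P\<in>\<P>. \<epsilon> P \<in> {1, -1} \<and> D P = \<epsilon> P * (pdet m v (nths L P) * pdet m v (nths L (- P)))"
    by metis
  then show ?thesis using sum0 by (intro exI[of _ \<epsilon>]) auto
qed

lemma sum_list_nths: "sum_list (nths L Q) = (\<Sum>j | j < length L \<and> j \<in> Q. L ! j)"
proof (induction L rule: rev_induct)
  case (snoc x xs)
  have "{j. j < length (xs @ [x]) \<and> j \<in> Q} =
      {j. j < length xs \<and> j \<in> Q} \<union> (if length xs \<in> Q then {length xs} else {})"
    by (auto simp: less_Suc_eq)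
  then have "(\<Sum>j | j < length (xs @ [x]) \<and> j \<in> Q. (xs @ [x]) ! j) =
      (\<Sum>j | j < length xs \<and> j \<in> Q. (xs @ [x]) ! j) + (if length xs \<in> Q then x else 0)"
    by (auto simp: add.commute)
  also have "(\<Sum>j | j < length xs \<and> j \<in> Q. (xs @ [x]) ! j) = (\<Sum>j | j < length xs \<and> j \<in> Q. xs ! j)"
    by (intro sum.cong) (auto simp: nth_append)
  finally show ?case using snoc by (simp add: nths_append)
qed simp

text \<open>The \<open>m + 1\<close> entries T_0, ..., T_i and S_i, ..., S_(m-1) are shuffled, the
  others stay. As both lists increase and T_i < S_i, each shuffle other than the original one trades
  entries of \<open>T\<close> for strictly larger entries of \<open>S\<close>.\<close>

lemma pluecker_exchange:
  fixes v :: "nat \<Rightarrow> nat \<Rightarrow> 'r::comm_ring_1"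
  assumes S: "length S = m" "sorted_wrt (<) S" and T: "length T = m" "sorted_wrt (<) T"
    and i: "i < m" "T ! i < S ! i"
  shows "\<exists>(A :: nat set set) \<epsilon> S' T'. finite A \<and> pdet m v S * pdet m v T = (\<Sum>P\<in>A. \<epsilon> P * (pdet m v (S' P) * pdet m v (T' P))) \<and>
    (\<forall>P\<in>A. \<epsilon> P \<in> {1, -1} \<and> length (S' P) = m \<and> length (T' P) = m \<and>
      set (S' P) \<union> set (T' P) \<subseteq> set S \<union> set T \<and>
      sum_list (S' P) + sum_list (T' P) = sum_list S + sum_list T \<and> sum_list T < sum_list (T' P))"
proof -
  \<comment> \<open>The entries to be shuffled occupy the positions \<open>i\<close> to
    \<open>i + m\<close>, with those of \<open>T\<close> first; the fixed entries of
    \<open>S\<close> and of \<open>T\<close> stand at the two ends.\<close>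
  define L where "L = take i S @ take (Suc i) T @ drop i S @ drop (Suc i) T"
  have L: "length L = 2 * m" using S T i by (simp add: L_def)
  define \<P> where "\<P> = {P. {..<i} \<subseteq> P \<and> P \<subseteq> {..<i + m + 1} \<and> card P = m}"
  have "\<P> \<subseteq> Pow {..<i + m + 1}" by (auto simp: \<P>_def)
  then have fin: "finite \<P>" by (rule finite_subset) simp
  define P0 where "P0 = {..<i} \<union> {2 * i + 1..<i + m + 1}"
  have "card P0 = card {..<i} + card {2 * i + 1..<i + m + 1}"
    unfolding P0_def by (rule card_Un_disjoint) auto
  then have "P0 \<in> \<P>" using i by (auto simp: \<P>_def P0_def)
  have S_eq: "nths L P0 = S"
  proof -
    have "nths (take i S) P0 = take i S" by (rule nths_all) (auto simp: P0_def)
    moreover have "nths (take (Suc i) T) {j. j + length (take i S) \<in> P0} = []"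
      by (rule nths_none) (use S T i in \<open>auto simp: P0_def\<close>)
    moreover have "nths (drop i S) {j. j + length (take (Suc i) T) \<in> {j. j + length (take i S) \<in> P0}} = drop i S"
      by (rule nths_all) (use S T i in \<open>auto simp: P0_def\<close>)
    moreover have "nths (drop (Suc i) T) {j. j + length (drop i S) \<in>
        {j. j + length (take (Suc i) T) \<in> {j. j + length (take i S) \<in> P0}}} = []"
      by (rule nths_none) (use S T i in \<open>auto simp: P0_def\<close>)
    ultimately show ?thesis by (simp only: L_def nths_append append_Nil append_Nil2 append_take_drop_id)
  qed
  have T_eq: "nths L (- P0) = T"
  proof -
    have "nths (take i S) (- P0) = []" by (rule nths_none) (auto simp: P0_def)
    moreover have "nths (take (Suc i) T) {j. j + length (take i S) \<in> - P0} = take (Suc i) T"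
      by (rule nths_all) (use S T i in \<open>auto simp: P0_def\<close>)
    moreover have "nths (drop i S) {j. j + length (take (Suc i) T) \<in> {j. j + length (take i S) \<in> - P0}} = []"
      by (rule nths_none) (use S T i in \<open>auto simp: P0_def\<close>)
    moreover have "nths (drop (Suc i) T) {j. j + length (drop i S) \<in>
        {j. j + length (take (Suc i) T) \<in> {j. j + length (take i S) \<in> - P0}}} = drop (Suc i) T"
      by (rule nths_all) (use S T i in \<open>auto simp: P0_def\<close>)
    ultimately show ?thesis by (simp only: L_def nths_append append_Nil append_Nil2 append_take_drop_id)
  qed
  obtain \<epsilon> where \<epsilon>: "\<And>P. P \<in> \<P> \<Longrightarrow> \<epsilon> P \<in> {1, -1 :: 'r}"
    and rel: "(\<Sum>P\<in>\<P>. \<epsilon> P * (pdet m v (nths L P) * pdet m v (nths L (- P)))) = 0"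
    using pluecker_relation[OF L i(1), of v, folded \<P>_def] by blast
  define A where "A = \<P> - {P0}"
  have "\<epsilon> P0 * (pdet m v S * pdet m v T) =
      - (\<Sum>P\<in>A. \<epsilon> P * (pdet m v (nths L P) * pdet m v (nths L (- P))))"
    using rel \<open>P0 \<in> \<P>\<close> fin by (simp add: sum.remove[of \<P> P0] A_def S_eq T_eq eq_neg_iff_add_eq_0)
  moreover have "\<epsilon> P0 * \<epsilon> P0 = 1" using \<epsilon>[OF \<open>P0 \<in> \<P>\<close>] by auto
  moreover have "e * x = - y \<Longrightarrow> e * e = 1 \<Longrightarrow> x = - e * y" for e x y :: 'r
    by (metis mult.assoc mult_1 mult_minus_left mult_minus_right)
  ultimately have "pdet m v S * pdet m v T =
      - \<epsilon> P0 * (\<Sum>P\<in>A. \<epsilon> P * (pdet m v (nths L P) * pdet m v (nths L (- P))))"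
    by iprover
  then have eq: "pdet m v S * pdet m v T =
      (\<Sum>P\<in>A. (- \<epsilon> P0 * \<epsilon> P) * (pdet m v (nths L P) * pdet m v (nths L (- P))))"
    by (simp add: sum_distrib_left mult.assoc)
  have L_low: "L ! j \<le> T ! i" if "i \<le> j" "j \<le> 2 * i" for j
  proof -
    have "L ! j = T ! (j - i)" using that S T i by (auto simp: L_def nth_append)
    moreover have "j - i < i \<or> j - i = i" using that by linarith
    then have "T ! (j - i) \<le> T ! i"
      using T i sorted_wrt_nth_less[OF T(2), of "j - i" i] by auto
    ultimately show ?thesis by simp
  qed
  have L_high: "S ! i \<le> L ! j" if "2 * i < j" "j \<le> i + m" for j
  proof -
    have "L ! j = S ! (j - i - 1)" using that S T i by (auto simp: L_def nth_append)
    moreover have "j - i - 1 < m" "i < j - i - 1 \<or> j - i - 1 = i" using that i by linarith+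
    then have "S ! i \<le> S ! (j - i - 1)"
      using that S i sorted_wrt_nth_less[OF S(2), of i "j - i - 1"] by auto
    ultimately show ?thesis by simp
  qed
  have total: "sum_list (nths L P) + sum_list (nths L (- P)) = sum_list L" for P
  proof -
    have "sum_list (nths L P) + sum_list (nths L (- P)) = (\<Sum>j<length L. L ! j)"
      unfolding sum_list_nths by (subst sum.union_disjoint[symmetric]) (auto intro: sum.cong)
    then show ?thesis by (simp add: sum_list_sum_nth atLeast0LessThan)
  qed
  have "\<epsilon>' \<in> {1, -1} \<Longrightarrow> \<epsilon>'' \<in> {1, -1} \<Longrightarrow> - \<epsilon>' * \<epsilon>'' \<in> {1, -1 :: 'r}" for \<epsilon>' \<epsilon>'' by auto
  then have sign: "- \<epsilon> P0 * \<epsilon> P \<in> {1, -1}" if "P \<in> A" for P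
    using \<epsilon>[OF \<open>P0 \<in> \<P>\<close>] \<epsilon>[of P] that by (auto simp: A_def)
  have len: "length (nths L P) = m" "length (nths L (- P)) = m" if "P \<in> A" for P
  proof -
    have P: "P \<subseteq> {..<2 * m}" "card P = m" using that i by (auto simp: A_def \<P>_def)
    then have "{i. i < 2 * m \<and> i \<in> P} = P" "{i. i < 2 * m \<and> i \<in> - P} = {..<2 * m} - P" by auto
    then show "length (nths L P) = m" "length (nths L (- P)) = m"
      using P finite_subset[OF P(1)] by (simp_all add: length_nths card_Diff_subset L)
  qed
  \<comment> \<open>The positions outside \<open>P\<close> and those outside \<open>P0\<close> are
    equally many, so their two differences have equal size; one carries only values up to
    \<open>T ! i\<close>, the other only values from \<open>S ! i\<close> on.\<close>
  have bigger: "sum_list T < sum_list (nths L (- P))" if "P \<in> A" for P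
  proof -
    define Q where "Q = {..<2 * m} - P"
    define Q0 where "Q0 = {..<2 * m} - P0"
    have P: "{..<i} \<subseteq> P" "P \<subseteq> {..<i + m + 1}" "card P = m" "P \<noteq> P0"
      using that by (auto simp: A_def \<P>_def)
    have P0: "{..<i} \<subseteq> P0" "P0 \<subseteq> {..<i + m + 1}" "card P0 = m"
      using \<open>P0 \<in> \<P>\<close> by (auto simp: \<P>_def)
    have finP: "finite P" "finite P0" using P P0 finite_subset by blast+
    have sub: "P \<subseteq> {..<2 * m}" "P0 \<subseteq> {..<2 * m}"
      using P(2) P0(2) i(1) order_trans[of _ "{..<i + m + 1}" "{..<2 * m}"] by simp_all
    then have "card Q = m" "card Q0 = m"
      using P(3) P0(3) finP by (simp_all add: Q_def Q0_def card_Diff_subset)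
    have "P = {..<2 * m} - Q" "P0 = {..<2 * m} - Q0"
      using sub by (auto simp: Q_def Q0_def)
    then have Q_ne: "Q \<noteq> Q0" using P(4) by metis
    have finQ: "finite Q" "finite Q0" by (auto simp: Q_def Q0_def)
    have same: "card (Q - Q0) = card (Q0 - Q)"
      using \<open>card Q = m\<close> \<open>card Q0 = m\<close> finQ by (simp add: card_Diff_subset_Int Int_commute)
    have pos: "card (Q - Q0) > 0"
    proof (rule ccontr)
      assume "\<not> ?thesis"
      then have "card (Q - Q0) = 0" "card (Q0 - Q) = 0" using same by simp_all
      then have "Q \<subseteq> Q0" "Q0 \<subseteq> Q" using finQ by (simp_all add: card_eq_0_iff)
      then show False using Q_ne by auto
    qed
    have lo: "L ! j \<le> T ! i" if "j \<in> Q0 - Q" for j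
      using that P i by (intro L_low) (auto simp: Q_def Q0_def P0_def)
    have hi: "S ! i \<le> L ! j" if "j \<in> Q - Q0" for j
      using that P i by (intro L_high) (auto simp: Q_def Q0_def P0_def)
    have "(\<Sum>j\<in>Q0 - Q. L ! j) \<le> card (Q0 - Q) * T ! i"
      using lo by (intro sum_bounded_above[where K = "T ! i", simplified]) auto
    also have "\<dots> < card (Q - Q0) * S ! i" using i(2) pos same by simp
    also have "\<dots> \<le> (\<Sum>j\<in>Q - Q0. L ! j)"
      using hi by (intro sum_bounded_below[where K = "S ! i", simplified]) auto
    finally have less: "(\<Sum>j\<in>Q0 - Q. L ! j) < (\<Sum>j\<in>Q - Q0. L ! j)" .
    have "(\<Sum>j\<in>Q0. L ! j) = (\<Sum>j\<in>Q0 - Q. L ! j) + (\<Sum>j\<in>Q0 \<inter> Q. L ! j)"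
      using finQ by (subst sum.union_disjoint[symmetric]) (auto intro!: sum.cong)
    also have "\<dots> < (\<Sum>j\<in>Q - Q0. L ! j) + (\<Sum>j\<in>Q0 \<inter> Q. L ! j)" using less by simp
    also have "\<dots> = (\<Sum>j\<in>Q. L ! j)"
      using finQ by (subst sum.union_disjoint[symmetric]) (auto intro!: sum.cong)
    finally have "(\<Sum>j\<in>Q0. L ! j) < (\<Sum>j\<in>Q. L ! j)" .
    moreover have "{j. j < length L \<and> j \<in> - P} = Q" "{j. j < length L \<and> j \<in> - P0} = Q0"
      by (auto simp: L Q_def Q0_def)
    ultimately show ?thesis using T_eq sum_list_nths[of L "- P0"] sum_list_nths[of L "- P"] by simp
  qed
  have "set L \<subseteq> set S \<union> set T"
    by (auto simp: L_def dest: in_set_takeD in_set_dropD)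
  then have "set (nths L P) \<union> set (nths L (- P)) \<subseteq> set S \<union> set T" for P
    using set_nths_subset[of L P] set_nths_subset[of L "- P"] by (meson Un_least order_trans)
  then show ?thesis
    using fin eq sign len bigger total total[of P0] S_eq T_eq
    by (intro exI[of _ A] exI[of _ "\<lambda>P. - \<epsilon> P0 * \<epsilon> P"] exI[of _ "nths L"] exI[of _ "\<lambda>P. nths L (- P)"])
       (simp add: A_def)
qed

lemma sum_closed:
  assumes "0 \<in> V" "\<And>a b. a \<in> V \<Longrightarrow> b \<in> V \<Longrightarrow> a + b \<in> V" "\<And>x. x \<in> A \<Longrightarrow> f x \<in> V"
  shows "sum f A \<in> V"
  using assms by (induction A rule: infinite_finite_induct) auto

lemma pdet_sort_mset:
  fixes v :: "nat \<Rightarrow> nat \<Rightarrow> 'r::comm_ring_1"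
  assumes "\<forall>S\<in>#M. length S = m"
  shows "\<exists>\<epsilon>\<in>{1, -1}. (\<Prod>S\<in>#M. pdet m v S) = \<epsilon> * (\<Prod>S\<in>#M. pdet m v (sort S))"
  using assms
proof (induction M)
  case (add S M)
  have "length (sort S) = m" "mset S = mset (sort S)" using add.prems by auto
  from pdet_mset[OF this, of v] obtain \<epsilon> where
    \<epsilon>: "\<epsilon> \<in> {1, -1}" "pdet m v S = \<epsilon> * pdet m v (sort S)" by (elim bexE)
  have "\<forall>S\<in>#M. length S = m" using add.prems by simp
  from add.IH[OF this] obtain \<epsilon>' where \<epsilon>': "\<epsilon>' \<in> {1, -1}"
    "(\<Prod>S\<in>#M. pdet m v S) = \<epsilon>' * (\<Prod>S\<in>#M. pdet m v (sort S))" by (elim bexE)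
  have "\<epsilon> * \<epsilon>' \<in> {1, -1}" using \<epsilon>(1) \<epsilon>'(1) by auto
  moreover have "(\<Prod>S\<in>#add_mset S M. pdet m v S) =
      (\<epsilon> * \<epsilon>') * (\<Prod>S\<in>#add_mset S M. pdet m v (sort S))"
    by (simp add: \<epsilon>(2) \<epsilon>'(2) algebra_simps)
  ultimately show ?case by (intro bexI)
qed simp

lemma sum_mset_le_size_mult:
  "(\<And>x. x \<in># M \<Longrightarrow> f x \<le> B) \<Longrightarrow> (\<Sum>x\<in>#M. f x) \<le> size M * (B :: nat)"
  by (induction M) (auto simp: add_mono)

lemma sum_squares_less:
  fixes a b a' b' :: nat
  assumes "a' + b' = a + b" "b < b'" "a \<le> b"
  shows "a\<^sup>2 + b\<^sup>2 < a'\<^sup>2 + b'\<^sup>2"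
proof -
  obtain k where k: "b' = b + k" "k > 0" using assms(2) less_imp_add_positive by blast
  then have a: "a = a' + k" using assms(1) by simp
  have "a\<^sup>2 + b\<^sup>2 + (2 * k * (b - a) + 2 * k * k) = a'\<^sup>2 + b'\<^sup>2"
  proof -
    obtain l where "b = a + l" using assms(3) le_Suc_ex by blast
    then show ?thesis by (simp add: k a power2_eq_square algebra_simps)
  qed
  moreover have "2 * k * k > 0" using k by simp
  ultimately show ?thesis by linarith
qed

text \<open>Rewriting an incomparable pair of columns moves weight from the lighter column to the heavier
  one, so the sum of the squares of the column sums increases and the rewriting terminates.\<close>

lemma straightening:
  fixes v :: "nat \<Rightarrow> nat \<Rightarrow> 'r::comm_ring_1"
  assumes V: "0 \<in> V" "\<And>a b. a \<in> V \<Longrightarrow> b \<in> V \<Longrightarrow> a + b \<in> V" "\<And>a. a \<in> V \<Longrightarrow> - a \<in> V"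
    and std: "\<And>M. size M = d \<Longrightarrow>
      \<forall>S\<in>#M. length S = m \<and> set S \<subseteq> {..<N} \<and> sorted_wrt (<) S \<Longrightarrow>
      \<forall>S\<in>#M. \<forall>T\<in>#M. list_all2 (\<le>) S T \<or> list_all2 (\<le>) T S \<Longrightarrow> (\<Prod>S\<in>#M. pdet m v S) \<in> V"
    and M: "size M = d" "\<forall>S\<in>#M. length S = m \<and> set S \<subseteq> {..<N}"
  shows "(\<Prod>S\<in>#M. pdet m v S) \<in> V"
  using M
\<comment> \<open>Each of the \<open>d\<close> lists has sum at most \<open>m * N\<close>; this
  bounds the increasing sum of squares and turns it into a decreasing measure.\<close>
proof (induction M rule: measure_induct_rule[where f = "\<lambda>M. d * (m * N)\<^sup>2 - (\<Sum>S\<in>#M. (sum_list S)\<^sup>2)"])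
  case (less M)
  have bound: "(\<Sum>S\<in>#K. (sum_list S)\<^sup>2) \<le> d * (m * N)\<^sup>2"
    if "size K = d" "\<forall>S\<in>#K. length S = m \<and> set S \<subseteq> {..<N}" for K
  proof -
    have "(sum_list S)\<^sup>2 \<le> (m * N)\<^sup>2" if "S \<in># K" for S
    proof -
      have S: "length S = m" "set S \<subseteq> {..<N}" using that \<open>\<forall>S\<in>#K. _\<close> by simp_all
      then have "\<And>x. x \<in> set S \<Longrightarrow> x \<le> N" by auto
      then have "sum_list S \<le> m * N"
        using sum_list_mono[of S "\<lambda>x. x" "\<lambda>_. N"] S(1) by (simp add: sum_list_triv)
      then show ?thesis by (rule power_mono) simp
    qed
    then have "(\<Sum>S\<in>#K. (sum_list S)\<^sup>2) \<le> size K * (m * N)\<^sup>2"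
      by (intro sum_mset_le_size_mult)
    then show ?thesis using that(1) by simp
  qed
  have sgn: "\<epsilon> * a \<in> V" if "a \<in> V" "\<epsilon> \<in> {1, -1}" for \<epsilon> a
    using that V(3) by auto
  show ?case
  proof (cases "\<forall>S\<in>#M. distinct S")
    case False
    then obtain S where "S \<in># M" "pdet m v S = 0"
      using less.prems pdet_not_distinct by blast
    then obtain M' where "M = add_mset S M'" by (metis insert_DiffM)
    then have "(\<Prod>S\<in>#M. pdet m v S) = 0" using \<open>pdet m v S = 0\<close> by simp
    then show ?thesis using V(1) by simp
  next
    case True
    define K where "K = image_mset sort M"
    have K: "size K = d" "\<forall>S\<in>#K. length S = m \<and> set S \<subseteq> {..<N}" "\<forall>S\<in>#K. sorted_wrt (<) S"
      using less.prems True by (auto simp: K_def strict_sorted_iff)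
    have K_sum: "(\<Sum>S\<in>#K. (sum_list S)\<^sup>2) = (\<Sum>S\<in>#M. (sum_list S)\<^sup>2)"
      by (simp add: K_def image_mset.compositionality o_def sum_mset_sum_list[symmetric] del: sum_mset_sum_list)
    have "(\<Prod>S\<in>#K. pdet m v S) \<in> V"
    proof (cases "\<forall>S\<in>#K. \<forall>T\<in>#K. list_all2 (\<le>) S T \<or> list_all2 (\<le>) T S")
      case True
      then show ?thesis using K by (intro std) auto
    next
      case False
      \<comment> \<open>By symmetry \<open>S\<close> is the lighter list. It fails to lie below
        \<open>T\<close> at some position \<open>i\<close>, and the exchange there makes the heavier
        list still heavier.\<close>
      then obtain S T where ST: "S \<in># K" "T \<in># K" "\<not> list_all2 (\<le>) S T" "\<not> list_all2 (\<le>) T S"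
          "sum_list S \<le> sum_list T"
        by (metis le_cases)
      then have "T \<noteq> S" by (auto simp: list_all2_conv_all_nth)
      then obtain K' where K': "K = add_mset S (add_mset T K')"
        using ST(1,2) by (metis insert_DiffM insert_noteq_member)
      obtain i where i: "i < m" "T ! i < S ! i"
        using ST K(2) by (auto simp: list_all2_conv_all_nth not_le)
      have S: "length S = m" "sorted_wrt (<) S" and T: "length T = m" "sorted_wrt (<) T"
        using ST(1,2) K by auto
      from pluecker_exchange[OF S T i, of v]
      obtain A :: "nat set set" and \<epsilon> S' T' where *: "finite A \<and>
        pdet m v S * pdet m v T = (\<Sum>P\<in>A. \<epsilon> P * (pdet m v (S' P) * pdet m v (T' P))) \<and>
        (\<forall>P\<in>A. \<epsilon> P \<in> {1, -1} \<and> length (S' P) = m \<and> length (T' P) = m \<and>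
          set (S' P) \<union> set (T' P) \<subseteq> set S \<union> set T \<and>
          sum_list (S' P) + sum_list (T' P) = sum_list S + sum_list T \<and> sum_list T < sum_list (T' P))"
        by (elim exE)
      note A = conjunct1[OF *] conjunct1[OF conjunct2[OF *]]
      note ex = bspec[OF conjunct2[OF conjunct2[OF *]]]
      have "(\<Prod>S\<in>#K. pdet m v S) =
          (\<Sum>P\<in>A. \<epsilon> P * (\<Prod>S\<in>#add_mset (S' P) (add_mset (T' P) K'). pdet m v S))"
        by (simp add: K' mult.assoc[symmetric] A(2) sum_distrib_right)
      also have "\<dots> \<in> V"
      proof -
        have "(\<Prod>S\<in>#add_mset (S' P) (add_mset (T' P) K'). pdet m v S) \<in> V" if P: "P \<in> A" for P
        proof (rule less.IH)
          let ?K = "add_mset (S' P) (add_mset (T' P) K')"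
          have "set S \<subseteq> {..<N}" "set T \<subseteq> {..<N}" using K(2) ST by auto
          then show valid: "size ?K = d" "\<forall>S\<in>#?K. length S = m \<and> set S \<subseteq> {..<N}"
            using ex[OF P] K by (auto simp: K')
          have "(\<Sum>S\<in>#K. (sum_list S)\<^sup>2) < (\<Sum>S\<in>#?K. (sum_list S)\<^sup>2)"
            using sum_squares_less[of "sum_list (S' P)" "sum_list (T' P)" "sum_list S" "sum_list T"]
              ex[OF P] ST(5) by (simp add: K' add.assoc[symmetric])
          then show "d * (m * N)\<^sup>2 - (\<Sum>S\<in>#?K. (sum_list S)\<^sup>2) < d * (m * N)\<^sup>2 - (\<Sum>S\<in>#M. (sum_list S)\<^sup>2)"
            using bound[OF valid] K_sum by linarith
        qed
        then have "\<epsilon> P * (\<Prod>S\<in>#add_mset (S' P) (add_mset (T' P) K'). pdet m v S) \<in> V" if "P \<in> A" for P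
          using that ex sgn by blast
        then show ?thesis using V(1,2) by (intro sum_closed)
      qed
      finally show ?thesis .
    qed
    moreover have "\<forall>S\<in>#M. length S = m" using less.prems by simp
    from pdet_sort_mset[OF this, of v] obtain \<epsilon> where "\<epsilon> \<in> {1, -1}"
      "(\<Prod>S\<in>#M. pdet m v S) = \<epsilon> * (\<Prod>S\<in>#M. pdet m v (sort S))" by (elim bexE)
    then have "\<epsilon> \<in> {1, -1}" "(\<Prod>S\<in>#M. pdet m v S) = \<epsilon> * (\<Prod>S\<in>#K. pdet m v S)"
      by (simp_all add: K_def image_mset.compositionality o_def)
    ultimately show ?thesis using sgn by metis
  qed
qed

section \<open>Leading monomials\<close>

text \<open>Coefficient 1 is built in, so that leading terms multiply over every coefficient
  ring.\<close>

definition lead :: "('v::linorder, 'a::comm_ring_1) mpoly \<Rightarrow> ('v \<Rightarrow>\<^sub>0 nat) \<Rightarrow> bool" where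
  "lead F \<mu> \<longleftrightarrow> (\<forall>\<kappa>\<in>Poly_Mapping.keys (F - Poly_Mapping.single \<mu> 1). \<kappa> < \<mu>)"

lemma lead_lookup: "lead F \<mu> \<Longrightarrow> Poly_Mapping.lookup F \<mu> = 1"
  by (auto simp: lead_def in_keys_iff lookup_minus lookup_single)

lemma lead_lookup_less: "lead F \<mu> \<Longrightarrow> \<mu> < \<kappa> \<Longrightarrow> Poly_Mapping.lookup F \<kappa> = 0"
proof (rule ccontr)
  assume *: "lead F \<mu>" "\<mu> < \<kappa>" "Poly_Mapping.lookup F \<kappa> \<noteq> 0"
  then have "\<kappa> \<in> Poly_Mapping.keys (F - Poly_Mapping.single \<mu> 1)"
    by (simp add: in_keys_iff lookup_minus lookup_single when_def)
  then show False using * by (auto simp: lead_def)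
qed

lemma lead_1: "lead 1 0"
  by (simp add: lead_def single_one)

lemma lead_mult:
  assumes F: "lead F \<mu>" and G: "lead G \<nu>" shows "lead (F * G) (\<mu> + \<nu>)"
proof -
  define F' where "F' = F - Poly_Mapping.single \<mu> 1"
  define G' where "G' = G - Poly_Mapping.single \<nu> 1"
  have eq: "F * G - Poly_Mapping.single (\<mu> + \<nu>) 1 =
      F' * Poly_Mapping.single \<nu> 1 + (Poly_Mapping.single \<mu> 1 * G' + F' * G')"
    by (simp add: F'_def G'_def algebra_simps mult_single)
  have A: "\<kappa> < \<mu> + \<nu>" if "\<kappa> \<in> Poly_Mapping.keys (F' * Poly_Mapping.single \<nu> 1)" for \<kappa>
    using that Poly_Mapping.keys_mult[of F' "Poly_Mapping.single \<nu> 1"] F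
    by (auto simp: lead_def F'_def split: if_splits)
  have B: "\<kappa> < \<mu> + \<nu>" if "\<kappa> \<in> Poly_Mapping.keys (Poly_Mapping.single \<mu> 1 * G')" for \<kappa>
    using that Poly_Mapping.keys_mult[of "Poly_Mapping.single \<mu> 1" G'] G
    by (auto simp: lead_def G'_def split: if_splits)
  have C: "\<kappa> < \<mu> + \<nu>" if "\<kappa> \<in> Poly_Mapping.keys (F' * G')" for \<kappa>
  proof -
    obtain a b where "\<kappa> = a + b" "a \<in> Poly_Mapping.keys F'" "b \<in> Poly_Mapping.keys G'"
      using Poly_Mapping.keys_mult[of F' G'] \<open>\<kappa> \<in> _\<close> by blast
    then show ?thesis using F G by (auto simp: lead_def F'_def G'_def intro: add_strict_mono)
  qed
  show ?thesis unfolding lead_def eq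
  proof
    fix \<kappa> assume \<kappa>: "\<kappa> \<in> Poly_Mapping.keys (F' * Poly_Mapping.single \<nu> 1 +
      (Poly_Mapping.single \<mu> 1 * G' + F' * G'))"
    consider "\<kappa> \<in> Poly_Mapping.keys (F' * Poly_Mapping.single \<nu> 1)"
      | "\<kappa> \<in> Poly_Mapping.keys (Poly_Mapping.single \<mu> 1 * G')" | "\<kappa> \<in> Poly_Mapping.keys (F' * G')"
      using subsetD[OF Poly_Mapping.keys_add \<kappa>]
        Poly_Mapping.keys_add[of "Poly_Mapping.single \<mu> 1 * G'" "F' * G'"] by blast
    then show "\<kappa> < \<mu> + \<nu>" by cases (rule A B C, assumption)+
  qed
qed

text \<open>\<open>order_ge B s\<close> is the \<open>s\<close>-th power of the ideal generated by the variables in \<open>B\<close>.\<close>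

definition degree_in :: "'v set \<Rightarrow> ('v \<Rightarrow>\<^sub>0 nat) \<Rightarrow> nat" where
  "degree_in B \<mu> = (\<Sum>v\<in>Poly_Mapping.keys \<mu> \<inter> B. Poly_Mapping.lookup \<mu> v)"

definition order_ge :: "'v set \<Rightarrow> nat \<Rightarrow> ('v, 'a::comm_ring_1) mpoly set" where
  "order_ge B s = {F. \<forall>\<mu>\<in>Poly_Mapping.keys F. s \<le> degree_in B \<mu>}"

lemma degree_in_superset:
  assumes "finite A" "Poly_Mapping.keys \<mu> \<subseteq> A"
  shows "degree_in B \<mu> = (\<Sum>v\<in>A \<inter> B. Poly_Mapping.lookup \<mu> v)"
  unfolding degree_in_def using assms by (intro sum.mono_neutral_left) (auto simp: in_keys_iff)

lemma degree_in_add: "degree_in B (\<mu> + \<nu>) = degree_in B \<mu> + degree_in B \<nu>"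
  using Poly_Mapping.keys_add[of \<mu> \<nu>]
  by (simp add: degree_in_superset[of "Poly_Mapping.keys \<mu> \<union> Poly_Mapping.keys \<nu>"] lookup_add sum.distrib)

lemma degree_in_0 [simp]: "degree_in B 0 = 0"
  by (simp add: degree_in_def)

lemma degree_in_single [simp]: "degree_in B (Poly_Mapping.single v k) = (if v \<in> B then k else 0)"
  by (auto simp: degree_in_def)

lemma degree_in_sum: "degree_in B (\<Sum>x\<in>A. f x) = (\<Sum>x\<in>A. degree_in B (f x))"
  by (induction A rule: infinite_finite_induct) (auto simp: degree_in_add)

lemma order_ge_single: "s \<le> degree_in B \<mu> \<Longrightarrow> Poly_Mapping.single \<mu> c \<in> order_ge B s"
  by (auto simp: order_ge_def split: if_splits)

lemma order_ge_mult:
  assumes "F \<in> order_ge B s" "G \<in> order_ge B t" shows "F * G \<in> order_ge B (s + t)"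
  unfolding order_ge_def
proof safe
  fix \<kappa> assume "\<kappa> \<in> Poly_Mapping.keys (F * G)"
  then obtain \<mu> \<nu> where "\<kappa> = \<mu> + \<nu>" "\<mu> \<in> Poly_Mapping.keys F" "\<nu> \<in> Poly_Mapping.keys G"
    using Poly_Mapping.keys_mult[of F G] by blast
  then show "s + t \<le> degree_in B \<kappa>"
    using assms by (auto simp: order_ge_def degree_in_add intro: add_mono)
qed

lemma order_ge_0: "F \<in> order_ge B 0"
  by (simp add: order_ge_def)

lemma is_ideal_order_ge: "is_ideal (order_ge B s)"
proof (rule is_idealI)
  fix F G :: "('a, 'b) mpoly" assume "F \<in> order_ge B s" "G \<in> order_ge B s"
  then show "F + G \<in> order_ge B s"
    using Poly_Mapping.keys_add[of F G] by (auto simp: order_ge_def)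
next
  fix R F :: "('a, 'b) mpoly" assume "F \<in> order_ge B s"
  then show "R * F \<in> order_ge B s" using order_ge_mult[OF order_ge_0] by fastforce
qed (simp add: order_ge_def)

lemma order_ge_antimono: "s \<le> t \<Longrightarrow> F \<in> order_ge B t \<Longrightarrow> F \<in> order_ge B s"
  by (force simp: order_ge_def)

lemma one_notin_order_ge: "(1 :: ('v, 'a::comm_ring_1) mpoly) \<notin> order_ge B 1"
  by (simp add: order_ge_def flip: single_one)

text \<open>The least monomial for the order that compares degrees in \<open>B\<close> first and
  breaks ties by \<open><\<close>; it realises the order of \<open>F\<close> in the variables
  \<open>B\<close>.\<close>

lemma ex_minimal_monomial:
  fixes F :: "('v::linorder, 'a::comm_ring_1) mpoly"
  assumes "F \<noteq> 0"
  shows "\<exists>\<mu>\<in>Poly_Mapping.keys F. \<forall>\<nu>\<in>Poly_Mapping.keys F.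
    degree_in B \<mu> < degree_in B \<nu> \<or> degree_in B \<mu> = degree_in B \<nu> \<and> \<mu> \<le> \<nu>"
proof -
  let ?K = "Poly_Mapping.keys F"
  define d where "d = Min (degree_in B ` ?K)"
  let ?M = "{\<mu>\<in>?K. degree_in B \<mu> = d}"
  have ne: "?K \<noteq> {}" using assms by simp
  have "d \<in> degree_in B ` ?K" unfolding d_def using ne by (intro Min_in) auto
  then have "?M \<noteq> {}" by auto
  then have M: "Min ?M \<in> ?M" by (intro Min_in) auto
  show ?thesis
  proof (intro bexI[of _ "Min ?M"] ballI)
    fix \<nu> assume \<nu>: "\<nu> \<in> ?K"
    then have "d \<le> degree_in B \<nu>" unfolding d_def by (intro Min_le) auto
    moreover have "degree_in B \<nu> = d \<Longrightarrow> Min ?M \<le> \<nu>" using \<nu> by (intro Min_le) auto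
    ultimately show "degree_in B (Min ?M) < degree_in B \<nu> \<or>
        degree_in B (Min ?M) = degree_in B \<nu> \<and> Min ?M \<le> \<nu>"
      using M by auto
  qed (use M in auto)
qed

lemma lookup_mult_unique:
  fixes F G :: "('v, 'a::comm_ring_1) mpoly"
  assumes "\<And>\<mu>' \<nu>'. \<mu>' \<in> Poly_Mapping.keys F \<Longrightarrow> \<nu>' \<in> Poly_Mapping.keys G \<Longrightarrow>
    \<mu>' + \<nu>' = \<mu> + \<nu> \<Longrightarrow> \<mu>' = \<mu> \<and> \<nu>' = \<nu>"
  shows "Poly_Mapping.lookup (F * G) (\<mu> + \<nu>) = Poly_Mapping.lookup F \<mu> * Poly_Mapping.lookup G \<nu>"
proof -
  define c where "c = Poly_Mapping.lookup F \<mu>"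
  define d where "d = Poly_Mapping.lookup G \<nu>"
  define F' where "F' = F - Poly_Mapping.single \<mu> c"
  define G' where "G' = G - Poly_Mapping.single \<nu> d"
  have keys: "Poly_Mapping.keys F' \<subseteq> Poly_Mapping.keys F - {\<mu>}"
    "Poly_Mapping.keys G' \<subseteq> Poly_Mapping.keys G - {\<nu>}"
    by (auto simp: F'_def G'_def c_def d_def in_keys_iff lookup_minus lookup_single when_def split: if_splits)
  have F1: "\<mu> + \<nu> \<notin> Poly_Mapping.keys (F' * G)"
  proof
    assume "\<mu> + \<nu> \<in> Poly_Mapping.keys (F' * G)"
    then obtain a b where "\<mu> + \<nu> = a + b" "a \<in> Poly_Mapping.keys F'" "b \<in> Poly_Mapping.keys G"
      using Poly_Mapping.keys_mult[of F' G] by blast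
    then show False using assms[of a b] keys by auto
  qed
  have F2: "\<mu> + \<nu> \<notin> Poly_Mapping.keys (Poly_Mapping.single \<mu> c * G')"
  proof
    assume "\<mu> + \<nu> \<in> Poly_Mapping.keys (Poly_Mapping.single \<mu> c * G')"
    then obtain b where "\<mu> + \<nu> = \<mu> + b" "b \<in> Poly_Mapping.keys G'"
      using Poly_Mapping.keys_mult[of "Poly_Mapping.single \<mu> c" G'] by (auto split: if_splits)
    then show False using keys by auto
  qed
  have "F * G = F' * G + Poly_Mapping.single \<mu> c * G' + Poly_Mapping.single (\<mu> + \<nu>) (c * d)"
    by (simp add: F'_def G'_def algebra_simps mult_single)
  then show ?thesis
    using F1 F2 by (simp add: lookup_add in_keys_iff c_def d_def)
qed

text \<open>The order is a valuation: the product of the least monomials of \<open>G\<close> and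
  \<open>F\<close> arises in only one way, so it survives in the product over a domain. That
  \<open>G\<close> is not in \<open>order_ge B 1\<close> says that its least monomial has degree
  0.\<close>

lemma order_ge_cancel:
  fixes F G :: "('v::linorder, 'a::idom) mpoly"
  assumes "G * F \<in> order_ge B s" "G \<notin> order_ge B 1" shows "F \<in> order_ge B s"
proof (cases "F = 0")
  case False
  have "G \<noteq> 0" using assms(2) by (auto simp: order_ge_def)
  then obtain \<mu> where \<mu>: "\<mu> \<in> Poly_Mapping.keys G" "\<And>\<nu>. \<nu> \<in> Poly_Mapping.keys G \<Longrightarrow>
      degree_in B \<mu> < degree_in B \<nu> \<or> degree_in B \<mu> = degree_in B \<nu> \<and> \<mu> \<le> \<nu>"
    using ex_minimal_monomial by blast
  from False obtain \<nu> where \<nu>: "\<nu> \<in> Poly_Mapping.keys F" "\<And>\<mu>. \<mu> \<in> Poly_Mapping.keys F \<Longrightarrow>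
      degree_in B \<nu> < degree_in B \<mu> \<or> degree_in B \<nu> = degree_in B \<mu> \<and> \<nu> \<le> \<mu>"
    using ex_minimal_monomial by blast
  have "Poly_Mapping.lookup (G * F) (\<mu> + \<nu>) = Poly_Mapping.lookup G \<mu> * Poly_Mapping.lookup F \<nu>"
  proof (rule lookup_mult_unique)
    fix \<mu>' \<nu>' assume *: "\<mu>' \<in> Poly_Mapping.keys G" "\<nu>' \<in> Poly_Mapping.keys F" "\<mu>' + \<nu>' = \<mu> + \<nu>"
    have "degree_in B \<mu>' + degree_in B \<nu>' = degree_in B \<mu> + degree_in B \<nu>"
      using arg_cong[OF *(3), of "degree_in B"] by (simp add: degree_in_add)
    with \<mu>(2)[OF *(1)] \<nu>(2)[OF *(2)] have "\<mu> \<le> \<mu>'" "\<nu> \<le> \<nu>'" by auto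
    then show "\<mu>' = \<mu> \<and> \<nu>' = \<nu>"
      using *(3) add_less_le_mono[of \<mu> \<mu>' \<nu> \<nu>'] add_le_less_mono[of \<mu> \<mu>' \<nu> \<nu>'] by fastforce
  qed
  then have "\<mu> + \<nu> \<in> Poly_Mapping.keys (G * F)"
    using \<mu>(1) \<nu>(1) by (simp add: in_keys_iff)
  then have "s \<le> degree_in B \<mu> + degree_in B \<nu>"
    using assms(1) by (auto simp: order_ge_def degree_in_add)
  moreover have "degree_in B \<mu> = 0"
    using assms(2) \<mu>(2) by (force simp: order_ge_def)
  ultimately show ?thesis using \<nu>(2) by (force simp: order_ge_def)
qed (simp add: order_ge_def)

text \<open>Setting the variables in \<open>B\<close> to zero kills the monomials that meet
  \<open>B\<close> and leaves the others unchanged, so none of the latter can occur in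
  \<open>F\<close>.\<close>

lemma order_ge_1I:
  assumes "poly_subst (\<lambda>v. if v \<in> B then 0 else Var v) F = 0" shows "F \<in> order_ge B 1"
proof (rule ccontr)
  assume "F \<notin> order_ge B 1"
  then obtain \<mu> where \<mu>: "\<mu> \<in> Poly_Mapping.keys F" "degree_in B \<mu> = 0"
    by (auto simp: order_ge_def not_le)
  then have disj: "Poly_Mapping.keys \<mu> \<inter> B = {}"
    by (auto simp: degree_in_def in_keys_iff)
  have mono: "(\<Prod>v\<in>Poly_Mapping.keys \<nu>. (if v \<in> B then 0 else Var v) ^ Poly_Mapping.lookup \<nu> v) =
      (if Poly_Mapping.keys \<nu> \<inter> B = {} then Poly_Mapping.single \<nu> 1 else (0 :: ('a, 'b) mpoly))" for \<nu>
  proof (cases "Poly_Mapping.keys \<nu> \<inter> B = {}")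
    case True
    have "(\<Prod>v\<in>Poly_Mapping.keys \<nu>. Poly_Mapping.single (Poly_Mapping.single v 1) (1::'b) ^ Poly_Mapping.lookup \<nu> v)
        = Poly_Mapping.single (\<Sum>v\<in>Poly_Mapping.keys \<nu>. Poly_Mapping.single v (Poly_Mapping.lookup \<nu> v)) 1"
    proof -
      have pow: "Poly_Mapping.single (Poly_Mapping.single v 1) (1::'b) ^ k =
          Poly_Mapping.single (Poly_Mapping.single v k) 1" for v :: 'a and k
        by (induction k) (simp_all add: mult_single flip: single_add)
      have "(\<Prod>v\<in>A. Poly_Mapping.single (f v) (1::'b)) = Poly_Mapping.single (\<Sum>v\<in>A. f v) 1"
        if "finite A" for A and f :: "'a \<Rightarrow> 'a \<Rightarrow>\<^sub>0 nat"
        using that by induction (simp_all add: mult_single)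
      then show ?thesis by (simp only: pow finite_keys)
    qed
    also have "(\<Sum>v\<in>Poly_Mapping.keys \<nu>. Poly_Mapping.single v (Poly_Mapping.lookup \<nu> v)) = \<nu>"
      by (intro poly_mapping_eqI) (simp add: lookup_sum lookup_single when_def sum.delta in_keys_iff)
    finally have "(\<Prod>v\<in>Poly_Mapping.keys \<nu>. Var v ^ Poly_Mapping.lookup \<nu> v) =
        (Poly_Mapping.single \<nu> 1 :: ('a, 'b) mpoly)" by (simp only: Var_def)
    moreover have "(\<Prod>v\<in>Poly_Mapping.keys \<nu>. (if v \<in> B then 0 else Var v) ^ Poly_Mapping.lookup \<nu> v) =
        (\<Prod>v\<in>Poly_Mapping.keys \<nu>. Var v ^ Poly_Mapping.lookup \<nu> v :: ('a, 'b) mpoly)"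
      using True by (intro prod.cong) auto
    ultimately show ?thesis using True by simp
  next
    case False
    then obtain v where "v \<in> Poly_Mapping.keys \<nu>" "v \<in> B" by auto
    then have "(\<Prod>v\<in>Poly_Mapping.keys \<nu>. (if v \<in> B then 0 else Var v) ^ Poly_Mapping.lookup \<nu> v)
        = (0 :: ('a, 'b) mpoly)"
      by (intro prod_zero bexI[of _ v]) (auto simp: in_keys_iff zero_power)
    then show ?thesis using False by simp
  qed
  have "0 = Poly_Mapping.lookup (poly_subst (\<lambda>v. if v \<in> B then 0 else Var v) F) \<mu>"
    by (simp add: assms)
  also have "\<dots> = (\<Sum>\<nu>\<in>Poly_Mapping.keys F. if \<nu> = \<mu> then Poly_Mapping.lookup F \<mu> else 0)"
    unfolding poly_subst_def mono lookup_sum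
    using disj by (intro sum.cong refl) (auto simp: Const_def mult_single lookup_single when_def)
  also have "\<dots> = Poly_Mapping.lookup F \<mu>"
    using \<mu>(1) by (subst sum.delta) auto
  finally show False using \<mu>(1) by (simp add: in_keys_iff)
qed

text \<open>The columns of \<open>(Z | L)\<close> with \<open>Z\<close> generic and \<open>L\<close> generic lower unitriangular.  The
  variables are numbered row by row, so that in the lexicographic order (where smaller numbers
  come first) the diagonal term of every maximal minor is the leading one.\<close>

definition ycol :: "nat \<Rightarrow> nat \<Rightarrow> nat \<Rightarrow> nat \<Rightarrow> (nat, 'a::comm_ring_1) mpoly" where
  "ycol n m c i = (if c < n + i then Var (i * (n + m) + c) else if c = n + i then 1 else 0)"

text \<open>The exponent of the entry \<open>ycol n m c i\<close>. The entries 1 and 0 both get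
  exponent 0, so zero entries have to be excluded separately.\<close>

definition yexp :: "nat \<Rightarrow> nat \<Rightarrow> nat \<Rightarrow> nat \<Rightarrow> (nat \<Rightarrow>\<^sub>0 nat)" where
  "yexp n m c i = (if c < n + i then Poly_Mapping.single (i * (n + m) + c) 1 else 0)"

definition diag_exp :: "nat \<Rightarrow> nat \<Rightarrow> nat list \<Rightarrow> (nat \<Rightarrow>\<^sub>0 nat)" where
  "diag_exp n m S = (\<Sum>i<m. yexp n m (S ! i) i)"

text \<open>The variables in the rows \<open>i \<ge> r\<close> of \<open>Z\<close>.\<close>

definition zvars :: "nat \<Rightarrow> nat \<Rightarrow> nat \<Rightarrow> nat set" where
  "zvars n m r = {k. r \<le> k div (n + m) \<and> k mod (n + m) < n}"

section \<open>Increasing column lists and the diagonal terms of maximal minors\<close>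

definition col_lists :: "nat \<Rightarrow> nat \<Rightarrow> nat list set" where
  "col_lists n m = {S. length S = m \<and> set S \<subseteq> {..<n + m} \<and> sorted_wrt (<) S}"

text \<open>The size k(S) of the minor of X: the columns below \<open>n\<close> are those of X or
  Z.\<close>

definition xcount :: "nat \<Rightarrow> nat list \<Rightarrow> nat" where
  "xcount n S = card {q. q < length S \<and> S ! q < n}"

lemma col_listsD:
  assumes "S \<in> col_lists n m"
  shows "length S = m" "sorted_wrt (<) S" "i < m \<Longrightarrow> S ! i < n + m"
  using assms nth_mem[of i S] by (auto simp: col_lists_def subset_iff)

lemma col_lists_nth_mono:
  assumes "S \<in> col_lists n m" "i < j" "j < m" shows "S ! i < S ! j"
  using col_listsD(1,2)[OF assms(1)] assms(2,3) by (intro sorted_wrt_nth_less[of "(<)" S]) auto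

text \<open>The \<open>m - 1 - i\<close> later entries increase strictly and stay below
  \<open>n + m\<close>. Hence the diagonal of a maximal minor never meets a zero of
  \<open>L\<close>.\<close>

lemma col_lists_nth_le:
  assumes S: "S \<in> col_lists n m" and i: "i < m" shows "S ! i \<le> n + i"
proof -
  have "S ! i + d \<le> S ! (i + d)" if "i + d < m" for d
    using that
  proof (induction d)
    case (Suc d)
    then show ?case using col_lists_nth_mono[OF S, of "i + d" "i + Suc d"] by simp
  qed simp
  from this[of "m - 1 - i"] show ?thesis
    using i col_listsD(3)[OF S, of "m - 1"] by simp
qed

lemma nth_less_iff_xcount:
  assumes S: "S \<in> col_lists n m" and q: "q < m" shows "S ! q < n \<longleftrightarrow> q < xcount n S"
proof -
  let ?A = "{q. q < m \<and> S ! q < n}"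
  have x: "xcount n S = card ?A" using col_listsD(1)[OF S] by (simp add: xcount_def)
  show ?thesis
  proof (cases "S ! q < n")
    case True
    have "{..q} \<subseteq> ?A"
    proof
      fix i assume "i \<in> {..q}"
      then show "i \<in> ?A" using True q col_lists_nth_mono[OF S, of i q] by (cases "i = q") auto
    qed
    then have "card {..q} \<le> card ?A" by (intro card_mono) auto
    then show ?thesis using True x by simp
  next
    case False
    have "?A \<subseteq> {..<q}"
    proof
      fix i assume "i \<in> ?A"
      then show "i \<in> {..<q}" using False q col_lists_nth_mono[OF S, of q i] by (cases i q rule: linorder_cases) auto
    qed
    then have "card ?A \<le> card {..<q}" by (intro card_mono) auto
    then show ?thesis using False x by simp
  qed
qed

lemma xcount_le: "S \<in> col_lists n m \<Longrightarrow> xcount n S \<le> m"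
  using card_mono[of "{..<m}" "{q. q < m \<and> S ! q < n}"] by (auto simp: xcount_def col_listsD)

lemma key_div_mod:
  assumes "(c::nat) < N" shows "(i * N + c) div N = i" "(i * N + c) mod N = c"
proof -
  have "N \<noteq> 0" using assms by auto
  then show "(i * N + c) div N = i" "(i * N + c) mod N = c" using assms by simp_all
qed

lemma prod_ycol:
  "(\<Prod>i<k. ycol n m (c i) i) =
    (if \<forall>i<k. c i \<le> n + i then Poly_Mapping.single (\<Sum>i<k. yexp n m (c i) i) 1
     else (0 :: (nat, 'a::comm_ring_1) mpoly))"
proof (induction k)
  case (Suc k)
  have "ycol n m (c k) k = (if c k \<le> n + k then Poly_Mapping.single (yexp n m (c k) k) 1 else (0 :: (nat, 'a) mpoly))"
    by (simp add: ycol_def yexp_def Var_def)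
  then show ?case using Suc by (auto simp: less_Suc_eq mult_single)
qed simp

text \<open>The number \<open>a * (n + m) + b\<close> determines \<open>a\<close> and
  \<open>b\<close>, so a variable sees only the choice made in its own row.\<close>

lemma lookup_sum_yexp:
  assumes "\<And>i. i < m \<Longrightarrow> c i < n + m" "b < n + m"
  shows "Poly_Mapping.lookup (\<Sum>i<m. yexp n m (c i) i) (a * (n + m) + b) =
    (if a < m \<and> c a = b \<and> b < n + a then 1 else 0)"
proof -
  have "Poly_Mapping.lookup (yexp n m (c i) i) (a * (n + m) + b) =
      (if i = a then if c a = b \<and> b < n + a then 1 else 0 else 0)" if "i < m" for i
  proof (cases "i * (n + m) + c i = a * (n + m) + b")
    case True
    have "(i * (n + m) + c i) div (n + m) = i" "(i * (n + m) + c i) mod (n + m) = c i"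
      "(a * (n + m) + b) div (n + m) = a" "(a * (n + m) + b) mod (n + m) = b"
      using assms(1)[OF that] assms(2) by (simp_all only: key_div_mod)
    then have "i = a" "c i = b" by (simp_all only: True)
    then show ?thesis by (simp add: yexp_def)
  next
    case False
    then show ?thesis by (auto simp: yexp_def lookup_single)
  qed
  then have "Poly_Mapping.lookup (\<Sum>i<m. yexp n m (c i) i) (a * (n + m) + b) =
      (\<Sum>i<m. if i = a then if c a = b \<and> b < n + a then 1 else 0 else 0)"
    by (simp add: lookup_sum)
  then show ?thesis by (simp add: sum.delta)
qed

lemma degree_in_sum_yexp:
  assumes "\<And>i. i < m \<Longrightarrow> c i < n + m"
  shows "degree_in (zvars n m r) (\<Sum>i<m. yexp n m (c i) i) = card {i. i < m \<and> r \<le> i \<and> c i < n}"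
proof -
  have "degree_in (zvars n m r) (yexp n m (c i) i) = (if r \<le> i \<and> c i < n then 1 else 0)"
    if "i < m" for i
    using assms[OF that] by (simp add: yexp_def zvars_def key_div_mod)
  then have "degree_in (zvars n m r) (\<Sum>i<m. yexp n m (c i) i) =
      (\<Sum>i<m. if r \<le> i \<and> c i < n then 1 else 0)"
    by (simp add: degree_in_sum)
  also have "\<dots> = card ({..<m} \<inter> {i. r \<le> i \<and> c i < n})"
    by (simp add: sum.If_cases)
  also have "{..<m} \<inter> {i. r \<le> i \<and> c i < n} = {i. i < m \<and> r \<le> i \<and> c i < n}" by auto
  finally show ?thesis .
qed

text \<open>In an increasing list the k(S) columns of Z come first, so the diagonal meets them in
  the rows 0 to k(S) - 1; those from row \<open>r\<close> on are counted.\<close>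

lemma degree_in_diag_exp:
  assumes "S \<in> col_lists n m"
  shows "degree_in (zvars n m r) (diag_exp n m S) = xcount n S - r"
proof -
  have "{i. i < m \<and> r \<le> i \<and> S ! i < n} = {r..<xcount n S}"
    using nth_less_iff_xcount[OF assms] xcount_le[OF assms] by auto
  then show ?thesis using degree_in_sum_yexp[of m "(!) S" n r] col_listsD(3)[OF assms]
    by (simp add: diag_exp_def)
qed

lemma pdet_ycol:
  assumes S: "S \<in> col_lists n m"
  shows "pdet m (ycol n m) S = (\<Sum>p | p permutes {..<m}. signof p *
    (if \<forall>i<m. S ! p i \<le> n + i then Poly_Mapping.single (\<Sum>i<m. yexp n m (S ! p i) i) 1 else 0))"
  unfolding pdet_def
  by (subst fdet_transpose[symmetric]) (simp add: fdet_leibniz prod_ycol atLeast0LessThan)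

text \<open>Every Leibniz term takes its k(S) entries of Z from different rows, and at most
  \<open>r\<close> of these rows lie before row \<open>r\<close>.\<close>

lemma pdet_ycol_order:
  assumes S: "S \<in> col_lists n m"
  shows "pdet m (ycol n m) S \<in> order_ge (zvars n m r) (xcount n S - r)"
  unfolding pdet_ycol[OF S]
proof (intro is_ideal_sum is_idealD(3)[OF is_ideal_order_ge] is_ideal_order_ge)
  fix p assume "p \<in> {p. p permutes {..<m}}"
  then have p: "p permutes {..<m}" by simp
  have lt: "p i < m" if "i < m" for i using permutes_in_image[OF p, of i] that by simp
  have "{i. i < m \<and> S ! p i < n} = {i. i < m \<and> p i < xcount n S}"
    using nth_less_iff_xcount[OF S] lt by auto
  also have "p ` \<dots> = {..<xcount n S}"
  proof (intro equalityI subsetI)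
    fix j assume "j \<in> {..<xcount n S}"
    then have "j < m" "j < xcount n S" using xcount_le[OF S] by auto
    then obtain i where "i < m" "p i = j"
      using permutes_image[OF p] by (metis imageE lessThan_iff)
    then show "j \<in> p ` {i. i < m \<and> p i < xcount n S}" using \<open>j < xcount n S\<close> by auto
  qed auto
  finally have card: "card {i. i < m \<and> S ! p i < n} = xcount n S"
    using card_image[of p "{i. i < m \<and> S ! p i < n}"] permutes_inj[OF p] inj_on_subset by fastforce
  have "{i. i < m \<and> S ! p i < n} \<subseteq> {i. i < m \<and> r \<le> i \<and> S ! p i < n} \<union> {..<r}" by auto
  then have "xcount n S \<le> card ({i. i < m \<and> r \<le> i \<and> S ! p i < n} \<union> {..<r})"
    unfolding card[symmetric] by (intro card_mono) auto
  also have "\<dots> \<le> card {i. i < m \<and> r \<le> i \<and> S ! p i < n} + r"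
    using card_Un_le[of _ "{..<r}"] by simp
  finally have "xcount n S - r \<le> degree_in (zvars n m r) (\<Sum>i<m. yexp n m (S ! p i) i)"
    using degree_in_sum_yexp[of m "\<lambda>i. S ! p i" n r] col_listsD(3)[OF S] lt by simp
  then show "(if \<forall>i<m. S ! p i \<le> n + i then Poly_Mapping.single (\<Sum>i<m. yexp n m (S ! p i) i) 1 else 0)
      \<in> order_ge (zvars n m r) (xcount n S - r)"
    using order_ge_single is_idealD(1)[OF is_ideal_order_ge] by auto
qed

text \<open>In the first row \<open>a\<close> moved by a permutation, the diagonal term uses an
  earlier column than the permuted term, hence an earlier variable.\<close>

lemma lead_pdet_ycol:
  assumes S: "S \<in> col_lists n m" shows "lead (pdet m (ycol n m) S) (diag_exp n m S)"
proof -
  define T :: "(nat \<Rightarrow> nat) \<Rightarrow> (nat, 'a) mpoly" where "T p = signof p *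
    (if \<forall>i<m. S ! p i \<le> n + i then Poly_Mapping.single (\<Sum>i<m. yexp n m (S ! p i) i) 1 else 0)" for p
  have fin: "finite {p. p permutes {..<m}}" by (simp add: finite_permutations)
  have "T id = Poly_Mapping.single (diag_exp n m S) 1"
    using col_lists_nth_le[OF S] by (simp add: T_def diag_exp_def)
  moreover have "pdet m (ycol n m) S = T id + (\<Sum>p\<in>{p. p permutes {..<m}} - {id}. T p)"
    unfolding pdet_ycol[OF S] T_def[symmetric] using fin by (intro sum.remove) (auto simp: permutes_id)
  ultimately have eq: "pdet m (ycol n m) S - Poly_Mapping.single (diag_exp n m S) 1 =
      (\<Sum>p\<in>{p. p permutes {..<m}} - {id}. T p)" by simp
  have less: "(\<Sum>i<m. yexp n m (S ! p i) i) < diag_exp n m S"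
    if p: "p permutes {..<m}" "p \<noteq> id" and le: "\<forall>i<m. S ! p i \<le> n + i" for p
  proof -
    have lt: "p i < m" if "i < m" for i using permutes_in_image[OF p(1), of i] that by simp
    have ex: "\<exists>i. p i \<noteq> i" using p(2) by (auto simp: fun_eq_iff)
    define a where "a = (LEAST i. p i \<noteq> i)"
    have a: "p a \<noteq> a" unfolding a_def by (rule LeastI_ex[OF ex])
    have below: "p i = i" if "i < a" for i using not_less_Least[of i] that by (auto simp: a_def)
    have am: "a < m" using a permutes_not_in[OF p(1), of a] by auto
    have pa: "a < p a"
    proof (rule ccontr)
      assume "\<not> a < p a"
      then have "p a < a" using a by simp
      then have "p (p a) = p a" by (rule below)
      then show False using a permutes_inj[OF p(1)] by (auto dest: injD)
    qed
    then have Sa: "S ! a < S ! p a" using col_lists_nth_mono[OF S _ lt[OF am]] by simp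
    \<comment> \<open>Since \<open>S ! p a\<close> is at most \<open>n + a\<close>, the smaller
      \<open>S ! a\<close> is strictly below it: the diagonal entry in row \<open>a\<close> is a
      variable and not the 1 of \<open>L\<close>.\<close>
    then have Sn: "S ! a < n + a" using le am by fastforce
    have c: "\<And>i. i < m \<Longrightarrow> S ! p i < n + m" "\<And>i. i < m \<Longrightarrow> S ! i < n + m"
      using col_listsD(3)[OF S] lt by auto
    \<comment> \<open>The variable of the diagonal entry in row \<open>a\<close>, the first one at
      which the two exponents differ.\<close>
    let ?k = "a * (n + m) + S ! a"
    show ?thesis unfolding less_poly_mapping.rep_eq diag_exp_def
    proof (rule less_funI, intro exI conjI allI impI)
      have "S ! a < n + m" using c(2)[OF am] .
      then show "Poly_Mapping.lookup (\<Sum>i<m. yexp n m (S ! p i) i) ?k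
          < Poly_Mapping.lookup (\<Sum>i<m. yexp n m (S ! i) i) ?k"
        using Sa Sn am by (simp add: lookup_sum_yexp[OF c(1)] lookup_sum_yexp[OF c(2)])
    next
      fix k assume k: "k < ?k"
      define u where "u = k div (n + m)"
      define w where "w = k mod (n + m)"
      have k_eq: "k = u * (n + m) + w" unfolding u_def w_def by (rule div_mult_mod_eq[symmetric])
      have w: "w < n + m" unfolding w_def using am by (intro mod_less_divisor) simp
      have "u < a \<or> u = a \<and> w < S ! a"
      proof -
        have "u \<le> a"
        proof (rule ccontr)
          assume "\<not> u \<le> a"
          then have "Suc a * (n + m) \<le> u * (n + m)" by (intro mult_le_mono1) simp
          then show False using k c(2)[OF am] k_eq by simp
        qed
        then show ?thesis using k k_eq by (cases "u = a") auto
      qed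
      then show "Poly_Mapping.lookup (\<Sum>i<m. yexp n m (S ! p i) i) k
          = Poly_Mapping.lookup (\<Sum>i<m. yexp n m (S ! i) i) k"
        unfolding k_eq using below Sa w by (auto simp: lookup_sum_yexp[OF c(1)] lookup_sum_yexp[OF c(2)])
    qed
  qed
  show ?thesis unfolding lead_def eq
  proof
    fix \<kappa> assume "\<kappa> \<in> Poly_Mapping.keys (\<Sum>p\<in>{p. p permutes {..<m}} - {id}. T p)"
    then obtain p where p: "p permutes {..<m}" "p \<noteq> id" "\<kappa> \<in> Poly_Mapping.keys (T p)"
      using keys_sum[of T "{p. p permutes {..<m}} - {id}"] by blast
    have "T p \<in> {0, Poly_Mapping.single (\<Sum>i<m. yexp n m (S ! p i) i) 1,
        - Poly_Mapping.single (\<Sum>i<m. yexp n m (S ! p i) i) 1}"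
      using sgn_eq_pm_one[of p, where ?'r = "(nat, 'a) mpoly"] by (auto simp: T_def)
    moreover have "\<forall>i<m. S ! p i \<le> n + i" using p(3) by (auto simp: T_def split: if_splits)
    ultimately show "\<kappa> < diag_exp n m S" using p less by (auto split: if_splits)
  qed
qed

section \<open>Standard products and their leading monomials\<close>

lemma lead_prod_mset:
  "(\<And>x. x \<in># M \<Longrightarrow> lead (f x) (\<mu> x)) \<Longrightarrow> lead (\<Prod>x\<in>#M. f x) (\<Sum>x\<in>#M. \<mu> x)"
  by (induction M) (simp_all add: lead_1 lead_mult)

lemma order_ge_prod_mset:
  "(\<And>x. x \<in># M \<Longrightarrow> f x \<in> order_ge B (s x)) \<Longrightarrow> (\<Prod>x\<in>#M. f x) \<in> order_ge B (\<Sum>x\<in>#M. s x)"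
  by (induction M) (simp_all add: order_ge_0 order_ge_mult)

lemma degree_in_sum_mset: "degree_in B (\<Sum>x\<in>#M. \<mu> x) = (\<Sum>x\<in>#M. degree_in B (\<mu> x))"
  by (induction M) (simp_all add: degree_in_add)

text \<open>The length is fixed because the list of unit columns gives the minor 1 and may be added
  to any chain without changing the product or its leading monomial.\<close>

definition standard :: "nat \<Rightarrow> nat \<Rightarrow> nat \<Rightarrow> nat list multiset set" where
  "standard n m d = {M. size M = d \<and> set_mset M \<subseteq> col_lists n m \<and>
    (\<forall>S\<in>#M. \<forall>T\<in>#M. list_all2 (\<le>) S T \<or> list_all2 (\<le>) T S)}"

lemma finite_standard: "finite (standard n m d)"
proof -
  have "finite (col_lists n m)"
    using finite_lists_length_eq[of "{..<n + m}" m] unfolding col_lists_def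
    by (rule rev_finite_subset) auto
  then have "finite {M. set_mset M \<subseteq> col_lists n m \<and> size M = d}" by (rule finite_multisets_of_size[unfolded multisets_of_size_def])
  then show ?thesis by (rule rev_finite_subset) (auto simp: standard_def)
qed

lemma chain_greatest:
  fixes M :: "nat list multiset"
  assumes "M \<noteq> {#}" "\<And>S. S \<in># M \<Longrightarrow> length S = m"
    "\<And>S T. S \<in># M \<Longrightarrow> T \<in># M \<Longrightarrow> list_all2 (\<le>) S T \<or> list_all2 (\<le>) T S"
  shows "\<exists>S\<in>#M. \<forall>T\<in>#M. \<forall>q<m. T ! q \<le> S ! q"
  using assms
proof (induction M)
  case (add S M)
  show ?case
  proof (cases "M = {#}")
    case False
    then obtain U where U: "U \<in># M" "\<forall>T\<in>#M. \<forall>q<m. T ! q \<le> U ! q"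
      using add.IH add.prems(2,3) by force
    have "list_all2 (\<le>) S U \<or> list_all2 (\<le>) U S" using add.prems(3) U(1) by simp
    then show ?thesis
    proof
      assume "list_all2 (\<le>) S U"
      then show ?thesis using U add.prems(2) by (intro bexI[of _ U]) (auto simp: list_all2_conv_all_nth)
    next
      assume "list_all2 (\<le>) U S"
      then have "\<forall>q<m. U ! q \<le> S ! q" using add.prems(2) U(1) by (auto simp: list_all2_conv_all_nth)
      then show ?thesis using U(2) by (intro bexI[of _ S]) (auto intro: order_trans)
    qed
  qed simp
qed simp

text \<open>The greatest member of a chain has the maximal entry at every position, so the multisets
  of entries determine it; remove it and repeat.\<close>

lemma chain_eqI:
  fixes M M' :: "nat list multiset"
  assumes "size M = d" "size M' = d" "\<And>S. S \<in># M + M' \<Longrightarrow> length S = m"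
    "\<And>S T. S \<in># M \<Longrightarrow> T \<in># M \<Longrightarrow> list_all2 (\<le>) S T \<or> list_all2 (\<le>) T S"
    "\<And>S T. S \<in># M' \<Longrightarrow> T \<in># M' \<Longrightarrow> list_all2 (\<le>) S T \<or> list_all2 (\<le>) T S"
    "\<And>q. q < m \<Longrightarrow> image_mset (\<lambda>S. S ! q) M = image_mset (\<lambda>S. S ! q) M'"
  shows "M = M'"
  using assms
proof (induction d arbitrary: M M')
  case (Suc d)
  have ne: "M \<noteq> {#}" "M' \<noteq> {#}" using Suc.prems(1,2) by auto
  obtain S where S: "S \<in># M" "\<forall>T\<in>#M. \<forall>q<m. T ! q \<le> S ! q"
    using chain_greatest[OF ne(1), of m] Suc.prems(3,4) by auto
  obtain S' where S': "S' \<in># M'" "\<forall>T\<in>#M'. \<forall>q<m. T ! q \<le> S' ! q"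
    using chain_greatest[OF ne(2), of m] Suc.prems(3,5) by auto
  have "S ! q = S' ! q" if q: "q < m" for q
  proof (rule antisym)
    have "S ! q \<in># image_mset (\<lambda>S. S ! q) M'" using S(1) by (simp flip: Suc.prems(6)[OF q])
    then show "S ! q \<le> S' ! q" using S'(2) q by auto
    have "S' ! q \<in># image_mset (\<lambda>S. S ! q) M" using S'(1) by (simp add: Suc.prems(6)[OF q])
    then show "S' ! q \<le> S ! q" using S(2) q by auto
  qed
  then have eq: "S = S'" using Suc.prems(3) S(1) S'(1) by (intro nth_equalityI) auto
  obtain N N' where N: "M = add_mset S N" "M' = add_mset S N'"
    using S(1) S'(1) eq by (metis insert_DiffM)
  have "N = N'"
    by (rule Suc.IH) (use Suc.prems N in \<open>auto\<close>)
  then show ?case using N by simp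
qed simp

lemma lookup_sum_mset: "Poly_Mapping.lookup (\<Sum>x\<in>#M. f x) k = (\<Sum>x\<in>#M. Poly_Mapping.lookup (f x) k)"
  by (induction M) (simp_all add: lookup_add)

lemma sum_mset_indicator:
  "(\<Sum>x\<in>#M. if f x = b then 1 else (0::nat)) = count (image_mset f M) b"
  by (induction M) auto

text \<open>For \<open>b < n + q\<close> the exponent of the variable in row \<open>q\<close> and
  column \<open>b\<close> counts the lists with \<open>q\<close>-th entry \<open>b\<close>, and a
  chain is determined by these counts at all positions.\<close>

lemma inj_on_diag_exp: "inj_on (\<lambda>M. \<Sum>S\<in>#M. diag_exp n m S) (standard n m d)"
proof (rule inj_onI)
  fix M M' assume M: "M \<in> standard n m d" and M': "M' \<in> standard n m d"
    and eq: "(\<Sum>S\<in>#M. diag_exp n m S) = (\<Sum>S\<in>#M'. diag_exp n m S)"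
  have count: "Poly_Mapping.lookup (\<Sum>S\<in>#K. diag_exp n m S) (q * (n + m) + b) =
      count (image_mset (\<lambda>S. S ! q) K) b"
    if K: "K \<in> standard n m d" and q: "q < m" and b: "b < n + q" for K q b
  proof -
    have "Poly_Mapping.lookup (diag_exp n m S) (q * (n + m) + b) = (if S ! q = b then 1 else 0)"
      if "S \<in># K" for S
    proof -
      have "S \<in> col_lists n m" using K that by (auto simp: standard_def)
      then show ?thesis using lookup_sum_yexp[of m "(!) S" n b q] col_listsD(3) q b
        by (simp add: diag_exp_def)
    qed
    then have "(\<Sum>S\<in>#K. Poly_Mapping.lookup (diag_exp n m S) (q * (n + m) + b)) =
        (\<Sum>S\<in>#K. if S ! q = b then 1 else 0)"
      by (intro arg_cong[where f = sum_mset] image_mset_cong)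
    then show ?thesis by (simp only: lookup_sum_mset sum_mset_indicator)
  qed
  have le: "b \<le> n + q" if "K \<in> standard n m d" "q < m" "b \<in># image_mset (\<lambda>S. S ! q) K" for K q b
    using that col_lists_nth_le by (fastforce simp: standard_def)
  have "image_mset (\<lambda>S. S ! q) M = image_mset (\<lambda>S. S ! q) M'" if q: "q < m" for q
  proof -
    let ?f = "\<lambda>K. image_mset (\<lambda>S. S ! q) K"
    have lt: "filter_mset (\<lambda>b. b < n + q) (?f M) = filter_mset (\<lambda>b. b < n + q) (?f M')"
    proof (rule multiset_eqI)
      fix b
      show "count (filter_mset (\<lambda>b. b < n + q) (?f M)) b = count (filter_mset (\<lambda>b. b < n + q) (?f M')) b"
        by (cases "b < n + q") (simp_all add: count[OF M q, symmetric] count[OF M' q, symmetric] eq)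
    qed
    \<comment> \<open>The only further value is \<open>n + q\<close>, the entry 1 of
      \<open>L\<close>, which no exponent records; its multiplicity is what is missing to
      \<open>d\<close>.\<close>
    have split: "?f K = filter_mset (\<lambda>b. b < n + q) (?f K) +
        replicate_mset (d - size (filter_mset (\<lambda>b. b < n + q) (?f K))) (n + q)"
      if K: "K \<in> standard n m d" for K
    proof -
      let ?h = "filter_mset (\<lambda>b. \<not> b < n + q) (?f K)"
      have part: "?f K = filter_mset (\<lambda>b. b < n + q) (?f K) + ?h" by (rule multiset_partition)
      have "size (?f K) = d" using K by (simp add: standard_def)
      then have "size ?h = d - size (filter_mset (\<lambda>b. b < n + q) (?f K))"
        using arg_cong[OF part, of size] by (simp only: size_union)
      moreover have "set_mset ?h \<subseteq> {n + q}" using le[OF K q] by fastforce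
      then have "?h = replicate_mset (size ?h) (n + q)" by (simp add: set_mset_subset_singletonD)
      ultimately show ?thesis using part by metis
    qed
    show ?thesis by (subst split[OF M], subst split[OF M']) (simp only: lt)
  qed
  then show "M = M'"
    using M M' by (intro chain_eqI[of M d M' m]) (auto simp: standard_def col_lists_def)
qed

section \<open>Vanishing orders along matrices of bounded rank\<close>

text \<open>Rows and columns are numbered through the enumerations of the finite index types, so
  that minors of X become instances of \<open>fdet\<close>.\<close>

definition xvar :: "nat \<Rightarrow> nat \<Rightarrow> ('m::finite \<times> 'n::finite, 'a::comm_ring_1) mpoly" where
  "xvar i j = Var (from_nat_into UNIV i, from_nat_into UNIV j)"

text \<open>The columns of the matrix \<open>(X | 1)\<close>, whose maximal minors are the minors of \<open>X\<close> up to
  sign.\<close>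

definition xcol :: "nat \<Rightarrow> nat \<Rightarrow> ('m::finite \<times> 'n::finite, 'a::comm_ring_1) mpoly" where
  "xcol c i = (if c < CARD('n) then xvar i c else if c = CARD('n) + i then 1 else 0)"

text \<open>The adjugate of \<open>L\<close>, which is its inverse because \<open>L\<close> has determinant \<open>1\<close>.\<close>

definition unitri_inv :: "nat \<Rightarrow> nat \<Rightarrow> nat \<Rightarrow> nat \<Rightarrow> (nat, 'a::comm_ring_1) mpoly" where
  "unitri_inv n m i j = fcof (m - 1) (\<lambda>a b. ycol n m (n + a) b) i j"

text \<open>The substitution \<open>X = L\<^sup>-\<^sup>1 Z\<close>.\<close>

definition factor_map :: "('m::finite \<times> 'n::finite, 'a::comm_ring_1) mpoly \<Rightarrow> (nat, 'a) mpoly" where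
  "factor_map = poly_subst (\<lambda>(a, b). \<Sum>l<CARD('m).
     unitri_inv CARD('n) CARD('m) (to_nat_on UNIV a) l *
     ycol CARD('n) CARD('m) (to_nat_on UNIV b) l)"

lemma to_nat_on_from_nat_into_card:
  "i < CARD('m::finite) \<Longrightarrow> to_nat_on (UNIV :: 'm set) (from_nat_into UNIV i) = i"
  using to_nat_on_finite[of "UNIV :: 'm set"] by (intro to_nat_on_from_nat_into) (auto simp: bij_betw_def)

lemma inj_on_from_nat_into_card: "inj_on (from_nat_into (UNIV :: 'm::finite set)) {..<CARD('m)}"
  using to_nat_on_from_nat_into_card by (metis inj_onI lessThan_iff)

lemma factor_map_xvar:
  assumes "i < CARD('m::finite)" "j < CARD('n::finite)"
  shows "factor_map (xvar i j :: ('m \<times> 'n, 'a::comm_ring_1) mpoly) =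
    (\<Sum>l<CARD('m). unitri_inv CARD('n) CARD('m) i l * ycol CARD('n) CARD('m) j l)"
  using assms by (simp add: factor_map_def xvar_def to_nat_on_from_nat_into_card)

interpretation factor_map: comm_ring_hom "factor_map :: ('m::finite \<times> 'n::finite, 'a::comm_ring_1) mpoly \<Rightarrow> _"
  unfolding factor_map_def by (rule poly_subst.comm_ring_hom_axioms)

lemma factor_map_Const [simp]: "factor_map (Const c) = Const c"
  by (simp add: factor_map_def)

lemma fdet_unitri: "fdet k (\<lambda>a b. ycol n m (n + a) b) = 1"
  by (rule fdet_upper_unitriangular) (auto simp: ycol_def)

text \<open>\<open>ycol n m (n + a) b\<close> is the entry of \<open>L\<close> in row
  \<open>b\<close> and column \<open>a\<close>. The cofactors are thus taken in the transpose, which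
  makes them the entries of the adjugate in the right order, and the sum is an entry of
  \<open>L\<close> times its adjugate.\<close>

lemma unitri_inv:
  assumes "i < m" "j < m"
  shows "(\<Sum>l<m. ycol n m (n + l) i * unitri_inv n m l j) =
    (if i = j then 1 else (0 :: (nat, 'a::comm_ring_1) mpoly))"
proof -
  obtain k where m: "m = Suc k" using assms by (cases m) auto
  let ?f = "\<lambda>a b. ycol n m (n + a) b :: (nat, 'a) mpoly"
  have *: "(\<Sum>l<m. ycol n m (n + l) i * unitri_inv n m l j) =
      (\<Sum>l<Suc k. ?f l i * fcof k ?f l j)"
    by (simp add: unitri_inv_def m)
  show ?thesis
  proof (cases "i = j")
    case True
    then have "(\<Sum>l<Suc k. ?f l i * fcof k ?f l j) = fdet (Suc k) ?f"
      using fdet_laplace_column[of j k ?f] assms by (simp only: m)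
    then show ?thesis using True * by (simp only: fdet_unitri simp_thms if_True)
  next
    case False
    then show ?thesis using fcof_column_orthogonal[of j k i ?f] assms unfolding * by (simp add: m del: sum.lessThan_Suc)
  qed
qed

lemma factor_map_pdet:
  fixes S
  assumes S: "length S = CARD('m::finite)" "set S \<subseteq> {..<CARD('n::finite) + CARD('m)}"
  shows "factor_map (pdet CARD('m) xcol S :: ('m \<times> 'n, 'a::comm_ring_1) mpoly) =
    pdet CARD('m) (ycol CARD('n) CARD('m)) S"
proof -
  let ?m = "CARD('m)" and ?n = "CARD('n)"
  let ?X = "xcol :: nat \<Rightarrow> nat \<Rightarrow> ('m \<times> 'n, 'a) mpoly"
  have entry: "(\<Sum>l<?m. factor_map (?X c l) * ycol ?n ?m (?n + l) i) = ycol ?n ?m c i"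
    if c: "c < ?n + ?m" and i: "i < ?m" for c i
  proof (cases "c < ?n")
    case True
    then have "(\<Sum>l<?m. factor_map (?X c l) * ycol ?n ?m (?n + l) i) =
        (\<Sum>l<?m. \<Sum>t<?m. ycol ?n ?m c t * (ycol ?n ?m (?n + l) i * unitri_inv ?n ?m l t))"
      by (intro sum.cong refl) (simp add: xcol_def factor_map_xvar sum_distrib_left sum_distrib_right algebra_simps)
    also have "\<dots> = (\<Sum>t<?m. ycol ?n ?m c t * (\<Sum>l<?m. ycol ?n ?m (?n + l) i * unitri_inv ?n ?m l t))"
      by (subst sum.swap) (simp add: sum_distrib_left)
    also have "\<dots> = (\<Sum>t<?m. if t = i then ycol ?n ?m c i else 0)"
      using i by (intro sum.cong refl) (simp add: unitri_inv)
    finally show ?thesis using i by simp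
  next
    case False
    have "(\<Sum>l<?m. factor_map (?X c l) * ycol ?n ?m (?n + l) i) =
        (\<Sum>l<?m. if l = c - ?n then ycol ?n ?m c i else 0)"
      using False by (intro sum.cong refl) (auto simp: xcol_def)
    then show ?thesis using c False by simp
  qed
  have "pdet ?m (ycol ?n ?m) S =
      fdet ?m (\<lambda>q i. \<Sum>l<?m. factor_map (?X (S ! q) l) * ycol ?n ?m (?n + l) i)"
    unfolding pdet_def
  proof (rule fdet_cong)
    fix q i assume "q < ?m" "i < ?m"
    then have "S ! q < ?n + ?m" using S nth_mem[of q S] by (auto simp: subset_iff)
    then show "ycol ?n ?m (S ! q) i =
        (\<Sum>l<?m. factor_map (?X (S ! q) l) * ycol ?n ?m (?n + l) i)"
      using \<open>i < ?m\<close> by (rule entry[symmetric])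
  qed
  also have "\<dots> = fdet ?m (\<lambda>q i. factor_map (?X (S ! q) i))"
    by (simp add: fdet_mult[of ?m "\<lambda>q i. factor_map (?X (S ! q) i)" "\<lambda>l. ycol ?n ?m (?n + l)"] fdet_unitri)
  finally show ?thesis
    by (simp add: pdet_def fdet_hom[OF factor_map.comm_ring_hom_axioms])
qed

text \<open>Spanning is expressed as membership in every such set that contains the products. It can
  then be applied directly to ideals and to sets of multipliers.\<close>

definition lin_closed :: "('v, 'a::comm_ring_1) mpoly set \<Rightarrow> bool" where
  "lin_closed V \<longleftrightarrow> 0 \<in> V \<and> (\<forall>a\<in>V. \<forall>b\<in>V. a + b \<in> V) \<and> (\<forall>c. \<forall>a\<in>V. Const c * a \<in> V)"

lemma lin_closed_sum: "lin_closed V \<Longrightarrow> (\<And>x. x \<in> A \<Longrightarrow> f x \<in> V) \<Longrightarrow> sum f A \<in> V"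
  by (rule sum_closed) (auto simp: lin_closed_def)

lemma lin_closed_ideal: "is_ideal I \<Longrightarrow> lin_closed I"
  by (simp add: lin_closed_def is_idealD)

lemma pdet_identity_columns:
  "pdet CARD('m) xcol [CARD('n)..<CARD('n) + CARD('m)] = (1 :: ('m::finite \<times> 'n::finite, 'a::comm_ring_1) mpoly)"
  unfolding pdet_def by (rule fdet_upper_unitriangular) (auto simp: xcol_def)

text \<open>A permutation other than the identity moves some index besides \<open>i\<close>, where
  it meets a zero of the identity matrix.\<close>

lemma fdet_identity_row_replaced:
  assumes i: "i < k" and f: "\<And>q l. q < k \<Longrightarrow> l < k \<Longrightarrow> q \<noteq> i \<Longrightarrow> f q l = (if q = l then 1 else 0)"
  shows "fdet k f = f i i"
proof -
  have "(\<Prod>q<k. f q (p q)) = 0" if p: "p permutes {..<k}" "p \<noteq> id" for p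
  proof -
    have "\<exists>q. q \<noteq> i \<and> p q \<noteq> q"
    proof (rule ccontr)
      assume "\<not> ?thesis"
      then have stable: "p q = q" if "q \<noteq> i" for q using that by blast
      have "p i = i"
      proof (rule ccontr)
        assume "p i \<noteq> i"
        then have "p (p i) = p i" by (rule stable)
        then show False using permutes_inj[OF p(1)] \<open>p i \<noteq> i\<close> by (auto dest: injD)
      qed
      then show False using stable p(2) by (metis eq_id_iff)
    qed
    then obtain q where q: "q \<noteq> i" "p q \<noteq> q" by blast
    then have "q < k" using permutes_not_in[OF p(1), of q] by auto
    moreover have "p q < k" using permutes_in_image[OF p(1), of q] \<open>q < k\<close> by simp
    ultimately show ?thesis using q f by (intro prod_zero bexI[of _ q]) auto
  qed
  then have "(\<Sum>p\<in>{p. p permutes {..<k}} - {id}. signof p * (\<Prod>q<k. f q (p q))) = 0"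
    by (intro sum.neutral) auto
  then have "fdet k f = (\<Prod>q<k. f q q)"
    unfolding fdet_leibniz atLeast0LessThan
    by (subst sum.remove[of _ id]) (auto simp: finite_permutations permutes_id)
  also have "\<dots> = f i i * (\<Prod>q\<in>{..<k} - {i}. f q q)" using i by (intro prod.remove) auto
  also have "(\<Prod>q\<in>{..<k} - {i}. f q q) = 1" using f by (intro prod.neutral) auto
  finally show ?thesis by simp
qed

lemma pdet_single_variable:
  assumes "i < CARD('m::finite)" "j < CARD('n::finite)"
  shows "pdet CARD('m) xcol ([CARD('n)..<CARD('n) + CARD('m)][i := j]) =
    (xvar i j :: ('m \<times> 'n, 'a::comm_ring_1) mpoly)"
  unfolding pdet_def
  by (subst fdet_identity_row_replaced[of i]) (use assms in \<open>auto simp: xcol_def\<close>)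

text \<open>All products of a fixed, sufficiently large number of maximal minors span: some of the
  factors may be the maximal minor \<open>1\<close>.\<close>

lemma minor_products_span:
  fixes f :: "('m::finite \<times> 'n::finite, 'a::comm_ring_1) mpoly"
  shows "\<exists>d. \<forall>e\<ge>d. \<forall>V. lin_closed V \<longrightarrow>
    (\<forall>M. size M = e \<and> (\<forall>S\<in>#M. length S = CARD('m) \<and> set S \<subseteq> {..<CARD('n) + CARD('m)}) \<longrightarrow>
      (\<Prod>S\<in>#M. pdet CARD('m) xcol S) \<in> V) \<longrightarrow> f \<in> V"
    (is "\<exists>d. \<forall>e\<ge>d. \<forall>V. lin_closed V \<longrightarrow> ?all e V \<longrightarrow> f \<in> V")
proof -
  let ?m = "CARD('m)" and ?n = "CARD('n)"
  define valid where "valid e M \<longleftrightarrow> size M = e \<and> (\<forall>S\<in>#M. length S = ?m \<and> set S \<subseteq> {..<?n + ?m})" for e M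
  define prd where "prd M = (\<Prod>S\<in>#M. pdet ?m xcol S :: ('m \<times> 'n, 'a) mpoly)" for M
  \<comment> \<open>Asking for every length \<open>e\<close> from \<open>d\<close> on, not for one
    length, lets two polynomials with different bounds be treated at a common length.\<close>
  define spans where "spans p d \<longleftrightarrow> (\<forall>e\<ge>d. \<forall>V. lin_closed V \<longrightarrow> (\<forall>M. valid e M \<longrightarrow> prd M \<in> V) \<longrightarrow> p \<in> V)" for p d
  define I where "I = [?n..<?n + ?m]"
  have I: "valid e (replicate_mset e I)" "prd (replicate_mset e I) = 1" for e
    by (auto simp: valid_def prd_def I_def pdet_identity_columns)
  have "\<exists>d. spans f d"
  proof (induction f rule: mpoly_induct)
    case (Const c)
    have "Const c \<in> V" if "lin_closed V" "\<forall>M. valid e M \<longrightarrow> prd M \<in> V" for e V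
    proof -
      have "1 \<in> V" using that(2) I by metis
      then have "Const c * 1 \<in> V" using that(1) by (simp only: lin_closed_def)
      then show ?thesis by simp
    qed
    then show ?case by (auto simp: spans_def)
  next
    case (Var ab)
    obtain a b where ab: "ab = (a, b)" by (cases ab)
    define i where "i = to_nat_on UNIV a"
    define j where "j = to_nat_on UNIV b"
    have i: "i < ?m" "from_nat_into UNIV i = a"
      using to_nat_on_finite[of "UNIV :: 'm set"] by (auto simp: bij_betw_def i_def)
    have j: "j < ?n" "from_nat_into UNIV j = b"
      using to_nat_on_finite[of "UNIV :: 'n set"] by (auto simp: bij_betw_def j_def)
    have eq: "Var ab = (xvar i j :: ('m \<times> 'n, 'a) mpoly)" by (simp add: ab xvar_def i j)
    have "spans (Var ab) 1" unfolding spans_def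
    proof (intro allI impI)
      fix e V assume e: "1 \<le> e" and V: "\<forall>M. valid e M \<longrightarrow> prd M \<in> V"
      let ?M = "add_mset (I[i := j]) (replicate_mset (e - 1) I)"
      have "set (I[i := j]) \<subseteq> insert j (set I)" by (rule set_update_subset_insert)
      also have "\<dots> \<subseteq> {..<?n + ?m}" using j by (auto simp: I_def)
      finally have "valid e ?M" using e by (auto simp: valid_def I_def)
      moreover have "prd ?M = Var ab"
        using I(2)[of "e - 1"] pdet_single_variable[OF i(1) j(1), where ?'a = 'a]
        by (simp add: prd_def eq I_def)
      ultimately show "Var ab \<in> V" using V by metis
    qed
    then show ?case ..
  next
    case (add p q)
    then obtain d d' where dd': "spans p d" "spans q d'" by blast
    have "spans (p + q) (max d d')" unfolding spans_def
    proof (intro allI impI)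
      fix e V assume *: "max d d' \<le> e" "lin_closed V" "\<forall>M. valid e M \<longrightarrow> prd M \<in> V"
      then have "p \<in> V" "q \<in> V" using dd' by (auto simp: spans_def)
      then show "p + q \<in> V" using *(2) by (simp add: lin_closed_def)
    qed
    then show ?case ..
  next
    case (mult p q)
    then obtain d d' where dd': "spans p d" "spans q d'" by blast
    have "spans (p * q) (d + d')" unfolding spans_def
    proof (intro allI impI)
      fix e V assume *: "d + d' \<le> e" "lin_closed V" "\<forall>M. valid e M \<longrightarrow> prd M \<in> V"
      \<comment> \<open>Multipliers into \<open>V\<close> again form a closed set, so the factors
        can be treated one at a time: \<open>d\<close> minors for \<open>p\<close>, the remaining
        \<open>e - d\<close> for \<open>q\<close>.\<close>
      have lin: "lin_closed {x. x * y \<in> V}" for y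
        using *(2) by (simp add: lin_closed_def distrib_right mult.assoc)
      have "prd M * q \<in> V" if M: "valid d M" for M
      proof -
        have "q * prd M \<in> V"
        proof (rule CollectD, rule dd'(2)[unfolded spans_def, rule_format])
          show "d' \<le> e - d" using *(1) by simp
          show "lin_closed {x. x * prd M \<in> V}" by (rule lin)
          fix M' assume "valid (e - d) M'"
          then have "valid e (M' + M)" using M *(1) by (auto simp: valid_def)
          then have "prd (M' + M) \<in> V" using *(3) by blast
          then show "prd M' \<in> {x. x * prd M \<in> V}" by (simp add: prd_def)
        qed
        then show ?thesis by (simp add: mult.commute)
      qed
      then show "p * q \<in> V"
        using dd'(1)[unfolded spans_def, rule_format, of d "{x. x * q \<in> V}"] lin by simp
    qed
    then show ?case ..
  qed
  then show ?thesis by (simp add: spans_def valid_def prd_def)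
qed

text \<open>Straightening replaces two factors by two factors, so the common length \<open>d\<close>
  of the spanning products is kept.\<close>

lemma standard_expansion:
  fixes f :: "('m::finite \<times> 'n::finite, 'a::comm_ring_1) mpoly"
  shows "\<exists>d c. f = (\<Sum>M\<in>standard CARD('n) CARD('m) d. Const (c M) * (\<Prod>S\<in>#M. pdet CARD('m) xcol S))"
proof -
  let ?m = "CARD('m)" and ?n = "CARD('n)"
  let ?prd = "\<lambda>M. (\<Prod>S\<in>#M. pdet ?m xcol S :: ('m \<times> 'n, 'a) mpoly)"
  obtain d where "\<forall>e\<ge>d. \<forall>V. lin_closed V \<longrightarrow>
    (\<forall>M. size M = e \<and> (\<forall>S\<in>#M. length S = ?m \<and> set S \<subseteq> {..<?n + ?m}) \<longrightarrow> ?prd M \<in> V) \<longrightarrow> f \<in> V"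
    using minor_products_span[of f] by (elim exE)
  then have d: "f \<in> V" if "lin_closed V"
    "\<And>M. size M = d \<Longrightarrow> \<forall>S\<in>#M. length S = ?m \<and> set S \<subseteq> {..<?n + ?m} \<Longrightarrow> ?prd M \<in> V" for V
    using that by blast
  define V where "V = range (\<lambda>c. \<Sum>M\<in>standard ?n ?m d. Const (c M) * ?prd M)"
  have VI: "x \<in> V" if "x = (\<Sum>M\<in>standard ?n ?m d. Const (c M) * ?prd M)" for x c
    using that by (auto simp: V_def)
  have V: "lin_closed V" unfolding lin_closed_def
  proof (intro conjI ballI allI)
    show "0 \<in> V" by (rule VI[of _ "\<lambda>_. 0"]) (simp add: Const_hom)
  next
    fix a b assume "a \<in> V" "b \<in> V"
    then obtain c c' where "a = (\<Sum>M\<in>standard ?n ?m d. Const (c M) * ?prd M)"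
      "b = (\<Sum>M\<in>standard ?n ?m d. Const (c' M) * ?prd M)" by (auto simp: V_def)
    then show "a + b \<in> V"
      by (intro VI[of _ "\<lambda>M. c M + c' M"]) (simp add: Const_hom distrib_right sum.distrib)
  next
    fix k a assume "a \<in> V"
    then obtain c where "a = (\<Sum>M\<in>standard ?n ?m d. Const (c M) * ?prd M)" by (auto simp: V_def)
    then show "Const k * a \<in> V"
      by (intro VI[of _ "\<lambda>M. k * c M"]) (simp add: Const_hom sum_distrib_left mult.assoc)
  qed
  have "f \<in> V"
  proof (rule d[OF V])
    fix M assume M: "size M = d" "\<forall>S\<in>#M. length S = ?m \<and> set S \<subseteq> {..<?n + ?m}"
    show "?prd M \<in> V"
    proof (rule straightening[OF _ _ _ _ M])
      show "0 \<in> V" "\<And>a b. a \<in> V \<Longrightarrow> b \<in> V \<Longrightarrow> a + b \<in> V" using V by (simp_all add: lin_closed_def)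
      fix a assume "a \<in> V"
      then have "Const (- 1) * a \<in> V" using V unfolding lin_closed_def by blast
      then show "- a \<in> V" by (simp add: Const_hom)
    next
      fix M assume M: "size M = d" "\<forall>S\<in>#M. length S = ?m \<and> set S \<subseteq> {..<?n + ?m} \<and> sorted_wrt (<) S"
        "\<forall>S\<in>#M. \<forall>T\<in>#M. list_all2 (\<le>) S T \<or> list_all2 (\<le>) T S"
      then have "M \<in> standard ?n ?m d" by (auto simp: standard_def col_lists_def)
      then have "?prd M = (\<Sum>K\<in>standard ?n ?m d. if K = M then ?prd M else 0)"
        by (simp add: finite_standard)
      also have "\<dots> = (\<Sum>K\<in>standard ?n ?m d. Const (if K = M then 1 else 0) * ?prd K)"
        by (intro sum.cong) (auto simp: Const_hom)
      finally show "?prd M \<in> V" by (rule VI)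
    qed
  qed
  then show ?thesis by (auto simp: V_def)
qed

text \<open>Setting the rows \<open>i \<ge> r\<close> of \<open>Z\<close> to zero turns \<open>L\<^sup>-\<^sup>1 Z\<close> into a generic matrix of rank
  at most \<open>r\<close>, so this is the vanishing order along these matrices.\<close>

definition det_order :: "nat \<Rightarrow> nat \<Rightarrow> ('m::finite \<times> 'n::finite, 'a::comm_ring_1) mpoly set" where
  "det_order r s = {f. factor_map f \<in> order_ge (zvars CARD('n) CARD('m) r) s}"

lemma lookup_Const_mult:
  fixes F :: "('v, 'a::comm_ring_1) mpoly"
  shows "Poly_Mapping.lookup (Const c * F) \<mu> = c * Poly_Mapping.lookup F \<mu>"
proof -
  have "Poly_Mapping.lookup (Const c * F) (0 + \<mu>) =
      Poly_Mapping.lookup (Const c :: ('v, 'a) mpoly) 0 * Poly_Mapping.lookup F \<mu>"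
    by (rule lookup_mult_unique) (auto simp: Const_def split: if_splits)
  then show ?thesis by (simp add: Const_def)
qed

text \<open>No standard product of order below \<open>s\<close> occurs in the expansion of
  \<open>f\<close>. Among those that did, take the one with the largest leading monomial: the other
  low ones have smaller leading monomials by injectivity, and the remaining products contain only
  monomials of degree at least \<open>s\<close>. So this monomial would survive in
  \<open>factor_map f\<close>, although its degree is below \<open>s\<close>.\<close>

lemma det_order_induct:
  fixes f :: "('m::finite \<times> 'n::finite, 'a::comm_ring_1) mpoly"
  assumes f: "f \<in> det_order r s" and V: "lin_closed V"
    and prd: "\<And>M. set_mset M \<subseteq> col_lists CARD('n) CARD('m) \<Longrightarrow> s \<le> (\<Sum>S\<in>#M. xcount CARD('n) S - r) \<Longrightarrow>
      (\<Prod>S\<in>#M. pdet CARD('m) xcol S) \<in> V"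
  shows "f \<in> V"
proof -
  let ?m = "CARD('m)" and ?n = "CARD('n)"
  let ?prd = "\<lambda>M. (\<Prod>S\<in>#M. pdet ?m xcol S :: ('m \<times> 'n, 'a) mpoly)"
  let ?Y = "\<lambda>M. (\<Prod>S\<in>#M. pdet ?m (ycol ?n ?m) S :: (nat, 'a) mpoly)"
  let ?\<mu> = "\<lambda>M. \<Sum>S\<in>#M. diag_exp ?n ?m S"
  let ?w = "\<lambda>M. \<Sum>S\<in>#M. xcount ?n S - r"
  obtain d c where f_eq: "f = (\<Sum>M\<in>standard ?n ?m d. Const (c M) * ?prd M)"
    using standard_expansion by blast
  have col: "S \<in> col_lists ?n ?m" if "M \<in> standard ?n ?m d" "S \<in># M" for M S
    using that by (auto simp: standard_def)
  have fm: "factor_map (?prd M) = ?Y M" if "M \<in> standard ?n ?m d" for M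
  proof -
    have "factor_map (?prd M) = (\<Prod>S\<in>#M. factor_map (pdet ?m xcol S :: ('m \<times> 'n, 'a) mpoly))"
      by (induction M) (simp_all add: factor_map.hom_mult)
    also have "\<dots> = ?Y M"
      using col[OF that]
      by (intro arg_cong[where f = prod_mset] image_mset_cong factor_map_pdet) (auto simp: col_lists_def)
    finally show ?thesis .
  qed
  have F: "factor_map f = (\<Sum>M\<in>standard ?n ?m d. Const (c M) * ?Y M)"
    unfolding f_eq by (simp add: factor_map.hom_sum factor_map.hom_mult fm)
  have deg: "degree_in (zvars ?n ?m r) (?\<mu> M) = ?w M" if "M \<in> standard ?n ?m d" for M
    unfolding degree_in_sum_mset using col[OF that]
    by (intro arg_cong[where f = sum_mset] image_mset_cong degree_in_diag_exp)
  have lead: "lead (?Y M) (?\<mu> M)" if "M \<in> standard ?n ?m d" for M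
    using col[OF that] by (intro lead_prod_mset lead_pdet_ycol)
  have ord: "?Y M \<in> order_ge (zvars ?n ?m r) (?w M)" if "M \<in> standard ?n ?m d" for M
    using col[OF that] by (intro order_ge_prod_mset pdet_ycol_order)
  have zero: "c M = 0" if "M \<in> standard ?n ?m d" "\<not> s \<le> ?w M" for M
  proof (rule ccontr)
    assume "c M \<noteq> 0"
    define A where "A = {M \<in> standard ?n ?m d. c M \<noteq> 0 \<and> \<not> s \<le> ?w M}"
    have "finite A" "A \<noteq> {}" using that \<open>c M \<noteq> 0\<close> finite_standard by (auto simp: A_def)
    then have "Max (?\<mu> ` A) \<in> ?\<mu> ` A" by (intro Max_in) auto
    then obtain M0 where M0: "M0 \<in> A" "?\<mu> M0 = Max (?\<mu> ` A)" by auto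
    have max: "?\<mu> K \<le> ?\<mu> M0" if "K \<in> A" for K
      unfolding M0(2) using that \<open>finite A\<close> by (intro Max_ge) auto
    have M0': "M0 \<in> standard ?n ?m d" "c M0 \<noteq> 0" "\<not> s \<le> ?w M0" using M0(1) by (auto simp: A_def)
    have "c K * Poly_Mapping.lookup (?Y K) (?\<mu> M0) = (if K = M0 then c M0 else 0)"
      if K: "K \<in> standard ?n ?m d" for K
    proof (cases "K = M0")
      case True
      then show ?thesis using lead_lookup[OF lead[OF K]] by simp
    next
      case False
      consider "c K = 0" | "s \<le> ?w K" | "K \<in> A" using K by (auto simp: A_def)
      then show ?thesis
      proof cases
        case 2
        then have "\<not> ?w K \<le> degree_in (zvars ?n ?m r) (?\<mu> M0)" using M0'(3) deg[OF M0'(1)] by simp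
        then have "?\<mu> M0 \<notin> Poly_Mapping.keys (?Y K)" using ord[OF K] unfolding order_ge_def by blast
        then show ?thesis using False by (simp add: in_keys_iff)
      next
        case 3
        have "?\<mu> K \<noteq> ?\<mu> M0" using inj_onD[OF inj_on_diag_exp _ K M0'(1)] False by blast
        then have "?\<mu> K < ?\<mu> M0" using max[OF 3] by simp
        then show ?thesis using lead_lookup_less[OF lead[OF K]] False by simp
      qed (use False in simp)
    qed
    then have "Poly_Mapping.lookup (factor_map f) (?\<mu> M0) =
        (\<Sum>K\<in>standard ?n ?m d. if K = M0 then c M0 else 0)"
      unfolding F lookup_sum lookup_Const_mult by (rule sum.cong[OF refl])
    also have "\<dots> = c M0" using M0'(1) finite_standard by simp
    finally have "?\<mu> M0 \<in> Poly_Mapping.keys (factor_map f)" using M0'(2) by (simp add: in_keys_iff)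
    then have "s \<le> degree_in (zvars ?n ?m r) (?\<mu> M0)"
      using f by (auto simp: det_order_def order_ge_def)
    then show False using M0'(3) deg[OF M0'(1)] by simp
  qed
  show ?thesis unfolding f_eq
  proof (rule lin_closed_sum[OF V])
    fix M assume M: "M \<in> standard ?n ?m d"
    show "Const (c M) * ?prd M \<in> V"
    proof (cases "s \<le> ?w M")
      case True
      then have "?prd M \<in> V" using M by (intro prd) (auto simp: standard_def)
      then show ?thesis using V by (simp add: lin_closed_def)
    next
      case False
      then show ?thesis using zero[OF M] V by (simp add: Const_hom lin_closed_def)
    qed
  qed
qed

lemma is_ideal_det_order: "is_ideal (det_order r s)"
  using is_idealD[OF is_ideal_order_ge]
  by (intro is_idealI) (auto simp: det_order_def factor_map.hom_add factor_map.hom_mult)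

lemma det_order_mult: "f \<in> det_order r s \<Longrightarrow> g \<in> det_order r t \<Longrightarrow> f * g \<in> det_order r (s + t)"
  by (simp add: det_order_def factor_map.hom_mult order_ge_mult)

lemma det_order_antimono: "s \<le> t \<Longrightarrow> f \<in> det_order r t \<Longrightarrow> f \<in> det_order r s"
  using order_ge_antimono by (auto simp: det_order_def)

lemma det_order_cancel:
  fixes f g :: "('m::finite \<times> 'n::finite, 'a::idom) mpoly"
  shows "g * f \<in> det_order r s \<Longrightarrow> g \<notin> det_order r 1 \<Longrightarrow> f \<in> det_order r s"
  using order_ge_cancel by (auto simp: det_order_def factor_map.hom_mult)

lemma one_notin_det_order: "(1 :: ('m::finite \<times> 'n::finite, 'a::comm_ring_1) mpoly) \<notin> det_order r 1"
  by (simp add: det_order_def one_notin_order_ge del: One_nat_def)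

lemma det_order_prime:
  "\<forall>f g. f * g \<in> det_order r 1 \<longrightarrow> f \<in> det_order r 1 \<or>
    g \<in> (det_order r 1 :: ('m::finite \<times> 'n::finite, 'a::idom) mpoly set)"
  using det_order_cancel by blast

lemma pdet_in_det_order:
  assumes "S \<in> col_lists CARD('n::finite) CARD('m::finite)"
  shows "(pdet CARD('m) xcol S :: ('m \<times> 'n, 'a::comm_ring_1) mpoly) \<in> det_order r (xcount CARD('n) S - r)"
  using pdet_ycol_order[OF assms, of r] assms
  by (simp add: det_order_def factor_map_pdet col_lists_def)

lemma prod_mset_in_det_order:
  assumes "set_mset M \<subseteq> col_lists CARD('n::finite) CARD('m::finite)"
  shows "(\<Prod>S\<in>#M. pdet CARD('m) xcol S :: ('m \<times> 'n, 'a::comm_ring_1) mpoly) \<in>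
    det_order r (\<Sum>S\<in>#M. xcount CARD('n) S - r)"
  using assms
proof (induction M)
  case empty
  show ?case by (simp add: det_order_def order_ge_0)
next
  case (add S M)
  then have "(pdet CARD('m) xcol S :: ('m \<times> 'n, 'a) mpoly) \<in> det_order r (xcount CARD('n) S - r)"
    by (intro pdet_in_det_order) auto
  with add show ?case by (simp add: det_order_mult)
qed

section \<open>Secant ideals and symbolic powers of the ideal of 2-minors\<close>

text \<open>Rows and columns are chosen by arbitrary injections. Their order affects only signs, and
  renumbering becomes composition.\<close>

definition minors_in :: "nat \<Rightarrow> ('m::finite \<times> 'n::finite, 'a::comm_ring_1) mpoly set \<Rightarrow> bool" where
  "minors_in N J \<longleftrightarrow> (\<forall>\<rho> \<gamma>. inj_on \<rho> {..<N} \<longrightarrow> \<rho> ` {..<N} \<subseteq> {..<CARD('m)} \<longrightarrow>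
    inj_on \<gamma> {..<N} \<longrightarrow> \<gamma> ` {..<N} \<subseteq> {..<CARD('n)} \<longrightarrow> fdet N (\<lambda>a b. xvar (\<rho> a) (\<gamma> b)) \<in> J)"

lemma minors_inD:
  fixes J :: "('m::finite \<times> 'n::finite, 'a::comm_ring_1) mpoly set"
  assumes "minors_in N J" "inj_on \<rho> {..<N}" "\<rho> ` {..<N} \<subseteq> {..<CARD('m)}"
    "inj_on \<gamma> {..<N}" "\<gamma> ` {..<N} \<subseteq> {..<CARD('n)}"
  shows "fdet N (\<lambda>a b. xvar (\<rho> a) (\<gamma> b)) \<in> J"
  using assms unfolding minors_in_def by blast

text \<open>The first \<open>N\<close> columns of an increasing list come from X, and Laplace
  expansion along them gives a combination of \<open>N\<close>-minors of X.\<close>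

lemma pdet_in_ideal_of_minors:
  fixes J :: "('m::finite \<times> 'n::finite, 'a::comm_ring_1) mpoly set"
  assumes J: "is_ideal J" "minors_in N J"
    and S: "S \<in> col_lists CARD('n) CARD('m)" "N \<le> xcount CARD('n) S"
  shows "pdet CARD('m) xcol S \<in> J"
  unfolding pdet_def
proof (rule fdet_mem_ideal_rows[OF J(1), of "{..<N}"])
  have N: "N \<le> CARD('m)" using S(2) xcount_le[OF S(1)] by simp
  then show "{..<N} \<subseteq> {..<CARD('m)}" by auto
  fix \<rho> \<gamma> :: "nat \<Rightarrow> nat"
  assume *: "inj_on \<rho> {..<card {..<N}}" "\<rho> ` {..<card {..<N}} = {..<N}"
    "inj_on \<gamma> {..<card {..<N}}" "\<gamma> ` {..<card {..<N}} \<subseteq> {..<CARD('m)}"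
  have \<rho>: "\<rho> a < N" if "a < N" for a using *(2) that by auto
  have lt: "S ! \<rho> a < CARD('n)" if "a < N" for a
    using nth_less_iff_xcount[OF S(1), of "\<rho> a"] \<rho>[OF that] N S(2) by simp
  have "fdet N (\<lambda>a b. xcol (S ! \<rho> a) (\<gamma> b)) = fdet N (\<lambda>a b. xvar (\<gamma> b) (S ! \<rho> a) :: ('m \<times> 'n, 'a) mpoly)"
    by (rule fdet_cong) (simp add: xcol_def lt)
  also have "\<dots> = fdet N (\<lambda>a b. xvar (\<gamma> a) (S ! \<rho> b))"
    by (rule fdet_transpose[symmetric])
  also have "\<dots> \<in> J"
  proof (rule minors_inD[OF J(2)])
    have "inj_on ((!) S) {..<N}"
      using col_lists_nth_mono[OF S(1)] N
      by (intro linorder_inj_onI) (metis lessThan_iff less_irrefl order_less_le_trans, auto)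
    then show "inj_on (\<lambda>b. S ! \<rho> b) {..<N}"
      using *(1,2) comp_inj_on[of \<rho> "{..<N}" "(!) S"] by (simp add: o_def)
    show "(\<lambda>b. S ! \<rho> b) ` {..<N} \<subseteq> {..<CARD('n)}" using lt by auto
  qed (use * in auto)
  finally show "fdet (card {..<N}) (\<lambda>a b. xcol (S ! \<rho> a) (\<gamma> b)) \<in> J" by simp
qed

section \<open>Minors in the secant ideals\<close>

abbreviation minors_ideal :: "('m::finite \<times> 'n::finite, 'a::comm_ring_1) mpoly set" where
  "minors_ideal \<equiv> generated_ideal (minors2 generic_matrix)"

lemma fdet_2: "fdet 2 f = f 0 0 * f 1 1 - f 0 1 * f 1 0"
  using fdet_laplace_row[of 0 1 f]
  by (simp add: numeral_2_eq_2 fcof_def fdet_1[unfolded One_nat_def] skip_def)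

text \<open>The entries \<open>u a * w b\<close> form a matrix of rank at most one.\<close>

lemma minors_ideal_vanish:
  fixes f :: "('m::finite \<times> 'n::finite, 'a::comm_ring_1) mpoly"
  assumes "f \<in> minors_ideal"
  shows "poly_subst (\<lambda>(a, b). u a * w b) f = 0"
  using _ assms
proof (rule poly_subst_generated)
  fix g :: "('m \<times> 'n, 'a) mpoly" assume "g \<in> minors2 generic_matrix"
  then show "poly_subst (\<lambda>(a, b). u a * w b) g = 0"
    by (auto simp: minors2_def generic_matrix_def Determinants.det_2 poly_subst_mult poly_subst.hom_minus)
qed

lemma two_minors_in: "minors_in 2 (minors_ideal :: ('m::finite \<times> 'n::finite, 'a::comm_ring_1) mpoly set)"
  unfolding minors_in_def
proof (intro allI impI)
  fix \<rho> \<gamma> :: "nat \<Rightarrow> nat"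
  assume \<rho>: "inj_on \<rho> {..<2}" "\<rho> ` {..<2} \<subseteq> {..<CARD('m)}"
    and \<gamma>: "inj_on \<gamma> {..<2}" "\<gamma> ` {..<2} \<subseteq> {..<CARD('n)}"
  \<comment> \<open>The type \<open>2\<close> has the elements 1 and 2, with which
    \<open>det_2\<close> expands; they stand for the positions 0 and 1.\<close>
  define \<rho>' :: "2 \<Rightarrow> 'm" where "\<rho>' p = from_nat_into UNIV (\<rho> (if p = 1 then 0 else 1))" for p
  define \<gamma>' :: "2 \<Rightarrow> 'n" where "\<gamma>' p = from_nat_into UNIV (\<gamma> (if p = 1 then 0 else 1))" for p
  have ne: "from_nat_into UNIV (\<rho> 0) \<noteq> (from_nat_into UNIV (\<rho> 1) :: 'm)"
    "from_nat_into UNIV (\<gamma> 0) \<noteq> (from_nat_into UNIV (\<gamma> 1) :: 'n)"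
    using \<rho> \<gamma> inj_onD[OF inj_on_from_nat_into_card[where ?'m = 'm], of "\<rho> 0" "\<rho> 1"]
      inj_onD[OF inj_on_from_nat_into_card[where ?'m = 'n], of "\<gamma> 0" "\<gamma> 1"]
      inj_onD[OF \<rho>(1), of 0 1] inj_onD[OF \<gamma>(1), of 0 1] by (auto simp: image_subset_iff)
  have two: "p = 1 \<or> p = 2" for p :: 2 by (rule exhaust_2)
  have "inj \<rho>'" "inj \<gamma>'"
    using ne two by (auto simp: inj_def \<rho>'_def \<gamma>'_def)
  then have "Determinants.det ((\<chi> p q. generic_matrix $ \<rho>' p $ \<gamma>' q) :: ('m \<times> 'n, 'a) mpoly ^ 2 ^ 2)
      \<in> minors_ideal"
    unfolding minors2_def
    by (intro subsetD[OF generated_ideal_self] CollectI exI[of _ \<rho>'] exI[of _ \<gamma>'] conjI refl)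
  also have "Determinants.det ((\<chi> p q. generic_matrix $ \<rho>' p $ \<gamma>' q) :: ('m \<times> 'n, 'a) mpoly ^ 2 ^ 2) =
      fdet 2 (\<lambda>a b. xvar (\<rho> a) (\<gamma> b))"
    by (simp add: Determinants.det_2 fdet_2 generic_matrix_def xvar_def \<rho>'_def \<gamma>'_def)
  finally show "fdet 2 (\<lambda>a b. xvar (\<rho> a) (\<gamma> b)) \<in> (minors_ideal :: ('m \<times> 'n, 'a) mpoly set)" .
qed

text \<open>Once the rows of Z from \<open>r\<close> on are killed, the product of the inverse of
  \<open>L\<close> with Z is a sum of \<open>r\<close> products column times row, that is, a sum of
  \<open>r\<close> points on which the 2-minors vanish.\<close>

lemma secant_subset_det_order:
  fixes f :: "('m::finite \<times> 'n::finite, 'a::comm_ring_1) mpoly"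
  assumes r: "r \<ge> 1" and f: "f \<in> secant_ideal minors_ideal r"
  shows "f \<in> det_order r 1"
proof -
  let ?m = "CARD('m)" and ?n = "CARD('n)"
  define kill :: "(nat, 'a) mpoly \<Rightarrow> (nat, 'a) mpoly" where
    "kill = poly_subst (\<lambda>v. if v \<in> zvars ?n ?m r then 0 else Var v)"
  define u :: "nat \<Rightarrow> 'm \<Rightarrow> (nat, 'a) mpoly" where
    "u k a = (if k < ?m then kill (unitri_inv ?n ?m (to_nat_on UNIV a) k) else 0)" for k a
  define w :: "nat \<Rightarrow> 'n \<Rightarrow> (nat, 'a) mpoly" where
    "w k b = kill (ycol ?n ?m (to_nat_on UNIV b) k)" for k b
  have w0: "w k b = 0" if "r \<le> k" for k b
  proof -
    have "to_nat_on UNIV b < ?n"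
      using to_nat_on_finite[of "UNIV :: 'n set"] by (auto simp: bij_betw_def)
    then show ?thesis using that
      by (simp add: w_def kill_def ycol_def zvars_def key_div_mod)
  qed
  have "poly_subst (\<lambda>x. \<Sum>k<r. (\<lambda>(a, b). u k a * w k b) x) f = 0"
    using f by (intro secant_ideal_vanish[OF r, of minors_ideal]) (auto simp: minors_ideal_vanish)
  also have "(\<lambda>x. \<Sum>k<r. (\<lambda>(a, b). u k a * w k b) x) =
      (\<lambda>(a, b). kill (\<Sum>l<?m. unitri_inv ?n ?m (to_nat_on UNIV a) l * ycol ?n ?m (to_nat_on UNIV b) l))"
  proof (rule ext, clarsimp)
    fix a b
    have "kill (\<Sum>l<?m. unitri_inv ?n ?m (to_nat_on UNIV a) l * ycol ?n ?m (to_nat_on UNIV b) l)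
        = (\<Sum>l<?m. u l a * w l b)"
      by (simp add: kill_def poly_subst.hom_sum poly_subst_mult u_def w_def)
    \<comment> \<open>Either of \<open>r\<close> and \<open>?m\<close> may be the larger. On the
      common range \<open>u\<close> vanishes from \<open>?m\<close> on and \<open>w\<close> from
      \<open>r\<close> on.\<close>
    also have "\<dots> = (\<Sum>l<?m + r. u l a * w l b)"
      by (intro sum.mono_neutral_left) (auto simp: u_def)
    also have "\<dots> = (\<Sum>l<r. u l a * w l b)"
      by (intro sum.mono_neutral_right) (auto simp: w0)
    finally show "(\<Sum>k<r. u k a * w k b) =
        kill (\<Sum>l<?m. unitri_inv ?n ?m (to_nat_on UNIV a) l * ycol ?n ?m (to_nat_on UNIV b) l)" ..
  qed
  finally have "kill (factor_map f) = 0"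
    by (simp add: kill_def factor_map_def poly_subst_poly_subst case_prod_unfold)
  then show ?thesis unfolding kill_def det_order_def by (intro CollectI order_ge_1I)
qed

text \<open>Modulo the join relations X is Y + Z. Splitting the rows of an (r + 2)-minor, either at
  least r + 1 rows come from Y, and Laplace expansion gives minors known by induction, or at least
  two come from Z, and it gives 2-minors.\<close>

lemma minors_in_secant:
  assumes "r \<ge> 1"
  shows "minors_in (Suc r) (secant_ideal (minors_ideal :: ('m::finite \<times> 'n::finite, 'a::comm_ring_1) mpoly set) r)"
  using assms
proof (induction r rule: nat_induct_at_least)
  case base
  show ?case using two_minors_in by (simp add: secant_ideal_def numeral_2_eq_2)
next
  case (Suc r)
  let ?I = "minors_ideal :: ('m \<times> 'n, 'a) mpoly set"
  let ?X = "xvar :: nat \<Rightarrow> nat \<Rightarrow> ('m \<times> 'n, 'a) mpoly"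
  define \<phi> :: "(('m \<times> 'n) \<Rightarrow> ('m \<times> 'n) join_var) \<Rightarrow> ('m \<times> 'n, 'a) mpoly \<Rightarrow> (('m \<times> 'n) join_var, 'a) mpoly"
    where "\<phi> J = poly_subst (\<lambda>a. Var (J a))" for J
  define A where "A = generated_ideal (\<phi> JY ` secant_ideal ?I r) + generated_ideal (\<phi> JZ ` ?I)
      + generated_ideal (range (\<lambda>a. Var (JX a) - Var (JY a) - Var (JZ a) :: (('m \<times> 'n) join_var, 'a) mpoly))"
  have A: "is_ideal A" unfolding A_def by (intro is_ideal_plus is_ideal_generated)
  have zero: "0 \<in> generated_ideal U" for U :: "(('m \<times> 'n) join_var, 'a) mpoly set"
    by (rule is_idealD(1)[OF is_ideal_generated])
  have AY: "\<phi> JY p \<in> A" if "p \<in> secant_ideal ?I r" for p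
  proof -
    have "\<phi> JY p + 0 + 0 \<in> A" unfolding A_def
      by (intro set_plus_intro zero subsetD[OF generated_ideal_self] imageI that)
    then show ?thesis by simp
  qed
  have AZ: "\<phi> JZ p \<in> A" if "p \<in> ?I" for p
  proof -
    have "0 + \<phi> JZ p + 0 \<in> A" unfolding A_def
      by (intro set_plus_intro zero subsetD[OF generated_ideal_self] imageI that)
    then show ?thesis by simp
  qed
  have AX: "Var (JX a) - Var (JY a) - Var (JZ a) \<in> A" for a
  proof -
    have "0 + 0 + (Var (JX a) - Var (JY a) - Var (JZ a)) \<in> A" unfolding A_def
      by (intro set_plus_intro zero subsetD[OF generated_ideal_self] range_eqI[OF refl])
    then show ?thesis by simp
  qed
  have \<phi>_fdet: "\<phi> J (fdet k g) = fdet k (\<lambda>i j. \<phi> J (g i j))" for J k g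
    unfolding \<phi>_def by (rule fdet_hom) (rule poly_subst.comm_ring_hom_axioms)
  show ?case unfolding minors_in_def
  proof (intro allI impI)
    fix \<rho> \<gamma> :: "nat \<Rightarrow> nat"
    assume \<rho>: "inj_on \<rho> {..<Suc (Suc r)}" "\<rho> ` {..<Suc (Suc r)} \<subseteq> {..<CARD('m)}"
      and \<gamma>: "inj_on \<gamma> {..<Suc (Suc r)}" "\<gamma> ` {..<Suc (Suc r)} \<subseteq> {..<CARD('n)}"
    define F where "F J a b = \<phi> J (?X (\<rho> a) (\<gamma> b))" for J a b
    have minor: "fdet k (\<lambda>a b. F J (\<rho>' a) (\<gamma>' b)) \<in> A"
      if "minors_in k B" "\<And>p. p \<in> B \<Longrightarrow> \<phi> J p \<in> A" "inj_on \<rho>' {..<k}" "\<rho>' ` {..<k} \<subseteq> {..<Suc (Suc r)}"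
        "inj_on \<gamma>' {..<k}" "\<gamma>' ` {..<k} \<subseteq> {..<Suc (Suc r)}" for k B J \<rho>' \<gamma>'
    proof -
      have "fdet k (\<lambda>a b. ?X (\<rho> (\<rho>' a)) (\<gamma> (\<gamma>' b))) \<in> B"
      proof (rule minors_inD[OF that(1)])
        show "inj_on (\<lambda>a. \<rho> (\<rho>' a)) {..<k}"
          using comp_inj_on[OF that(3) inj_on_subset[OF \<rho>(1) that(4)]] by (simp add: o_def)
        show "inj_on (\<lambda>a. \<gamma> (\<gamma>' a)) {..<k}"
          using comp_inj_on[OF that(5) inj_on_subset[OF \<gamma>(1) that(6)]] by (simp add: o_def)
        show "(\<lambda>a. \<rho> (\<rho>' a)) ` {..<k} \<subseteq> {..<CARD('m)}" "(\<lambda>a. \<gamma> (\<gamma>' a)) ` {..<k} \<subseteq> {..<CARD('n)}"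
          using that(4,6) \<rho>(2) \<gamma>(2) by blast+
      qed
      from that(2)[OF this] show ?thesis by (simp add: \<phi>_fdet F_def)
    qed
    have part: "fdet (Suc (Suc r)) (\<lambda>i. if i \<in> P then F JY i else F JZ i) \<in> A"
      if P: "P \<subseteq> {..<Suc (Suc r)}" for P
    proof -
      have finP: "finite P" using P finite_subset by blast
      have rows: "fdet (Suc (Suc r)) (\<lambda>i. if i \<in> P then F JY i else F JZ i) \<in> A"
        if R: "R \<subseteq> {..<Suc (Suc r)}" "card R = k" "\<And>i. i \<in> R \<Longrightarrow> (if i \<in> P then F JY i else F JZ i) = F J i"
          and B: "minors_in k B" "\<And>p. p \<in> B \<Longrightarrow> \<phi> J p \<in> A" for R k J B
      proof (rule fdet_mem_ideal_rows[OF A R(1)])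
        fix \<rho>' \<gamma>' :: "nat \<Rightarrow> nat"
        assume *: "inj_on \<rho>' {..<card R}" "\<rho>' ` {..<card R} = R"
          "inj_on \<gamma>' {..<card R}" "\<gamma>' ` {..<card R} \<subseteq> {..<Suc (Suc r)}"
        have "fdet (card R) (\<lambda>a b. (if \<rho>' a \<in> P then F JY (\<rho>' a) else F JZ (\<rho>' a)) (\<gamma>' b)) =
            fdet k (\<lambda>a b. F J (\<rho>' a) (\<gamma>' b))"
          unfolding R(2)
        proof (rule fdet_cong)
          fix i j assume "i < k"
          then have "\<rho>' i \<in> R" using *(2) R(2) by blast
          from R(3)[OF this] show "(if \<rho>' i \<in> P then F JY (\<rho>' i) else F JZ (\<rho>' i)) (\<gamma>' j) = F J (\<rho>' i) (\<gamma>' j)"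
            by simp
        qed
        also have "\<dots> \<in> A"
          by (rule minor[OF B]) (use * R in auto)
        finally show "fdet (card R) (\<lambda>a b. (if \<rho>' a \<in> P then F JY (\<rho>' a) else F JZ (\<rho>' a)) (\<gamma>' b)) \<in> A" .
      qed
      show ?thesis
      proof (cases "Suc r \<le> card P")
        case True
        then obtain R where "R \<subseteq> P" "card R = Suc r" using obtain_subset_with_card_n by metis
        then show ?thesis using P by (intro rows[OF _ _ _ Suc.IH AY]) auto
      next
        case False
        then have "2 \<le> card ({..<Suc (Suc r)} - P)" using P finP by (simp add: card_Diff_subset)
        then obtain R where "R \<subseteq> {..<Suc (Suc r)} - P" "card R = 2" using obtain_subset_with_card_n by metis
        then show ?thesis by (intro rows[OF _ _ _ two_minors_in AZ]) auto
      qed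
    qed
    have "fdet (Suc (Suc r)) (F JX) - fdet (Suc (Suc r)) (\<lambda>a b. F JY a b + F JZ a b) \<in> A"
    proof (rule fdet_cong_ideal[OF A])
      fix i j
      have "F JX i j - (F JY i j + F JZ i j) = F JX i j - F JY i j - F JZ i j" by simp
      also have "\<dots> \<in> A" using AX by (simp add: F_def \<phi>_def xvar_def)
      finally show "F JX i j - (F JY i j + F JZ i j) \<in> A" .
    qed
    moreover have "fdet (Suc (Suc r)) (\<lambda>a b. F JY a b + F JZ a b) \<in> A"
      unfolding fdet_add_rows by (intro is_ideal_sum[OF A] part) auto
    ultimately have "fdet (Suc (Suc r)) (F JX) \<in> A"
      using is_idealD(2)[OF A] by fastforce
    then have "\<phi> JX (fdet (Suc (Suc r)) (\<lambda>a b. ?X (\<rho> a) (\<gamma> b))) \<in> A"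
      by (simp add: \<phi>_fdet F_def[abs_def])
    then show "fdet (Suc (Suc r)) (\<lambda>a b. ?X (\<rho> a) (\<gamma> b)) \<in> secant_ideal ?I (Suc r)"
      by (simp add: secant_ideal_Suc[OF Suc.hyps] join_ideal_def A_def \<phi>_def)
  qed
qed

lemma prod_mset_in_ideal:
  assumes "is_ideal J" "x \<in># M" "f x \<in> J" shows "(\<Prod>x\<in>#M. f x) \<in> J"
proof -
  obtain M' where "M = add_mset x M'" using assms(2) by (metis insert_DiffM)
  then show ?thesis using is_idealD(4)[OF assms(1,3)] by simp
qed

lemma sum_mset_nonzero: "(\<Sum>x\<in>#M. f x :: nat) \<noteq> 0 \<Longrightarrow> \<exists>x\<in>#M. f x \<noteq> 0"
  by (induction M) auto

text \<open>A product of minors of positive order has a factor with k(S) > r, which expands into (r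
  + 1)-minors; these lie in the secant ideal.\<close>

lemma secant_eq_det_order:
  assumes r: "r \<ge> 1"
  shows "secant_ideal (minors_ideal :: ('m::finite \<times> 'n::finite, 'a::comm_ring_1) mpoly set) r = det_order r 1"
proof (intro equalityI subsetI)
  let ?J = "secant_ideal (minors_ideal :: ('m \<times> 'n, 'a) mpoly set) r"
  have J: "is_ideal ?J" by (intro is_ideal_secant is_ideal_generated)
  fix f :: "('m \<times> 'n, 'a) mpoly" assume "f \<in> det_order r 1"
  then show "f \<in> ?J"
  proof (rule det_order_induct[OF _ lin_closed_ideal[OF J]])
    fix M assume M: "set_mset M \<subseteq> col_lists CARD('n) CARD('m)" "1 \<le> (\<Sum>S\<in>#M. xcount CARD('n) S - r)"
    have "(\<Sum>S\<in>#M. xcount CARD('n) S - r) \<noteq> 0" using M(2) by linarith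
    from sum_mset_nonzero[OF this] obtain S where "S \<in># M" "xcount CARD('n) S - r \<noteq> 0" by blast
    then have "S \<in># M" "Suc r \<le> xcount CARD('n) S" by simp_all
    then show "(\<Prod>S\<in>#M. pdet CARD('m) xcol S) \<in> ?J"
      using M(1) by (intro prod_mset_in_ideal[OF J] pdet_in_ideal_of_minors[OF J minors_in_secant[OF r]]) auto
  qed
qed (rule secant_subset_det_order[OF r])

text \<open>Evaluate at the partial permutation matrix with ones at the places
  (\<open>\<rho> k\<close>, \<open>\<gamma> k\<close>): it is a sum of \<open>r\<close> matrices of
  rank one, so the secant ideal vanishes there, while the minor takes the value 1.\<close>

lemma minor_notin_det_order:
  assumes r: "r \<ge> 1" and \<rho>: "inj_on \<rho> {..<r}" "\<rho> ` {..<r} \<subseteq> {..<CARD('m::finite)}"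
    and \<gamma>: "inj_on \<gamma> {..<r}" "\<gamma> ` {..<r} \<subseteq> {..<CARD('n::finite)}"
  shows "(fdet r (\<lambda>a b. xvar (\<rho> a) (\<gamma> b)) :: ('m \<times> 'n, 'a::comm_ring_1) mpoly) \<notin> det_order r 1"
    (is "?g \<notin> _")
proof
  assume "?g \<in> det_order r 1"
  then have g: "?g \<in> secant_ideal minors_ideal r" by (simp only: secant_eq_det_order[OF r])
  define u :: "nat \<Rightarrow> 'm \<Rightarrow> (nat, 'a) mpoly" where "u k a = (if a = from_nat_into UNIV (\<rho> k) then 1 else 0)" for k a
  define w :: "nat \<Rightarrow> 'n \<Rightarrow> (nat, 'a) mpoly" where "w k b = (if b = from_nat_into UNIV (\<gamma> k) then 1 else 0)" for k b
  define \<sigma> where "\<sigma> x = (\<Sum>k<r. (\<lambda>(a, b). u k a * w k b) x)" for x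
  have "poly_subst \<sigma> ?g = 0" unfolding \<sigma>_def
    using g by (intro secant_ideal_vanish[OF r, of minors_ideal]) (auto simp: minors_ideal_vanish)
  moreover have "poly_subst \<sigma> ?g = fdet r (\<lambda>i j. \<sigma> (from_nat_into UNIV (\<rho> i), from_nat_into UNIV (\<gamma> j)))"
    by (simp add: fdet_hom[OF poly_subst.comm_ring_hom_axioms] xvar_def)
  moreover have "\<dots> = 1"
  proof -
    have u: "u k (from_nat_into UNIV (\<rho> i)) = (if k = i then 1 else 0)" if "k < r" "i < r" for k i
    proof -
      have "from_nat_into UNIV (\<rho> i) = (from_nat_into UNIV (\<rho> k) :: 'm) \<longleftrightarrow> k = i"
        using that \<rho> inj_onD[OF inj_on_from_nat_into_card[where ?'m = 'm], of "\<rho> i" "\<rho> k"]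
          inj_onD[OF \<rho>(1), of i k] by (auto simp: image_subset_iff)
      then show ?thesis by (simp add: u_def)
    qed
    have w: "w k (from_nat_into UNIV (\<gamma> i)) = (if k = i then 1 else 0)" if "k < r" "i < r" for k i
    proof -
      have "from_nat_into UNIV (\<gamma> i) = (from_nat_into UNIV (\<gamma> k) :: 'n) \<longleftrightarrow> k = i"
        using that \<gamma> inj_onD[OF inj_on_from_nat_into_card[where ?'m = 'n], of "\<gamma> i" "\<gamma> k"]
          inj_onD[OF \<gamma>(1), of i k] by (auto simp: image_subset_iff)
      then show ?thesis by (simp add: w_def)
    qed
    have "\<sigma> (from_nat_into UNIV (\<rho> i), from_nat_into UNIV (\<gamma> j)) = (if i = j then 1 else 0)"
      if "i < r" "j < r" for i j
    proof -
      have "\<sigma> (from_nat_into UNIV (\<rho> i), from_nat_into UNIV (\<gamma> j)) = (\<Sum>k<r. if k = i then if i = j then 1 else 0 else 0)"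
        unfolding \<sigma>_def using that by (intro sum.cong refl) (auto simp: u w)
      then show ?thesis using that by simp
    qed
    then show ?thesis by (intro fdet_upper_unitriangular) auto
  qed
  ultimately show False by simp
qed

section \<open>Symbolic powers of the secant ideals\<close>

lemma fcof_row_orthogonal:
  assumes "i < Suc k" "l < Suc k" "i \<noteq> l"
  shows "(\<Sum>j<Suc k. f l j * fcof k f i j) = 0"
proof -
  have "fcof k (\<lambda>a b. f b a) j i = fcof k f i j" for j
    using fdet_transpose[of k "\<lambda>a b. f (skip i a) (skip j b)"] by (simp add: fcof_def add.commute)
  then show ?thesis using fcof_column_orthogonal[OF assms, of "\<lambda>a b. f b a"] by simp
qed

text \<open>Bordering the minor \<open>g\<close> in the first \<open>r\<close> rows and columns by the last row and by column
  \<open>j\<close> gives \<open>\<mu> j = g * f k j + (a combination of the first r entries of column j)\<close>; against the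
  cofactors of the last row the second part contributes nothing.\<close>

lemma minor_times_determinant:
  fixes f :: "nat \<Rightarrow> nat \<Rightarrow> 'r::comm_ring_1"
  assumes r: "r \<le> k"
  shows "fdet r f * fdet (Suc k) f =
    (\<Sum>j<Suc k. fdet (Suc r) (\<lambda>a b. f (if a < r then a else k) (if b < r then b else j)) * fcof k f k j)"
proof -
  define h where "h j a b = f (if a < r then a else k) (if b < r then b else j)" for j a b
  \<comment> \<open>Only column \<open>r\<close> of \<open>h j\<close> depends on \<open>j\<close>,
    and these cofactors delete it, so 0 stands for any \<open>j\<close>.\<close>
  define c where "c i = fcof r (h 0) i r" for i
  have cof: "fcof r (h j) i r = c i" for i j
    unfolding c_def fcof_def by (rule arg_cong[where f = "\<lambda>x. _ * x"], rule fdet_cong) (simp add: h_def skip_def)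
  have cr: "c r = fdet r f"
    by (auto simp: c_def fcof_def h_def skip_def intro: fdet_cong simp flip: mult_2)
  have \<mu>: "fdet (Suc r) (h j) = (\<Sum>i<r. f i j * c i) + f k j * fdet r f" for j
    by (subst fdet_laplace_column[of r]) (simp_all add: cof cr, simp add: h_def)
  have "(\<Sum>j<Suc k. fdet (Suc r) (h j) * fcof k f k j) =
      (\<Sum>j<Suc k. \<Sum>i<r. c i * (f i j * fcof k f k j)) + fdet r f * (\<Sum>j<Suc k. f k j * fcof k f k j)"
    unfolding \<mu> by (simp add: distrib_right sum.distrib sum_distrib_left sum_distrib_right algebra_simps del: sum.lessThan_Suc)
  also have "(\<Sum>j<Suc k. \<Sum>i<r. c i * (f i j * fcof k f k j)) = (\<Sum>i<r. c i * (\<Sum>j<Suc k. f i j * fcof k f k j))"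
    by (subst sum.swap) (simp add: sum_distrib_left del: sum.lessThan_Suc)
  also have "\<dots> = 0"
    using r by (intro sum.neutral ballI) (simp add: fcof_row_orthogonal del: sum.lessThan_Suc)
  also have "(\<Sum>j<Suc k. f k j * fcof k f k j) = fdet (Suc k) f"
    by (rule fdet_laplace_row[symmetric]) simp
  finally show ?thesis by (simp add: h_def)
qed

text \<open>Induction on the size: an \<open>r\<close>-minor times an (N + 1)-minor is a sum of
  products of (r + 1)-minors, which lie in the prime, with \<open>N\<close>-minors, which lie in the
  symbolic power \<open>N - r\<close>. The \<open>r\<close>-minor is outside the prime and
  cancels.\<close>

lemma minors_in_symbolic_power:
  assumes r: "r \<ge> 1" and N: "r \<le> N"
  shows "minors_in N (symbolic_power (det_order r 1 :: ('m::finite \<times> 'n::finite, 'a::idom) mpoly set) (N - r))"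
  using N
proof (induction N rule: nat_induct_at_least)
  case base
  show ?case unfolding minors_in_def diff_self_eq_0
    by (simp only: symbolic_power_0[OF is_ideal_det_order one_notin_det_order det_order_prime]) simp
next
  case (Suc N)
  let ?P = "det_order r 1 :: ('m \<times> 'n, 'a) mpoly set"
  note prime = is_ideal_det_order one_notin_det_order det_order_prime
  show ?case unfolding minors_in_def
  proof (intro allI impI)
    fix \<rho> \<gamma> :: "nat \<Rightarrow> nat"
    assume \<rho>: "inj_on \<rho> {..<Suc N}" "\<rho> ` {..<Suc N} \<subseteq> {..<CARD('m)}"
      and \<gamma>: "inj_on \<gamma> {..<Suc N}" "\<gamma> ` {..<Suc N} \<subseteq> {..<CARD('n)}"
    define f :: "nat \<Rightarrow> nat \<Rightarrow> ('m \<times> 'n, 'a) mpoly" where "f a b = xvar (\<rho> a) (\<gamma> b)" for a b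
    have sub: "(\<lambda>a. \<rho> (p a)) ` {..<K} \<subseteq> {..<CARD('m)}" "inj_on (\<lambda>a. \<rho> (p a)) {..<K}"
      "(\<lambda>a. \<gamma> (p a)) ` {..<K} \<subseteq> {..<CARD('n)}" "inj_on (\<lambda>a. \<gamma> (p a)) {..<K}"
      if p: "inj_on p {..<K}" "p ` {..<K} \<subseteq> {..<Suc N}" for p K
    proof -
      show "(\<lambda>a. \<rho> (p a)) ` {..<K} \<subseteq> {..<CARD('m)}" "(\<lambda>a. \<gamma> (p a)) ` {..<K} \<subseteq> {..<CARD('n)}"
        using p(2) \<rho>(2) \<gamma>(2) by blast+
      show "inj_on (\<lambda>a. \<rho> (p a)) {..<K}" "inj_on (\<lambda>a. \<gamma> (p a)) {..<K}"
        using comp_inj_on[OF p(1) inj_on_subset[OF \<rho>(1) p(2)]]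
          comp_inj_on[OF p(1) inj_on_subset[OF \<gamma>(1) p(2)]] by (simp_all add: o_def)
    qed
    have \<mu>: "fdet (Suc r) (\<lambda>a b. f (if a < r then a else N) (if b < r then b else j)) \<in> ?P"
      if j: "j < Suc N" for j
    proof (cases "j < r")
      \<comment> \<open>Bordering by one of the first \<open>r\<close> columns repeats that
        column.\<close>
      case True
      have "fdet (Suc r) (\<lambda>b a. f (if a < r then a else N) (if b < r then b else j)) = 0"
        by (rule fdet_identical_rows[of j _ r]) (use True in auto)
      then show ?thesis
        using fdet_transpose[of "Suc r" "\<lambda>a b. f (if a < r then a else N) (if b < r then b else j)"]
          is_idealD(1)[OF is_ideal_det_order, of r 1] by simp
    next
      case False
      have "minors_in (Suc r) ?P" using minors_in_secant[OF r] by (simp only: secant_eq_det_order[OF r])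
      moreover have "inj_on (\<lambda>a. if a < r then a else i) {..<Suc r}"
        "(\<lambda>a. if a < r then a else i) ` {..<Suc r} \<subseteq> {..<Suc N}" if "r \<le> i" "i < Suc N" for i :: nat
        using that by (auto simp: inj_on_def split: if_splits)
      ultimately show ?thesis unfolding f_def
        using False j Suc.hyps by (intro minors_inD sub) auto
    qed
    have cof: "fcof N f N j \<in> symbolic_power ?P (N - r)" if j: "j < Suc N" for j
      unfolding fcof_def f_def
      by (intro is_idealD(3)[OF is_ideal_symbolic_power[OF prime]] minors_inD[OF Suc.IH] sub)
         (auto intro: inj_on_subset[OF inj_skip] skip_less)
    have "fdet r f * fdet (Suc N) f \<in> symbolic_power ?P (Suc (N - r))"
      unfolding minor_times_determinant[OF Suc.hyps]
    proof (intro is_ideal_sum is_ideal_symbolic_power[OF prime])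
      fix j assume "j \<in> {..<Suc N}"
      then show "fdet (Suc r) (\<lambda>a b. f (if a < r then a else N) (if b < r then b else j)) * fcof N f N j
          \<in> symbolic_power ?P (Suc (N - r))"
        using symbolic_power_mult[OF prime symbolic_power_1[OF prime \<mu>] cof, of j j] by simp
    qed
    moreover have "fdet r f \<notin> ?P" unfolding f_def
      using Suc.hyps sub[of "\<lambda>a. a" r] by (intro minor_notin_det_order r) auto
    ultimately have "fdet (Suc N) f \<in> symbolic_power ?P (Suc (N - r))"
      by (rule symbolic_power_cancel[OF prime])
    then show "fdet (Suc N) (\<lambda>a b. xvar (\<rho> a) (\<gamma> b)) \<in> symbolic_power ?P (Suc N - r)"
      using Suc.hyps by (simp add: f_def[abs_def] Suc_diff_le)
  qed
qed

text \<open>Ordinary powers have the right order, and a denominator, being of order 0, can be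
  cancelled. Conversely, membership of a product of minors is checked factor by factor.\<close>

lemma symbolic_power_det_order:
  assumes r: "r \<ge> 1"
  shows "symbolic_power (det_order r 1 :: ('m::finite \<times> 'n::finite, 'a::idom) mpoly set) s = det_order r s"
proof (intro equalityI subsetI)
  let ?P = "det_order r 1 :: ('m \<times> 'n, 'a) mpoly set"
  note prime = is_ideal_det_order one_notin_det_order det_order_prime
  fix f :: "('m \<times> 'n, 'a) mpoly"
  have power: "ideal_power ?P t \<subseteq> det_order r t" for t
  proof (induction t)
    case 0
    show ?case by (auto simp: det_order_def order_ge_0)
  next
    case (Suc t)
    have "a * b \<in> det_order r (Suc t)" if "a \<in> ideal_power ?P t" "b \<in> ?P" for a b
      using det_order_mult[OF subsetD[OF Suc that(1)] that(2)] by simp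
    then show ?case unfolding ideal_power_Suc
      by (intro ideal_times_subset is_ideal_det_order)
  qed
  {
    assume "f \<in> symbolic_power ?P s"
    then have "\<exists>g. g \<notin> ?P \<and> g * f \<in> ideal_power ?P s"
      by (simp only: symbolic_power_prime[OF prime] mem_Collect_eq)
    then obtain g where "g \<notin> ?P" "g * f \<in> det_order r s" using power by blast
    then show "f \<in> det_order r s" by (rule det_order_cancel[rotated])
  }
  assume "f \<in> det_order r s"
  then show "f \<in> symbolic_power ?P s"
  proof (rule det_order_induct[OF _ lin_closed_ideal[OF is_ideal_symbolic_power[OF prime]]])
    fix M assume M: "set_mset M \<subseteq> col_lists CARD('n) CARD('m)" "s \<le> (\<Sum>S\<in>#M. xcount CARD('n) S - r)"
    have "(\<Prod>S\<in>#M. pdet CARD('m) xcol S) \<in> symbolic_power ?P (\<Sum>S\<in>#M. xcount CARD('n) S - r)"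
      using M(1)
    proof (induction M)
      case empty
      show ?case by (simp only: symbolic_power_0[OF prime] image_mset_empty sum_mset.empty UNIV_I)
    next
      case (add S M)
      have "pdet CARD('m) xcol S \<in> symbolic_power ?P (xcount CARD('n) S - r)"
      proof (cases "r \<le> xcount CARD('n) S")
        case True
        then show ?thesis using add.prems
          by (intro pdet_in_ideal_of_minors[OF is_ideal_symbolic_power[OF prime] minors_in_symbolic_power[OF r]]) auto
      next
        case False
        \<comment> \<open>Minors smaller than \<open>r\<close> have truncated weight 0, and the
          symbolic power with exponent 0 is the whole ring.\<close>
        then have "xcount CARD('n) S - r = 0" by simp
        then show ?thesis by (simp only: symbolic_power_0[OF prime] UNIV_I)
      qed
      moreover have "(\<Prod>S\<in>#M. pdet CARD('m) xcol S) \<in> symbolic_power ?P (\<Sum>S\<in>#M. xcount CARD('n) S - r)"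
        using add.prems by (intro add.IH) simp
      ultimately show ?case
        unfolding image_mset_add_mset prod_mset.add_mset sum_mset.add_mset
        by (rule symbolic_power_mult[OF prime])
    qed
    then show "(\<Prod>S\<in>#M. pdet CARD('m) xcol S) \<in> symbolic_power ?P s"
      using symbolic_power_antimono[OF prime M(2)] by blast
  qed
qed

section \<open>The decomposition behind differential perfection\<close>

lemma det_order_decomposition:
  assumes r: "r \<ge> 1" and s: "s \<ge> 1"
  shows "det_order r s = det_order (r + s - 1) 1 +
    (\<Sum>i = 1..s - 1. ideal_times (det_order r i) (det_order r (s - i)
      :: ('m::finite \<times> 'n::finite, 'a::idom) mpoly set))" (is "_ = ?A + ?B")
proof
  have AB: "is_ideal ?A" "is_ideal ?B"
    by (intro is_ideal_det_order is_ideal_set_sum is_ideal_times)+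
  have zero: "0 \<in> ?A" "0 \<in> ?B" by (rule is_idealD(1)[OF AB(1)], rule is_idealD(1)[OF AB(2)])
  show "det_order r s \<subseteq> ?A + ?B"
  proof
    fix f :: "('m \<times> 'n, 'a) mpoly" assume "f \<in> det_order r s"
    then show "f \<in> ?A + ?B"
    proof (rule det_order_induct[OF _ lin_closed_ideal[OF is_ideal_plus[OF AB]]])
      fix M assume M: "set_mset M \<subseteq> col_lists CARD('n) CARD('m)" "s \<le> (\<Sum>S\<in>#M. xcount CARD('n) S - r)"
      let ?k = "\<lambda>S. xcount CARD('n) S - r"
      have "(\<Sum>S\<in>#M. ?k S) \<noteq> 0" using M(2) s by linarith
      from sum_mset_nonzero[OF this] obtain S where S: "S \<in># M" "?k S \<noteq> 0" by blast
      obtain M' where M': "M = add_mset S M'" using S(1) by (metis insert_DiffM)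
      show "(\<Prod>S\<in>#M. pdet CARD('m) xcol S) \<in> ?A + ?B"
      proof (cases "s \<le> ?k S")
        case True
        \<comment> \<open>Here k(S) is at least \<open>r + s\<close>, so this factor alone has
          positive order with respect to rank \<open>r + s - 1\<close>.\<close>
        have "(pdet CARD('m) xcol S :: ('m \<times> 'n, 'a) mpoly) \<in> det_order (r + s - 1) (xcount CARD('n) S - (r + s - 1))"
          using M S(1) by (intro pdet_in_det_order) auto
        moreover have "1 \<le> xcount CARD('n) S - (r + s - 1)" using True s by linarith
        ultimately have "(pdet CARD('m) xcol S :: ('m \<times> 'n, 'a) mpoly) \<in> ?A"
          by (rule det_order_antimono[rotated])
        then have "(\<Prod>S\<in>#M. pdet CARD('m) xcol S :: ('m \<times> 'n, 'a) mpoly) + 0 \<in> ?A + ?B"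
          by (intro set_plus_intro prod_mset_in_ideal[OF AB(1) S(1)] zero)
        then show ?thesis by simp
      next
        case False
        \<comment> \<open>The chosen factor has order strictly between 0 and \<open>s\<close>, and
          the other factors together supply at least the missing \<open>s - ?k S\<close>.\<close>
        have "(pdet CARD('m) xcol S :: ('m \<times> 'n, 'a) mpoly) \<in> det_order r (?k S)"
          using M S(1) by (intro pdet_in_det_order) auto
        moreover have "(\<Prod>S\<in>#M'. pdet CARD('m) xcol S :: ('m \<times> 'n, 'a) mpoly) \<in> det_order r (s - ?k S)"
        proof (rule det_order_antimono)
          show "(\<Prod>S\<in>#M'. pdet CARD('m) xcol S :: ('m \<times> 'n, 'a) mpoly) \<in> det_order r (\<Sum>S\<in>#M'. ?k S)"
            using M(1) M' by (intro prod_mset_in_det_order) auto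
          show "s - ?k S \<le> (\<Sum>S\<in>#M'. ?k S)" using M(2) M' by simp
        qed
        ultimately have "(\<Prod>S\<in>#M. pdet CARD('m) xcol S :: ('m \<times> 'n, 'a) mpoly) \<in>
            ideal_times (det_order r (?k S)) (det_order r (s - ?k S))"
          by (simp add: M' ideal_times_intro)
        moreover have "?k S \<in> {1..s - 1}" using False S(2) by auto
        ultimately have "(\<Prod>S\<in>#M. pdet CARD('m) xcol S :: ('m \<times> 'n, 'a) mpoly) \<in> ?B"
          using subsetD[OF subset_set_sum[of "{1..s - 1}" "?k S"
              "\<lambda>i. ideal_times (det_order r i) (det_order r (s - i) :: ('m \<times> 'n, 'a) mpoly set)"]]
          by (simp only: is_ideal_times is_ideal_det_order finite_atLeastAtMost)
        then have "0 + (\<Prod>S\<in>#M. pdet CARD('m) xcol S :: ('m \<times> 'n, 'a) mpoly) \<in> ?A + ?B"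
          by (intro set_plus_intro zero)
        then show ?thesis by simp
      qed
    qed
  qed
  have "?A \<subseteq> det_order r s"
  proof
    fix f assume "f \<in> ?A"
    then show "f \<in> det_order r s"
    proof (rule det_order_induct[OF _ lin_closed_ideal[OF is_ideal_det_order]])
      fix M assume M: "set_mset M \<subseteq> col_lists CARD('n) CARD('m)"
        "1 \<le> (\<Sum>S\<in>#M. xcount CARD('n) S - (r + s - 1))"
      have "(\<Sum>S\<in>#M. xcount CARD('n) S - (r + s - 1)) \<noteq> 0" using M(2) by linarith
      from sum_mset_nonzero[OF this] obtain S where S: "S \<in># M" "xcount CARD('n) S - (r + s - 1) \<noteq> 0" by blast
      \<comment> \<open>From k(S) > r + s - 1 follows that k(S) - r is at least \<open>s\<close>, so
        one such factor already gives the order.\<close>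
      then have le: "s \<le> xcount CARD('n) S - r" by linarith
      moreover have "(pdet CARD('m) xcol S :: ('m \<times> 'n, 'a) mpoly) \<in> det_order r (xcount CARD('n) S - r)"
        using M(1) S(1) by (intro pdet_in_det_order) auto
      ultimately have "(pdet CARD('m) xcol S :: ('m \<times> 'n, 'a) mpoly) \<in> det_order r s"
        by (rule det_order_antimono)
      then show "(\<Prod>S\<in>#M. pdet CARD('m) xcol S :: ('m \<times> 'n, 'a) mpoly) \<in> det_order r s"
        by (rule prod_mset_in_ideal[OF is_ideal_det_order S(1)])
    qed
  qed
  moreover have "?B \<subseteq> det_order r s"
  proof (intro set_sum_subset ideal_times_subset is_ideal_det_order)
    fix i and a b :: "('m \<times> 'n, 'a) mpoly"
    assume "i \<in> {1..s - 1}" "a \<in> det_order r i" "b \<in> det_order r (s - i)"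
    moreover from this have "i + (s - i) = s" by auto
    ultimately show "a * b \<in> det_order r s" using det_order_mult[of a r i b "s - i"] by simp
  qed
  ultimately have "?A + ?B \<subseteq> det_order r s + det_order r s" by (rule set_plus_mono2)
  also have "\<dots> \<subseteq> det_order r s"
    by (auto simp: set_plus_def intro: is_idealD(2)[OF is_ideal_det_order])
  finally show "?A + ?B \<subseteq> det_order r s" .
qed

theorem theorem5p5:
  shows "differentially_perfect
           (generated_ideal
             (minors2 (generic_matrix ::
               ('m::finite \<times> 'n::finite, 'k::alg_closed_field) mpoly ^ 'n ^ 'm)))"
  unfolding differentially_perfect_def r_differentially_perfect_def
proof (intro allI impI)
  fix r s :: nat assume rs: "r \<ge> 1" "s \<ge> 1"
  then have "r + s - 1 \<ge> 1" by simp
  then show "symbolic_power (secant_ideal (minors_ideal :: ('m \<times> 'n, 'k) mpoly set) r) s =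
      secant_ideal minors_ideal (r + s - 1) +
      (\<Sum>i = 1..s - 1. ideal_times (symbolic_power (secant_ideal minors_ideal r) i)
        (symbolic_power (secant_ideal minors_ideal r) (s - i)))"
    by (simp only: secant_eq_det_order rs symbolic_power_det_order det_order_decomposition[OF rs])
qed

end
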